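(* Let $(f_n)_{n\ge0}$ be a smartingale (with respect to $\mu$) with bounded differences $|\Delta f_n|\le L$ for all $n\ge 0$. Assume that there is a constant $C_D$ such that for every finite full chain of atoms, with its decomposition into fat full chains $\mathscr X_1,\mathscr X_2,\dots,\mathscr X_J$ and with $L_j$ and $X_j$ denoting the atoms of largest and smallest $\mu$-measure in $\mathscr X_j$, one has $$\operatorname{diam}(L_i)\sum_{j\le i}(\operatorname{diam}X_j)^{-1}\le C_D,\qquad 1\le i\le J.$$ Then, for some constant $r>0$, $$\limsup_{n\to\infty}\frac{f_n}{\sqrt{r\,S_n^2\log\log S_n^2}}\le1\qquad\mu\text{-a.s. on }\{S^2=\infty\},$$ where $S_n^2=\sum_{k\le n}(\mathbb E_k+\mathbb E_{k-1})(\Delta f_k)^2$ and $S^2=\sup_nS_n^2$.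
   Context: Setting. $\Omega\subset\mathbb R^d$ is convex and compact, $\mathscr F$ its Borel $\sigma$-algebra, $\mu$ a probability measure on $(\Omega,\mathscr F)$. $(\mathscr F_n)_{n\ge0}$ is a filtration with $\mathscr F_0=\{\emptyset,\Omega\}$ such that for $n\ge1$, $\mathscr F_n$ is generated by subdividing each atom $A$ of $\mathscr F_{n-1}$ into two atoms $A',A''$ of $\mathscr F_n$ with $\mu(A'')\ge\mu(A')>0$. $\mathscr A_n$ is the set of atoms of $\mathscr F_n$, $\mathscr A=\bigcup_n\mathscr A_n$. Every atom is convex, $\max_{A\in\mathscr A_n}\operatorname{diam}A\to0$, and $w(A)\ge c_4\operatorname{diam}A$ for all $A\in\mathscr A$ with a constant $c_4>0$, where $w(A)$ is the minimal distance between two parallel supporting hyperplanes of $A$. $S$ is a finite-dimensional vector space of real polynomials on $\Omega$ containing a function $g:\Omega\to[c_3,1]$ with $c_3>0$. With $\|f\|_A=\|f\|_{L^\infty(A)}$, there are constants $c_1,c_2\in(0,1]$ such that $\mu(\{\omega\in A:|f(\omega)|\ge c_1\|f\|_A\})\ge c_2\mu(A)$ for all $A\in\mathscr A$, $f\in S$. $\mathbb E_n$ is conditional expectation with respect to $\mathscr F_n$ and $\mu$. $S_n$ (as a space) consists of functions $f:\Omega\to\mathbb R$ that coincide on each $A\in\mathscr A_n$ with some element of $S$; $P_n$ is the orthogonal projection onto this space in $L^2(\mu)$, extended to $L^1(\mu)$. A sequence $(f_n)_{n\ge0}$ of integrable functions is a smartingale if $P_{n-1}f_n=f_{n-1}$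 for $n\ge1$. Put $\Delta f_n=f_n-f_{n-1}$, with the conventions $f_{-1}=0$ (so $\Delta f_0=f_0$) and $\mathbb E_{-1}=0$. Chains. A full chain is a decreasing sequence $(C_i)_{i=1}^N$ of atoms with $C_{i+1}\in\{C_i',C_i''\}$ for all $i<N$; it is fat if $\mu(C_N)\ge\mu(C_1)/2$. The decomposition of a finite full chain into fat full chains is: $i_0=1$, $i_k=\min\{n>i_{k-1}:\mu(C_n)<\frac12\mu(C_{i_{k-1}})\}$ as long as this exists, $\mathscr X_k=(C_i)_{i_{k-1}\le i<i_k}$, the last block running up to $C_N$. *)

theory Defs
  imports "HOL-Probability.Probability"
begin

section \<open>Atoms and binary filtrations\<close>

definition atoms :: "'a measure \<Rightarrow> 'a set set" where
  "atoms N = {A \<in> sets N. A \<noteq> {} \<and> (\<forall>B\<in>sets N. B \<subseteq> A \<longrightarrow> B = {} \<or> B = A)}"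

definition all_atoms :: "(nat \<Rightarrow> 'a measure) \<Rightarrow> 'a set set" where
  "all_atoms F = (\<Union>n. atoms (F n))"

text \<open>The functions \<open>lo\<close> and \<open>hi\<close> assign to an atom \<open>A\<close> its two parts \<open>A'\<close> and \<open>A''\<close>.\<close>

definition binary_filtration :: "'a measure \<Rightarrow> (nat \<Rightarrow> 'a measure) \<Rightarrow> bool" where
  "binary_filtration M F \<longleftrightarrow>
     filtration (space M) F \<and> (\<forall>n. subalgebra M (F n)) \<and>
     sets (F 0) = {{}, space M} \<and>
     (\<forall>n. \<exists>lo hi.
        (\<forall>A\<in>atoms (F n).
           lo A \<in> sets M \<and> hi A \<in> sets M \<and> lo A \<union> hi A = A \<and> lo A \<inter> hi A = {} \<and>
           0 < measure M (lo A) \<and> measure M (lo A) \<le> measure M (hi A)) \<and>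
        sets (F (Suc n)) = sigma_sets (space M) (\<Union>A\<in>atoms (F n). {lo A, hi A}))"


section \<open>Minimal width and sup norm\<close>

text \<open>The infimum runs over pairs of parallel hyperplanes that support \<open>A\<close> from opposite sides
  (so that \<open>A\<close> lies between them). As \<open>A\<close> need not be closed, a supporting hyperplane is
  only required to meet the closure of \<open>A\<close>.\<close>

definition min_width :: "'a::euclidean_space set \<Rightarrow> real" where
  "min_width A = Inf {setdist {x. u \<bullet> x = a} {x. u \<bullet> x = b} | u a b.
     u \<noteq> 0 \<and> (\<forall>x\<in>A. a \<le> u \<bullet> x \<and> u \<bullet> x \<le> b) \<and>
     closure A \<inter> {x. u \<bullet> x = a} \<noteq> {} \<and> closure A \<inter> {x. u \<bullet> x = b} \<noteq> {}}"

text \<open>The \<open>L\<^sup>\<infinity>\<close>-norm on \<open>A\<close>. It is applied to polynomials on bounded convex sets with nonempty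
  interior only; there the (Lebesgue) essential supremum is the supremum.\<close>

definition sup_norm_on :: "'a set \<Rightarrow> ('a \<Rightarrow> real) \<Rightarrow> real" where
  "sup_norm_on A p = (SUP x\<in>A. \<bar>p x\<bar>)"


section \<open>Smartingales\<close>

text \<open>The type of real functions is not an instance of \<^class>\<open>real_vector\<close> here, so
  finite-dimensional spaces of functions are written as sets of linear combinations of finitely
  many functions.\<close>

definition finite_dim_space :: "('a \<Rightarrow> real) set \<Rightarrow> bool" where
  "finite_dim_space S \<longleftrightarrow>
     (\<exists>B. finite B \<and> S = {p. \<exists>c. p = (\<lambda>x. \<Sum>b\<in>B. c b * b x)})"

definition piecewise_space :: "('a \<Rightarrow> real) set \<Rightarrow> 'a measure \<Rightarrow> ('a \<Rightarrow> real) set" where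
  "piecewise_space S N = {h. \<forall>A\<in>atoms N. \<exists>p\<in>S. \<forall>x\<in>A. h x = p x}"

text \<open>Orthogonal projection of \<open>f\<close> onto \<open>V\<close> with respect to \<open>M\<close>, determined up to null sets by
  \<open>f - h \<bottom> V\<close>. Since the elements of the spaces \<open>V\<close> used below are bounded, the same relation
  gives the extension of the projection from \<open>L\<^sup>2\<close> to \<open>L\<^sup>1\<close>.\<close>

definition orth_proj :: "'a measure \<Rightarrow> ('a \<Rightarrow> real) set \<Rightarrow> ('a \<Rightarrow> real) \<Rightarrow> 'a \<Rightarrow> real" where
  "orth_proj M V f = (SOME h. h \<in> V \<and> (\<forall>v\<in>V. (\<integral>x. (f x - h x) * v x \<partial>M) = 0))"

definition smartingale ::
  "'a measure \<Rightarrow> (nat \<Rightarrow> 'a measure) \<Rightarrow> ('a \<Rightarrow> real) set \<Rightarrow> (nat \<Rightarrow> 'a \<Rightarrow> real) \<Rightarrow> bool" where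
  "smartingale M F S f \<longleftrightarrow>
     (\<forall>n. integrable M (f n)) \<and>
     (\<forall>n\<ge>1. AE x in M. orth_proj M (piecewise_space S (F (n - 1))) (f n) x = f (n - 1) x)"

definition increment :: "(nat \<Rightarrow> 'a \<Rightarrow> real) \<Rightarrow> nat \<Rightarrow> 'a \<Rightarrow> real" where
  "increment f n x = (if n = 0 then f 0 x else f n x - f (n - 1) x)"

definition square_var ::
  "'a measure \<Rightarrow> (nat \<Rightarrow> 'a measure) \<Rightarrow> (nat \<Rightarrow> 'a \<Rightarrow> real) \<Rightarrow> nat \<Rightarrow> 'a \<Rightarrow> real" where
  "square_var M F f n x =
     (\<Sum>k\<le>n. real_cond_exp M (F k) (\<lambda>y. (increment f k y)\<^sup>2) x +
       (if k = 0 then 0 else real_cond_exp M (F (k - 1)) (\<lambda>y. (increment f k y)\<^sup>2) x))"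


section \<open>Chains of atoms\<close>

definition child_atom :: "(nat \<Rightarrow> 'a measure) \<Rightarrow> 'a set \<Rightarrow> 'a set \<Rightarrow> bool" where
  "child_atom F A B \<longleftrightarrow> (\<exists>n. A \<in> atoms (F n) \<and> B \<in> atoms (F (Suc n)) \<and> B \<subseteq> A)"

definition full_chain :: "(nat \<Rightarrow> 'a measure) \<Rightarrow> 'a set list \<Rightarrow> bool" where
  "full_chain F Cs \<longleftrightarrow> Cs \<noteq> [] \<and> set Cs \<subseteq> all_atoms F \<and> successively (child_atom F) Cs"

text \<open>A block starting with the atom \<open>A\<close> ends just before the first later atom of measure less
  than half of the measure of \<open>A\<close>; the next block starts with that atom.\<close>

function fat_blocks :: "'a measure \<Rightarrow> 'a set list \<Rightarrow> 'a set list list" where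
  "fat_blocks M [] = []"
| "fat_blocks M (A # Cs) =
     (A # takeWhile (\<lambda>B. \<not> measure M B < measure M A / 2) Cs) #
     fat_blocks M (dropWhile (\<lambda>B. \<not> measure M B < measure M A / 2) Cs)"
  by pat_completeness auto
termination
  by (relation "Wellfounded.measure (\<lambda>(M, Cs). length Cs)")
    (auto simp: le_imp_less_Suc length_dropWhile_le)

definition largest_atom :: "'a measure \<Rightarrow> 'a set list \<Rightarrow> 'a set" where
  "largest_atom M Xs = arg_max_on (measure M) (set Xs)"

definition smallest_atom :: "'a measure \<Rightarrow> 'a set list \<Rightarrow> 'a set" where
  "smallest_atom M Xs = arg_min_on (measure M) (set Xs)"

definition chain_diam_bound :: "'a::metric_space measure \<Rightarrow> (nat \<Rightarrow> 'a measure) \<Rightarrow> real \<Rightarrow> bool" where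
  "chain_diam_bound M F C \<longleftrightarrow>
     (\<forall>Cs. full_chain F Cs \<longrightarrow>
        (let Xs = fat_blocks M Cs in
          \<forall>i<length Xs. diameter (largest_atom M (Xs ! i)) *
             (\<Sum>j\<le>i. inverse (diameter (smallest_atom M (Xs ! j)))) \<le> C))"

end

theory Submission
  imports Defs "HOL-Real_Asymp.Real_Asymp"
begin

text \<open>Averaging the smartingale \<open>f\<^sub>n\<close> over the atoms of level \<open>n\<close> with respect to \<open>g \<mu>\<close> gives a
  martingale \<open>m\<^sub>n\<close>, because \<open>\<Delta>f\<^sub>n\<close> is orthogonal to \<open>g\<close> on the atoms of level \<open>n - 1\<close>.
  Let \<open>\<delta>\<^sub>n\<close> be the diameter of the atom of level \<open>n\<close> containing the given point and \<open>\<theta>\<^sub>n\<close> the fraction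
  of measure lost in passing to it from its parent. A Markov inequality bounds the oscillation of \<open>\<Delta>f\<^sub>k\<close> on
  that atom by its sup norm \<open>N\<^sub>k\<close> times \<open>\<delta>\<^sub>n / \<delta>\<^sub>k\<close>. Orthogonality and a Remez inequality give
  \<open>N\<^sub>k \<lesssim> \<theta>\<^sub>k\<close> and \<open>N\<^sub>k\<^sup>2 \<lesssim> \<theta>\<^sub>k (E\<^sub>k + E\<^sub>k\<^sub>-\<^sub>1) (\<Delta>f\<^sub>k)\<^sup>2\<close>, and the condition on
  chains says that the sum of \<open>\<theta>\<^sub>k \<delta>\<^sub>n / \<delta>\<^sub>k\<close> over \<open>k \<le> n\<close> is bounded. Hence \<open>f\<^sub>n - m\<^sub>n\<close> and the
  increments of \<open>m\<^sub>n\<close> are bounded, and the predictable quadratic variation of \<open>m\<^sub>n\<close> is at most a constant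
  times \<open>S\<^sub>n\<^sup>2\<close>. The upper half of the law of the iterated logarithm for \<open>m\<^sub>n\<close> follows from exponential
  supermartingales and the Borel--Cantelli lemma.\<close>

section \<open>Polynomials on convex bodies\<close>

text \<open>Constants need not lie in \<open>S\<close>, so increments need not have mean zero on
  atoms; the weight \<open>g\<close> repairs this. The obstacle is that a step of the averaged
  martingale is not controlled by the new increment alone: it also contains the difference of the
  averages of \<open>f n\<close> over two sibling cells, which collects the oscillation of all
  earlier increments. Its conditional variance carries the factor \<open>\<theta>\<close> of the new
  step, and Cauchy-Schwarz over the earlier increments leads to a double sum of
  \<open>e k * \<theta> (n+1) * \<delta> n / \<delta> k\<close>, where \<open>e k\<close> are the
  terms of the square function. So two bounds are needed: one for the sum of
  \<open>\<theta> k * \<delta> n / \<delta> k\<close> over \<open>k\<close>, which is the condition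
  on chains, and one for the sum of \<open>\<theta> (n+1) * \<delta> n / \<delta> k\<close> over
  \<open>n\<close>, which follows from the first by telescoping. The two conditional expectations in
  the square function serve two cases: the one at level \<open>k\<close> controls the jump when the
  cell has less than half of the measure of its parent, the one at level \<open>k - 1\<close>
  otherwise. Constants are not optimised.\<close>

lemma poly_eq_sum_le:
  assumes "degree q \<le> D"
  shows "poly q x = (\<Sum>i\<le>D. coeff q i * (x::real) ^ i)"
  unfolding poly_altdef using assms by (intro sum.mono_neutral_left) (auto intro: coeff_eq_0)

text \<open>The combination \<open>q(t) - 2\<^sup>D q(t/2)\<close> has no term of degree \<open>D\<close>, which allows induction on \<open>D\<close>.\<close>
lemma poly_coeff_bounded:
  "\<exists>K\<ge>0. \<forall>q m. degree q \<le> D \<longrightarrow> (\<forall>t\<in>{0..1}. \<bar>poly q t\<bar> \<le> m) \<longrightarrow> (\<forall>i. \<bar>coeff q i\<bar> \<le> K * (m::real))"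
proof (induction D)
  case 0
  have "\<bar>coeff q i\<bar> \<le> 1 * m" if q: "degree q \<le> 0" and m: "\<forall>t\<in>{0..1}. \<bar>poly q t\<bar> \<le> m"
    for q :: "real poly" and m i
  proof -
    have "\<bar>coeff q 0\<bar> \<le> m" using m[rule_format, of 0] by (simp add: poly_0_coeff_0)
    moreover have "0 \<le> m" using m[rule_format, of 0] by simp
    moreover have "i \<noteq> 0 \<Longrightarrow> coeff q i = 0" using q by (intro coeff_eq_0) simp
    ultimately show ?thesis by (cases "i = 0") auto
  qed
  then show ?case by (intro exI[of _ 1]) auto
next
  case (Suc D)
  then obtain K where K0: "K \<ge> 0" and K: "\<And>q m i. degree q \<le> D \<Longrightarrow> (\<forall>t\<in>{0..1}. \<bar>poly q t\<bar> \<le> m) \<Longrightarrow> \<bar>coeff q i\<bar> \<le> K * (m::real)"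
    by metis
  define K1 where "K1 = K * (1 + 2 ^ Suc D)"
  have K10: "K1 \<ge> 0" using K0 by (simp add: K1_def)
  have main: "\<bar>coeff q i\<bar> \<le> (1 + real (Suc D) * K1 + K1) * m"
    if q: "degree q \<le> Suc D" and m: "\<forall>t\<in>{0..1}. \<bar>poly q t\<bar> \<le> m" for q :: "real poly" and m i
  proof -
    have m0: "0 \<le> m" using m[rule_format, of 0] by simp
    define q' where "q' = q - smult (2 ^ Suc D) (pcompose q [:0, 1/2:])"
    have cq': "coeff q' i = (1 - 2 ^ Suc D * (1/2) ^ i) * coeff q i" for i
      by (simp add: q'_def coeff_pcompose_linear algebra_simps)
    have "degree q' \<le> D"
    proof (rule degree_le, intro allI impI)
      fix i assume "D < i"
      show "coeff q' i = 0"
      proof (cases "i = Suc D")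
        case True
        then show ?thesis by (simp add: cq' power_divide)
      next
        case False
        then have "coeff q i = 0" using q \<open>D < i\<close> by (intro coeff_eq_0) simp
        then show ?thesis by (simp add: cq')
      qed
    qed
    moreover have "\<bar>poly q' t\<bar> \<le> (1 + 2 ^ Suc D) * m" if "t \<in> {0..1}" for t
    proof -
      have "\<bar>poly q' t\<bar> \<le> \<bar>poly q t\<bar> + 2 ^ Suc D * \<bar>poly q (t/2)\<bar>"
        by (simp add: q'_def poly_pcompose abs_mult order_trans[OF abs_triangle_ineq4])
      also have "\<dots> \<le> m + 2 ^ Suc D * m"
        using m that by (intro add_mono mult_left_mono) auto
      finally show ?thesis by (simp add: algebra_simps)
    qed
    ultimately have "\<bar>coeff q' i\<bar> \<le> K1 * m" for i
      using K[of q' "(1 + 2 ^ Suc D) * m" i] by (simp add: K1_def mult.assoc)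
    \<comment> \<open>For \<open>i \<le> D\<close> the factor relating the two coefficients is 1
      minus a power of 2 with positive exponent, hence at least 1 in absolute value, and bounds pass
      back from \<open>q'\<close> to \<open>q\<close>. The top coefficient is then read off from the
      value at 1.\<close>
    then have low: "\<bar>coeff q i\<bar> \<le> K1 * m" if "i \<le> D" for i
    proof -
      have "(2::real) \<le> 2 ^ (Suc D - i)"
        using that self_le_power[of "2::real" "Suc D - i"] by simp
      moreover have "(2::real) ^ Suc D * (1/2) ^ i = 2 ^ (Suc D - i)"
        using that by (subst power_diff) (auto simp: power_divide)
      ultimately have "1 \<le> \<bar>1 - (2::real) ^ Suc D * (1/2) ^ i\<bar>" by linarith
      then have "1 * \<bar>coeff q i\<bar> \<le> \<bar>coeff q' i\<bar>" unfolding cq' abs_mult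
        by (intro mult_right_mono) auto
      also have "\<dots> \<le> K1 * m" by fact
      finally show ?thesis by simp
    qed
    have "poly q 1 = (\<Sum>i\<le>Suc D. coeff q i)"
      using poly_eq_sum_le[OF q, of 1] by simp
    then have "coeff q (Suc D) = poly q 1 - (\<Sum>i\<le>D. coeff q i)" by simp
    also have "\<bar>\<dots>\<bar> \<le> m + (\<Sum>i\<le>D. \<bar>coeff q i\<bar>)"
      using m[rule_format, of 1] sum_abs[of "coeff q" "{..D}"] by (simp del: sum_abs)
    also have "\<dots> \<le> m + (\<Sum>i\<le>D. K1 * m)" by (intro add_left_mono sum_mono low) auto
    also have "\<dots> = (1 + real (Suc D) * K1) * m" by (simp add: algebra_simps)
    finally have top: "\<bar>coeff q (Suc D)\<bar> \<le> (1 + real (Suc D) * K1) * m" .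
    have z: "0 \<le> K1 * m" "0 \<le> (1 + real (Suc D) * K1) * m" using K10 m0 by auto
    consider "i \<le> D" | "i = Suc D" | "i > Suc D" by linarith
    then show ?thesis
    proof cases
      case 1 then show ?thesis using low[of i] z by (simp add: distrib_right)
    next
      case 2 then show ?thesis using top z by (simp add: distrib_right)
    next
      case 3
      then have "coeff q i = 0" using q by (intro coeff_eq_0) simp
      then show ?thesis using z by (simp add: distrib_right)
    qed
  qed
  have "0 \<le> 1 + real (Suc D) * K1 + K1" using K10 by auto
  then show ?case using main by blast
qed

text \<open>Bounded coefficients give both one-dimensional estimates used along lines: growth
  outside the unit interval (Remez) and a Lipschitz bound at the endpoint 0 (Markov).\<close>

lemma poly_growth:
  assumes "T \<ge> 0"
  shows "\<exists>K\<ge>0. \<forall>q m. degree q \<le> D \<longrightarrow> (\<forall>t\<in>{0..1}. \<bar>poly q t\<bar> \<le> m) \<longrightarrow>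
    (\<forall>t. \<bar>t\<bar> \<le> T \<longrightarrow> \<bar>poly q t\<bar> \<le> K * m \<and> \<bar>poly q t - poly q 0\<bar> \<le> K * m * \<bar>t::real\<bar>)"
proof -
  obtain K where K0: "K \<ge> 0" and K: "\<And>q m i. degree q \<le> D \<Longrightarrow> (\<forall>t\<in>{0..1}. \<bar>poly q t\<bar> \<le> m) \<Longrightarrow> \<bar>coeff q i\<bar> \<le> K * (m::real)"
    using poly_coeff_bounded[of D] by metis
  define K1 where "K1 = (\<Sum>i\<le>D. K * T ^ i)"
  define K2 where "K2 = (\<Sum>i\<le>D. K * T ^ (i - 1))"
  have K10: "K1 \<ge> 0" "K2 \<ge> 0" using K0 assms by (auto simp: K1_def K2_def intro!: sum_nonneg)
  have *: "\<bar>poly q t\<bar> \<le> (K1 + K2) * m \<and> \<bar>poly q t - poly q 0\<bar> \<le> (K1 + K2) * m * \<bar>t\<bar>"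
    if q: "degree q \<le> D" and m: "\<forall>t\<in>{0..1}. \<bar>poly q t\<bar> \<le> m" and t: "\<bar>t\<bar> \<le> T" for q m t
  proof -
    have m0: "0 \<le> m" using m[rule_format, of 0] by simp
    have alt: "poly q t = (\<Sum>i\<le>D. coeff q i * t ^ i)" for t by (rule poly_eq_sum_le[OF q])
    have "\<bar>poly q t\<bar> \<le> (\<Sum>i\<le>D. \<bar>coeff q i\<bar> * \<bar>t\<bar> ^ i)"
      unfolding alt by (rule order_trans[OF sum_abs]) (simp add: abs_mult power_abs)
    also have "\<dots> \<le> (\<Sum>i\<le>D. (K * m) * T ^ i)"
      using K[OF q m] t K0 m0 by (intro sum_mono mult_mono power_mono) auto
    also have "\<dots> = K1 * m" by (simp add: K1_def sum_distrib_left sum_distrib_right mult_ac)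
    finally have 1: "\<bar>poly q t\<bar> \<le> K1 * m" .
    have "poly q t - poly q 0 = (\<Sum>i\<le>D. coeff q i * (t ^ i - 0 ^ i))"
      unfolding alt by (simp add: sum_subtractf right_diff_distrib)
    also have "\<bar>\<dots>\<bar> \<le> (\<Sum>i\<le>D. \<bar>coeff q i\<bar> * \<bar>t ^ i - 0 ^ i\<bar>)"
      by (rule order_trans[OF sum_abs]) (simp add: abs_mult)
    also have "\<dots> \<le> (\<Sum>i\<le>D. (K * m) * (T ^ (i - 1) * \<bar>t\<bar>))"
    proof (intro sum_mono mult_mono)
      fix i
      show "\<bar>t ^ i - 0 ^ i\<bar> \<le> T ^ (i - 1) * \<bar>t\<bar>"
      proof (cases i)
        case (Suc j)
        then show ?thesis using mult_left_mono[OF power_mono[of "\<bar>t\<bar>" T j], of "\<bar>t\<bar>"] t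
          by (simp add: abs_mult power_abs mult.commute)
      qed auto
    qed (use K[OF q m] K0 m0 in auto)
    also have "\<dots> = K2 * m * \<bar>t\<bar>" by (simp add: K2_def sum_distrib_left sum_distrib_right mult_ac)
    finally have 2: "\<bar>poly q t - poly q 0\<bar> \<le> K2 * m * \<bar>t\<bar>" .
    have "0 \<le> K2 * m" "0 \<le> K1 * m * \<bar>t\<bar>" using K10 m0 by auto
    then show ?thesis using 1 2 unfolding distrib_right by linarith
  qed
  show ?thesis using * K10 by (intro exI[of _ "K1 + K2"]) auto
qed

text \<open>Polynomials in several variables enter only through their restrictions to lines, so that
  no multivariate coefficients have to be handled.\<close>

definition line_degree_le :: "nat \<Rightarrow> ('a::real_vector \<Rightarrow> real) \<Rightarrow> bool" where
  "line_degree_le D p \<longleftrightarrow> (\<forall>x u. \<exists>q. degree q \<le> D \<and> (\<forall>t. p (x + t *\<^sub>R u) = poly q t))"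

lemma line_degree_le_mono: "line_degree_le D p \<Longrightarrow> D \<le> D' \<Longrightarrow> line_degree_le D' p"
  unfolding line_degree_le_def by (meson order_trans)

lemma real_polynomial_function_line_degree:
  fixes p :: "'a::euclidean_space \<Rightarrow> real"
  assumes "real_polynomial_function p"
  shows "\<exists>D. line_degree_le D p"
  using assms
proof (induction rule: real_polynomial_function.induct)
  case (linear p)
  have "\<exists>q. degree q \<le> 1 \<and> (\<forall>t. p (x + t *\<^sub>R u) = poly q t)" for x u
    using linear.hyps
    by (intro exI[of _ "[:p x, p u:]"]) (auto simp: bounded_linear.linear linear_add linear_cmul)
  then show ?case unfolding line_degree_le_def by blast
next
  case (const c)
  have "\<exists>q. degree q \<le> 0 \<and> (\<forall>t. c = poly q t)"
    by (intro exI[of _ "[:c:]"]) auto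
  then show ?case unfolding line_degree_le_def by blast
next
  case (add f g)
  then obtain D E where "line_degree_le D f" "line_degree_le E g" by blast
  then have D: "line_degree_le (max D E) f" "line_degree_le (max D E) g"
    by (auto intro: line_degree_le_mono)
  have "line_degree_le (max D E) (\<lambda>x. f x + g x)"
    unfolding line_degree_le_def
  proof (intro allI)
    fix x u
    obtain q r where "degree q \<le> max D E" "\<forall>t. f (x + t *\<^sub>R u) = poly q t"
      "degree r \<le> max D E" "\<forall>t. g (x + t *\<^sub>R u) = poly r t"
      using D unfolding line_degree_le_def by metis
    then show "\<exists>q. degree q \<le> max D E \<and> (\<forall>t. f (x + t *\<^sub>R u) + g (x + t *\<^sub>R u) = poly q t)"
      by (intro exI[of _ "q + r"]) (simp add: degree_add_le)
  qed
  then show ?case by blast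
next
  case (mult f g)
  then obtain D E where D: "line_degree_le D f" "line_degree_le E g" by blast
  have "line_degree_le (D + E) (\<lambda>x. f x * g x)"
    unfolding line_degree_le_def
  proof (intro allI)
    fix x u
    obtain q r where "degree q \<le> D" "\<forall>t. f (x + t *\<^sub>R u) = poly q t"
      "degree r \<le> E" "\<forall>t. g (x + t *\<^sub>R u) = poly r t"
      using D unfolding line_degree_le_def by metis
    then show "\<exists>q. degree q \<le> D + E \<and> (\<forall>t. f (x + t *\<^sub>R u) * g (x + t *\<^sub>R u) = poly q t)"
      by (intro exI[of _ "q * r"]) (auto intro: order_trans[OF degree_mult_le])
  qed
  then show ?case by blast
qed

lemma line_degree_le_lincomb:
  assumes "\<And>b. b \<in> B \<Longrightarrow> line_degree_le D b"
  shows "line_degree_le D (\<lambda>x. \<Sum>b\<in>B. c b * b x)"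
  unfolding line_degree_le_def
proof (intro allI)
  fix x u
  have "\<forall>b\<in>B. \<exists>q. degree q \<le> D \<and> (\<forall>t. b (x + t *\<^sub>R u) = poly q t)"
    using assms unfolding line_degree_le_def by blast
  from bchoice[OF this] obtain q
    where q: "\<And>b. b \<in> B \<Longrightarrow> degree (q b) \<le> D \<and> (\<forall>t. b (x + t *\<^sub>R u) = poly (q b) t)" by blast
  have "degree (\<Sum>b\<in>B. smult (c b) (q b)) \<le> D"
  proof (rule degree_le, intro allI impI)
    fix i assume "D < i"
    then have "coeff (q b) i = 0" if "b \<in> B" for b using q[OF that] by (intro coeff_eq_0) simp
    then show "coeff (\<Sum>b\<in>B. smult (c b) (q b)) i = 0" by (simp add: coeff_sum)
  qed
  moreover have "(\<Sum>b\<in>B. c b * b (x + t *\<^sub>R u)) = poly (\<Sum>b\<in>B. smult (c b) (q b)) t" for t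
    using q by (simp add: poly_sum)
  ultimately show "\<exists>q. degree q \<le> D \<and> (\<forall>t. (\<Sum>b\<in>B. c b * b (x + t *\<^sub>R u)) = poly q t)" by blast
qed

text \<open>Otherwise a hyperplane separates \<open>v\<close> from the convex set \<open>A - A\<close>, and \<open>A\<close> has width at most
  \<open>norm v\<close> in the direction of its normal.\<close>
lemma chord_of_min_width:
  fixes A :: "'a::euclidean_space set"
  assumes A: "convex A" "bounded A" "A \<noteq> {}" and v: "norm v < min_width A"
  shows "\<exists>a\<in>A. a + v \<in> A"
proof (rule ccontr)
  assume no: "\<not> (\<exists>a\<in>A. a + v \<in> A)"
  define D where "D = (\<Union>x\<in>A. \<Union>y\<in>A. {x - y})"
  have "convex D" unfolding D_def using convex_differences[OF A(1) A(1)] by simp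
  moreover have "v \<notin> D"
  proof
    assume "v \<in> D"
    then obtain x y where "x \<in> A" "y \<in> A" "v = x - y" by (auto simp: D_def)
    then have "y \<in> A \<and> y + v \<in> A" by auto
    then show False using no by blast
  qed
  moreover have "D \<noteq> {}" using A(3) by (auto simp: D_def)
  ultimately obtain n c where n: "n \<noteq> 0" "\<forall>x\<in>{v}. n \<bullet> x \<le> c" "\<forall>x\<in>D. c \<le> n \<bullet> x"
    using separating_hyperplane_sets[of "{v}" D] by auto
  define K where "K = closure A"
  have K: "compact K" "K \<noteq> {}" using A(2,3) by (auto simp: K_def compact_closure)
  have cont: "continuous_on K (\<lambda>x. n \<bullet> x)" by (intro continuous_intros)
  obtain x1 where x1: "x1 \<in> K" "\<And>y. y \<in> K \<Longrightarrow> n \<bullet> x1 \<le> n \<bullet> y"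
    using continuous_attains_inf[OF K cont] by auto
  obtain x2 where x2: "x2 \<in> K" "\<And>y. y \<in> K \<Longrightarrow> n \<bullet> y \<le> n \<bullet> x2"
    using continuous_attains_sup[OF K cont] by auto
  define a b where "a = n \<bullet> x1" and "b = n \<bullet> x2"
  have AK: "A \<subseteq> K" by (simp add: K_def closure_subset)
  have ab: "a \<le> b" using x1 x2 unfolding a_def b_def by blast
  \<comment> \<open>On \<open>A - A\<close> the functional is bounded below by \<open>c\<close>;
    passing to the closure in one argument after the other gives this for the extreme points
    \<open>x1\<close> and \<open>x2\<close>.\<close>
  have c: "c \<le> a - b"
  proof -
    have D1: "c \<le> n \<bullet> x - n \<bullet> y" if "x \<in> A" "y \<in> A" for x y
      using n(3) that by (auto simp: D_def inner_diff_right)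
    have "c \<le> n \<bullet> x - n \<bullet> y" if "x \<in> K" "y \<in> A" for x y
    proof -
      have "A \<subseteq> {x. c + n \<bullet> y \<le> n \<bullet> x}" using D1 that by (auto simp: algebra_simps)
      then have "K \<subseteq> {x. c + n \<bullet> y \<le> n \<bullet> x}" unfolding K_def
        by (intro closure_minimal) (auto intro!: closed_Collect_le continuous_intros)
      then show ?thesis using that by auto
    qed
    then have D2: "A \<subseteq> {y. c + n \<bullet> y \<le> n \<bullet> x1}" using x1(1) by (auto simp: algebra_simps)
    have "K \<subseteq> {y. c + n \<bullet> y \<le> n \<bullet> x1}" unfolding K_def
      by (intro closure_minimal D2) (auto intro!: closed_Collect_le continuous_intros)
    then show ?thesis using x2(1) by (auto simp: a_def b_def)
  qed
  have "b - a \<le> norm n * norm v"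
  proof -
    have "b - a \<le> - (n \<bullet> v)" using c n(2) by simp
    also have "\<dots> \<le> norm n * norm v" using Cauchy_Schwarz_ineq2[of n v] by linarith
    finally show ?thesis .
  qed
  have "min_width A \<le> setdist {x. n \<bullet> x = a} {x. n \<bullet> x = b}"
    unfolding min_width_def
  proof (rule cInf_lower)
    show "setdist {x. n \<bullet> x = a} {x. n \<bullet> x = b} \<in> {setdist {x. u \<bullet> x = a} {x. u \<bullet> x = b} | u a b.
     u \<noteq> 0 \<and> (\<forall>x\<in>A. a \<le> u \<bullet> x \<and> u \<bullet> x \<le> b) \<and>
     closure A \<inter> {x. u \<bullet> x = a} \<noteq> {} \<and> closure A \<inter> {x. u \<bullet> x = b} \<noteq> {}}"
      using n(1) x1 x2 AK unfolding a_def b_def K_def by blast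
    show "bdd_below {setdist {x. u \<bullet> x = a} {x. u \<bullet> x = b} | u a b.
     u \<noteq> 0 \<and> (\<forall>x\<in>A. a \<le> u \<bullet> x \<and> u \<bullet> x \<le> b) \<and>
     closure A \<inter> {x. u \<bullet> x = a} \<noteq> {} \<and> closure A \<inter> {x. u \<bullet> x = b} \<noteq> {}}"
      by (rule bdd_belowI[of _ 0]) (auto simp: setdist_pos_le)
  qed
  \<comment> \<open>Moving \<open>x1\<close> along the normal reaches the opposite hyperplane after
    the distance \<open>(b - a) / norm n\<close>.\<close>
  also have "\<dots> \<le> dist x1 (x1 + ((b - a) / (n \<bullet> n)) *\<^sub>R n)"
    using n(1) by (intro setdist_le_dist) (auto simp: a_def inner_add_right)
  also have "\<dots> = (b - a) / norm n"
    using ab n(1) by (simp add: dist_norm power2_norm_eq_inner[symmetric] power2_eq_square)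
  also have "\<dots> \<le> norm v" using \<open>b - a \<le> _\<close> n(1) by (simp add: field_simps)
  finally show False using v by simp
qed

text \<open>Along the rays from \<open>x\<close> through a chord \<open>[a, a + v]\<close> of \<open>A\<close> parallel to \<open>y - x\<close> the bound extends
  to a large triangle with apex \<open>x\<close>. The line through \<open>y\<close> parallel to \<open>a - x\<close> meets this triangle in a
  segment, and along this line the bound extends to \<open>y\<close>.\<close>
lemma line_degree_growth:
  assumes "T \<ge> 0"
  shows "\<exists>K\<ge>1. \<forall>(p::'a::euclidean_space \<Rightarrow> real) A w m x y.
     line_degree_le D p \<longrightarrow> convex A \<longrightarrow> w > 0 \<longrightarrow> (\<forall>v. norm v < w \<longrightarrow> (\<exists>a\<in>A. a + v \<in> A)) \<longrightarrow>
     (\<forall>z\<in>A. \<bar>p z\<bar> \<le> m) \<longrightarrow> x \<in> A \<longrightarrow> norm (y - x) \<le> T * w \<longrightarrow> \<bar>p y\<bar> \<le> K * m"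
proof -
  obtain K where K0: "K \<ge> 0" and K: "\<And>q m t. degree q \<le> D \<Longrightarrow> (\<forall>t\<in>{0..1}. \<bar>poly q t\<bar> \<le> m) \<Longrightarrow>
      \<bar>t\<bar> \<le> 2 * T + 1 \<Longrightarrow> \<bar>poly q t\<bar> \<le> K * (m::real)"
    using poly_growth[of "2 * T + 1" D] assms by (metis add_nonneg_nonneg mult_nonneg_nonneg zero_le_numeral zero_le_one)
  have main: "\<bar>p y\<bar> \<le> (1 + K * K) * m"
    if p: "line_degree_le D p" and A: "convex A" and w: "w > 0"
      and chord: "\<forall>v. norm v < w \<longrightarrow> (\<exists>a\<in>A. a + v \<in> A)"
      and m: "\<forall>z\<in>A. \<bar>p z\<bar> \<le> m" and x: "x \<in> A" and y: "norm (y - x) \<le> T * w"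
    for p :: "'a \<Rightarrow> real" and A w m x y
  proof (cases "y = x")
    case True
    have "0 \<le> m" using m x abs_ge_zero order_trans by blast
    then have "0 \<le> K * K * m" using K0 by simp
    then show ?thesis using m x True by (simp add: distrib_right add_increasing2)
  next
    case False
    have m0: "0 \<le> m" using m x abs_ge_zero order_trans by blast
    \<comment> \<open>Half of \<open>w\<close>, because chords are only available for vectors
      strictly shorter than \<open>w\<close>. The dilation \<open>\<tau>\<close> takes
      \<open>v\<close> back to \<open>y - x\<close>.\<close>
    define v where "v = (w / (2 * norm (y - x))) *\<^sub>R (y - x)"
    define \<tau> where "\<tau> = 2 * norm (y - x) / w"
    have "norm v = w / 2" using False w by (simp add: v_def)
    then obtain a where a: "a \<in> A" "a + v \<in> A" using chord w by (metis field_sum_of_halves less_add_same_cancel1 half_gt_zero)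
    have \<tau>: "\<tau> > 0" "\<tau> \<le> 2 * T" using False w y by (auto simp: \<tau>_def field_simps)
    have yx: "y = x + \<tau> *\<^sub>R v" using False w by (simp add: \<tau>_def v_def)
    \<comment> \<open>For \<open>s\<close> in this range the point lies on the ray from
      \<open>x\<close> through the chord point \<open>z\<close>, dilated by \<open>s\<close>; the
      condition \<open>\<tau> \<le> s\<close> keeps \<open>z\<close> on the chord, and
      \<open>s \<le> 2 * T + 1\<close> allows the first use of the growth bound. The second use goes
      back from parameter \<open>\<tau>\<close> to \<open>y\<close>.\<close>
    have step1: "\<bar>p (y + s *\<^sub>R (a - x))\<bar> \<le> K * m" if s: "s \<in> {\<tau>..\<tau> + 1}" for s
    proof -
      have s0: "s > 0" using s \<tau> by auto
      define z where "z = a + (\<tau> / s) *\<^sub>R v"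
      have "z = (1 - \<tau>/s) *\<^sub>R a + (\<tau>/s) *\<^sub>R (a + v)" by (simp add: z_def algebra_simps)
      then have z: "z \<in> A" using a A s s0 \<tau> by (auto intro!: convexD_alt)
      obtain q where q: "degree q \<le> D" "\<And>t. p (x + t *\<^sub>R (z - x)) = poly q t"
        using p unfolding line_degree_le_def by metis
      have "\<bar>poly q t\<bar> \<le> m" if "t \<in> {0..1}" for t
      proof -
        have "x + t *\<^sub>R (z - x) = (1 - t) *\<^sub>R x + t *\<^sub>R z" by (simp add: algebra_simps)
        then have "x + t *\<^sub>R (z - x) \<in> A" using x z A that by (auto intro!: convexD_alt)
        then show ?thesis using m q(2)[of t] by metis
      qed
      then have "\<bar>poly q s\<bar> \<le> K * m" using s s0 \<tau> by (intro K q(1)) auto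
      moreover have "y + s *\<^sub>R (a - x) = x + s *\<^sub>R (z - x)" using s0 by (simp add: yx z_def algebra_simps)
      ultimately show ?thesis using q(2)[of s] by simp
    qed
    obtain q where q: "degree q \<le> D" "\<And>t. p ((y + \<tau> *\<^sub>R (a - x)) + t *\<^sub>R (a - x)) = poly q t"
      using p unfolding line_degree_le_def by metis
    have "\<bar>poly q t\<bar> \<le> K * m" if "t \<in> {0..1}" for t
      using step1[of "\<tau> + t"] that q(2)[of t] by (simp add: algebra_simps)
    then have "\<bar>poly q (- \<tau>)\<bar> \<le> K * (K * m)" using \<tau> by (intro K q(1)) auto
    moreover have "poly q (- \<tau>) = p y" using q(2)[of "- \<tau>"] by simp
    ultimately show ?thesis using m0 by (simp add: algebra_simps)
  qed
  show ?thesis by (rule exI[of _ "1 + K * K"]) (use main K0 in auto)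
qed

text \<open>If \<open>y\<close> and \<open>z\<close> are at distance less than \<open>w\<close>, the
  one-dimensional Lipschitz bound is applied to the segment of length \<open>w\<close> from
  \<open>z\<close> towards \<open>y\<close>; this segment stays within \<open>(T + 1) * w\<close> of
  \<open>x\<close>, where the growth bound holds. For distant points the growth bound alone
  suffices.\<close>

lemma line_degree_lipschitz:
  assumes "T \<ge> 0"
  shows "\<exists>K\<ge>1. \<forall>(p::'a::euclidean_space \<Rightarrow> real) A w m x y z.
     line_degree_le D p \<longrightarrow> convex A \<longrightarrow> w > 0 \<longrightarrow> (\<forall>v. norm v < w \<longrightarrow> (\<exists>a\<in>A. a + v \<in> A)) \<longrightarrow>
     (\<forall>z\<in>A. \<bar>p z\<bar> \<le> m) \<longrightarrow> x \<in> A \<longrightarrow> norm (y - x) \<le> T * w \<longrightarrow> norm (z - x) \<le> T * w \<longrightarrow>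
     \<bar>p y - p z\<bar> \<le> K * m * norm (y - z) / w"
proof -
  obtain K where K1: "K \<ge> 1" and K: "\<And>(p::'a \<Rightarrow> real) A w m x y. line_degree_le D p \<Longrightarrow> convex A \<Longrightarrow> w > 0 \<Longrightarrow>
     (\<forall>v. norm v < w \<longrightarrow> (\<exists>a\<in>A. a + v \<in> A)) \<Longrightarrow> (\<forall>z\<in>A. \<bar>p z\<bar> \<le> m) \<Longrightarrow> x \<in> A \<Longrightarrow>
     norm (y - x) \<le> (T + 1) * w \<Longrightarrow> \<bar>p y\<bar> \<le> K * m"
    using line_degree_growth[of "T + 1" D, OF add_nonneg_nonneg[OF assms zero_le_one]] by blast
  obtain M where M0: "M \<ge> 0" and M: "\<And>q m t. degree q \<le> D \<Longrightarrow> (\<forall>t\<in>{0..1}. \<bar>poly q t\<bar> \<le> m) \<Longrightarrow>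
      \<bar>t\<bar> \<le> 1 \<Longrightarrow> \<bar>poly q t - poly q 0\<bar> \<le> M * (m::real) * \<bar>t\<bar>"
    using poly_growth[of 1 D, OF zero_le_one] by blast
  have main: "\<bar>p y - p z\<bar> \<le> (2 * K + M * K) * m * norm (y - z) / w"
    if p: "line_degree_le D p" and A: "convex A" and w: "w > 0"
      and chord: "\<forall>v. norm v < w \<longrightarrow> (\<exists>a\<in>A. a + v \<in> A)"
      and m: "\<forall>z\<in>A. \<bar>p z\<bar> \<le> m" and x: "x \<in> A" and y: "norm (y - x) \<le> T * w" and z: "norm (z - x) \<le> T * w"
    for p :: "'a \<Rightarrow> real" and A w m x y z
  proof -
    have m0: "0 \<le> m" using m x abs_ge_zero order_trans by blast
    have near: "\<bar>p u\<bar> \<le> K * m" if "norm (u - x) \<le> (T + 1) * w" for u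
      using K[OF p A w chord m x that] .
    have Tw: "T * w \<le> (T + 1) * w" using w by simp
    let ?r = "norm (y - z) / w"
    have r0: "?r \<ge> 0" using w by simp
    have parts: "0 \<le> 2 * K * m * ?r" "0 \<le> M * K * m * ?r"
      using K1 M0 m0 r0 by (intro mult_nonneg_nonneg; linarith)+
    have "\<bar>p y - p z\<bar> \<le> 2 * K * m * ?r \<or> \<bar>p y - p z\<bar> \<le> M * K * m * ?r"
    proof (cases "?r \<ge> 1")
      case True
      have "\<bar>p y - p z\<bar> \<le> K * m + K * m" using near[of y] near[of z] y z Tw by linarith
      also have "\<dots> \<le> 2 * K * m * ?r" using True mult_left_mono[OF True, of "2 * K * m"] K1 m0 by simp
      finally show ?thesis by simp
    next
      case False
      show ?thesis
      proof (cases "y = z")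
        case True then show ?thesis by simp
      next
        case ne: False
        define u where "u = (w / norm (y - z)) *\<^sub>R (y - z)"
        have nu: "norm u = w" using ne w by (simp add: u_def)
        obtain q where q: "degree q \<le> D" "\<And>t. p (z + t *\<^sub>R u) = poly q t"
          using p unfolding line_degree_le_def by metis
        have "\<bar>poly q t\<bar> \<le> K * m" if "t \<in> {0..1}" for t
        proof -
          have "norm (z + t *\<^sub>R u - x) \<le> norm (z - x) + norm (t *\<^sub>R u)"
            by (metis add_diff_eq add.commute diff_add_eq norm_triangle_ineq)
          also have "\<dots> \<le> T * w + w" using z that w nu by (intro add_mono) (auto simp: mult_le_cancel_right1)
          finally show ?thesis using near[of "z + t *\<^sub>R u"] q(2)[of t] by (simp add: distrib_right)
        qed
        then have "\<bar>poly q ?r - poly q 0\<bar> \<le> M * (K * m) * \<bar>?r\<bar>" using False r0 by (intro M q(1)) auto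
        moreover have "poly q ?r = p y" using q(2)[of ?r, symmetric] ne w by (simp add: u_def)
        moreover have "poly q 0 = p z" using q(2)[of 0] by simp
        ultimately show ?thesis using r0 w by (simp add: mult.assoc)
      qed
    qed
    then have "\<bar>p y - p z\<bar> \<le> 2 * K * m * ?r + M * K * m * ?r" using parts by linarith
    then show ?thesis by (simp add: algebra_simps add_divide_distrib)
  qed
  have "2 * K + M * K \<ge> 1" using K1 M0 by (simp add: add_increasing2)
  then show ?thesis using main by (intro exI[of _ "2 * K + M * K"]) auto
qed

section \<open>Martingales on trees of cells\<close>

text \<open>Conditional expectations become weighted averages over finitely many cells. The measure
  is only finite because the locale is used both for the given probability measure and for its
  density \<open>g\<close>.\<close>

locale cell_tree = finite_measure M for M :: "'a measure" +
  fixes At :: "nat \<Rightarrow> 'a set set"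
  assumes finite_At: "finite (At n)"
    and At_sets: "A \<in> At n \<Longrightarrow> A \<in> sets M"
    and At_0: "At 0 = {space M}"
    and At_cover: "\<Union>(At n) = space M"
    and At_disjoint: "A \<in> At n \<Longrightarrow> B \<in> At n \<Longrightarrow> A \<noteq> B \<Longrightarrow> A \<inter> B = {}"
    and At_refine: "B \<in> At (Suc n) \<Longrightarrow> \<exists>A\<in>At n. B \<subseteq> A"
    and At_pos: "A \<in> At n \<Longrightarrow> 0 < measure M A"
begin

definition cell :: "nat \<Rightarrow> 'a \<Rightarrow> 'a set" where
  "cell n x = (THE A. A \<in> At n \<and> x \<in> A)"

definition children :: "nat \<Rightarrow> 'a set \<Rightarrow> 'a set set" where
  "children n A = {B \<in> At (Suc n). B \<subseteq> A}"

lemma cell_eq: "A \<in> At n \<Longrightarrow> x \<in> A \<Longrightarrow> cell n x = A"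
  unfolding cell_def using At_disjoint by (intro the_equality) blast+

lemma cell_At:
  assumes "x \<in> space M" shows "cell n x \<in> At n" "x \<in> cell n x"
  using assms At_cover[of n] cell_eq by auto

lemma cell_sets: "x \<in> space M \<Longrightarrow> cell n x \<in> sets M"
  using At_sets cell_At by blast

lemma At_subset_space: "A \<in> At n \<Longrightarrow> A \<subseteq> space M"
  using At_cover by blast

lemma cell_cong:
  assumes "x \<in> space M" "y \<in> cell n x" shows "cell n y = cell n x"
  using assms cell_At cell_eq by blast

lemma cell_Suc_subset:
  assumes "x \<in> space M" shows "cell (Suc n) x \<subseteq> cell n x"
  using assms At_refine[OF cell_At(1)] cell_At cell_eq by (metis subsetD)

lemma cell_antimono: "x \<in> space M \<Longrightarrow> m \<le> n \<Longrightarrow> cell n x \<subseteq> cell m x"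
  by (rule lift_Suc_antimono_le[of "\<lambda>n. cell n x"]) (auto dest: cell_Suc_subset)

lemma cell_Suc_children: "x \<in> space M \<Longrightarrow> cell (Suc n) x \<in> children n (cell n x)"
  by (simp add: children_def cell_At cell_Suc_subset)

lemma finite_children [simp]: "finite (children n A)"
  using finite_At[of "Suc n"] by (simp add: children_def)

lemma children_sets: "B \<in> children n A \<Longrightarrow> B \<in> sets M"
  by (auto simp: children_def At_sets)

lemma Union_children:
  assumes "A \<in> At n" shows "\<Union>(children n A) = A"
proof
  show "A \<subseteq> \<Union>(children n A)"
  proof
    fix x assume x: "x \<in> A"
    then have "x \<in> space M" using assms At_subset_space by blast
    then show "x \<in> \<Union>(children n A)"
      using cell_Suc_children[of x n] cell_At[of x "Suc n"] cell_eq[OF assms x] by auto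
  qed
qed (auto simp: children_def)

lemma children_disjoint: "disjoint_family_on (\<lambda>B. B) (children n A)"
  using At_disjoint by (auto simp: disjoint_family_on_def children_def)

lemma measurable_cell [measurable]: "(\<lambda>x. \<phi> (cell n x)) \<in> measurable M (count_space UNIV)"
proof (rule measurableI)
  fix X :: "'b set"
  have "(\<lambda>x. \<phi> (cell n x)) -` X \<inter> space M = \<Union>{A \<in> At n. \<phi> A \<in> X}"
    using At_subset_space by (auto simp: cell_eq) (use cell_At in blast)
  then show "(\<lambda>x. \<phi> (cell n x)) -` X \<inter> space M \<in> sets M"
    using finite_At[of n] At_sets[of _ n] by (auto intro!: sets.finite_Union)
qed simp

lemma borel_measurable_cell [measurable]: "(\<lambda>x. \<phi> (cell n x) :: real) \<in> borel_measurable M"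
  using measurable_cell[of "\<phi>" n] by (rule measurable_compose[where g = id, unfolded id_def]) simp

end

section \<open>Exponential supermartingales and the iterated logarithm on a tree\<close>

locale tree_martingale = cell_tree +
  fixes m :: "nat \<Rightarrow> 'a set \<Rightarrow> real" and K :: real
  assumes martingale: "A \<in> At n \<Longrightarrow> (\<Sum>B\<in>children n A. measure M B * m (Suc n) B) = measure M A * m n A"
    and bounded_step: "A \<in> At n \<Longrightarrow> B \<in> children n A \<Longrightarrow> \<bar>m (Suc n) B - m n A\<bar> \<le> K"
begin

text \<open>The conditional variance of the step out of \<open>A\<close>; \<open>quad_var\<close>
  below is the predictable quadratic variation.\<close>

definition step_var :: "nat \<Rightarrow> 'a set \<Rightarrow> real" where
  "step_var n A = (\<Sum>B\<in>children n A. measure M B * (m (Suc n) B - m n A)\<^sup>2) / measure M A"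

definition quad_var :: "nat \<Rightarrow> 'a \<Rightarrow> real" where
  "quad_var n x = (\<Sum>j<n. step_var j (cell j x))"

lemma measure_children: "A \<in> At n \<Longrightarrow> (\<Sum>B\<in>children n A. measure M B) = measure M A"
  using children_sets[of _ n A, THEN subsetI] finite_measure_finite_Union[of "children n A" "\<lambda>B. B"] Union_children[of A n]
    children_disjoint[of n A] by simp

text \<open>In other words, \<open>exp (\<theta> * m n - \<theta>\<^sup>2 * quad_var n)\<close> is a
  supermartingale. The quadratic bound for the exponential is summed over the children, and the
  linear term cancels by the martingale property.\<close>

lemma exp_step:
  assumes A: "A \<in> At n" and lam: "0 \<le> \<theta>" "\<theta> * K \<le> 1"
  shows "(\<Sum>B\<in>children n A. measure M B * exp (\<theta> * m (Suc n) B)) \<le>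
    measure M A * exp (\<theta> * m n A + \<theta>\<^sup>2 * step_var n A)"
proof -
  let ?a = "m n A"
  have sv: "measure M A * step_var n A = (\<Sum>B\<in>children n A. measure M B * (m (Suc n) B - m n A)\<^sup>2)"
    using At_pos[OF A] by (simp add: step_var_def)
  \<comment> \<open>Only an upper bound on \<open>y\<close> is required. For negative
    \<open>y\<close> one compares after multiplication by \<open>1 - y\<close>, using
    \<open>1 - y \<le> exp (-y)\<close> and \<open>1 \<le> 1 - y ^ 3\<close>.\<close>
  have ex: "exp y \<le> 1 + y + y\<^sup>2" if "y \<le> 1" for y :: real
  proof (cases "y \<ge> 0")
    case True then show ?thesis using exp_bound[of y] that by simp
  next
    case False
    then have "exp y * (1 - y) \<le> 1"
      using exp_ge_add_one_self[of "-y"] mult_left_mono[of "1 - y" "exp (-y)" "exp y"]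
      by (simp add: exp_minus)
    moreover have "1 \<le> (1 + y + y\<^sup>2) * (1 - y)"
    proof -
      have "(1 + y + y\<^sup>2) * (1 - y) = 1 - y ^ 3" by (simp add: algebra_simps power2_eq_square power3_eq_cube)
      moreover have "y ^ 3 \<le> 0" using False by (simp add: power_le_zero_eq)
      ultimately show ?thesis by simp
    qed
    ultimately have "exp y * (1 - y) \<le> (1 + y + y\<^sup>2) * (1 - y)" by linarith
    then show ?thesis using False by (simp add: mult_le_cancel_right)
  qed
  have "(\<Sum>B\<in>children n A. measure M B * exp (\<theta> * m (Suc n) B)) =
      exp (\<theta> * ?a) * (\<Sum>B\<in>children n A. measure M B * exp (\<theta> * (m (Suc n) B - ?a)))"
    by (simp add: sum_distrib_left mult_ac right_diff_distrib exp_diff)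
  also have "\<dots> \<le> exp (\<theta> * ?a) * (\<Sum>B\<in>children n A. measure M B *
      (1 + \<theta> * (m (Suc n) B - ?a) + (\<theta> * (m (Suc n) B - ?a))\<^sup>2))"
  proof (intro mult_left_mono sum_mono ex)
    fix B assume "B \<in> children n A"
    then have "m (Suc n) B - ?a \<le> K" using bounded_step[OF A] by fastforce
    then show "\<theta> * (m (Suc n) B - ?a) \<le> 1" using lam mult_left_mono[of _ K \<theta>] by fastforce
  qed auto
  also have "(\<Sum>B\<in>children n A. measure M B *
      (1 + \<theta> * (m (Suc n) B - ?a) + (\<theta> * (m (Suc n) B - ?a))\<^sup>2)) =
      (\<Sum>B\<in>children n A. measure M B) + \<theta> * ((\<Sum>B\<in>children n A. measure M B * m (Suc n) B)
       - (\<Sum>B\<in>children n A. measure M B) * ?a) + \<theta>\<^sup>2 * (measure M A * step_var n A)"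
    unfolding sv power_mult_distrib
    by (simp only: distrib_left sum.distrib sum_distrib_left sum_distrib_right
      right_diff_distrib sum_subtractf mult_1_right mult_1_left mult_ac)
  also have "\<dots> = measure M A * (1 + \<theta>\<^sup>2 * step_var n A)"
    using martingale[OF A] measure_children[OF A] by (simp add: algebra_simps)
  also have "exp (\<theta> * ?a) * \<dots> \<le> exp (\<theta> * ?a) * (measure M A * exp (\<theta>\<^sup>2 * step_var n A))"
    by (intro mult_left_mono) (auto intro: exp_ge_add_one_self)
  finally show ?thesis by (simp add: exp_add mult_ac)
qed

text \<open>Induction on the horizon \<open>N\<close> replaces stopping times. Either the level
  \<open>b\<close> is reached at \<open>A\<close> itself, and the right-hand side is at least the
  measure of \<open>A\<close>; or one step is made, its variance term is added to the level, and
  \<open>exp_step\<close> sums the bounds of the children.\<close>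

lemma maximal_inequality_aux:
  assumes lam: "0 \<le> \<theta>" "\<theta> * K \<le> 1"
  shows "A \<in> At n \<Longrightarrow> measure M {x\<in>A. \<exists>k\<in>{n..n+N}. b \<le> \<theta> * m k (cell k x) - \<theta>\<^sup>2 * (\<Sum>j=n..<k. step_var j (cell j x))}
    \<le> measure M A * exp (\<theta> * m n A - b)"
proof (induction N arbitrary: n A b)
  case 0
  let ?E = "{x\<in>A. \<exists>k\<in>{n..n+0}. b \<le> \<theta> * m k (cell k x) - \<theta>\<^sup>2 * (\<Sum>j=n..<k. step_var j (cell j x))}"
  show ?case
  proof (cases "b \<le> \<theta> * m n A")
    case True
    have "measure M ?E \<le> measure M A * 1" using 0 At_sets by (auto intro!: finite_measure_mono)
    also have "\<dots> \<le> measure M A * exp (\<theta> * m n A - b)" using True by (intro mult_left_mono) auto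
    finally show ?thesis .
  next
    case False
    then have E: "?E = {}" using cell_eq[OF 0] by auto
    show ?thesis unfolding E by simp
  qed
next
  case (Suc N)
  let ?E = "{x\<in>A. \<exists>k\<in>{n..n+Suc N}. b \<le> \<theta> * m k (cell k x) - \<theta>\<^sup>2 * (\<Sum>j=n..<k. step_var j (cell j x))}"
  show ?case
  proof (cases "b \<le> \<theta> * m n A")
    case True
    have "measure M ?E \<le> measure M A * 1" using Suc.prems At_sets by (auto intro!: finite_measure_mono)
    also have "\<dots> \<le> measure M A * exp (\<theta> * m n A - b)" using True by (intro mult_left_mono) auto
    finally show ?thesis .
  next
    case False
    define b' where "b' = b + \<theta>\<^sup>2 * step_var n A"
    let ?G = "\<lambda>B. {x\<in>B. \<exists>k\<in>{Suc n..Suc n+N}. b' \<le> \<theta> * m k (cell k x) - \<theta>\<^sup>2 * (\<Sum>j=Suc n..<k. step_var j (cell j x))}"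
    have G: "?G B \<in> sets M" if "B \<in> children n A" for B
    proof -
      have [measurable]: "B \<in> sets M" using that children_sets by blast
      have "?G B = {x\<in>space M. x \<in> B \<and> (\<exists>k\<in>{Suc n..Suc n+N}. b' \<le> \<theta> * m k (cell k x) - \<theta>\<^sup>2 * (\<Sum>j=Suc n..<k. step_var j (cell j x)))}"
        using sets.sets_into_space[of B M] by auto
      also have "\<dots> \<in> sets M" by measurable
      finally show ?thesis .
    qed
    have "?E \<subseteq> (\<Union>B\<in>children n A. ?G B)"
    proof
      fix x assume "x \<in> ?E"
      then obtain k where x: "x \<in> A" and k: "k \<in> {n..n+Suc N}"
        and bk: "b \<le> \<theta> * m k (cell k x) - \<theta>\<^sup>2 * (\<Sum>j=n..<k. step_var j (cell j x))" by blast
      have cA: "cell n x = A" using cell_eq[OF Suc.prems x] .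
      have "k \<noteq> n" using bk False cA by auto
      then have k': "k \<in> {Suc n..Suc n+N}" "n < k" using k by auto
      have xs: "x \<in> space M" using x Suc.prems At_subset_space by blast
      have "(\<Sum>j=n..<k. step_var j (cell j x)) = step_var n A + (\<Sum>j=Suc n..<k. step_var j (cell j x))"
        using k' cA by (simp add: sum.atLeast_Suc_lessThan)
      then have "b' \<le> \<theta> * m k (cell k x) - \<theta>\<^sup>2 * (\<Sum>j=Suc n..<k. step_var j (cell j x))"
        using bk by (simp add: b'_def algebra_simps)
      then have "x \<in> ?G (cell (Suc n) x)" using k' cell_At[OF xs] by auto
      then show "x \<in> (\<Union>B\<in>children n A. ?G B)" using cell_Suc_children[OF xs, of n] cA by auto
    qed
    then have "measure M ?E \<le> measure M (\<Union>B\<in>children n A. ?G B)"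
      by (rule finite_measure_mono) (intro sets.finite_UN finite_children G)
    also have "\<dots> \<le> (\<Sum>B\<in>children n A. measure M (?G B))"
      using G by (intro finite_measure_subadditive_finite finite_children) blast
    also have "\<dots> \<le> (\<Sum>B\<in>children n A. measure M B * exp (\<theta> * m (Suc n) B - b'))"
      using Suc.IH[of _ "Suc n" b'] by (intro sum_mono) (auto simp: children_def)
    also have "\<dots> = exp (- b') * (\<Sum>B\<in>children n A. measure M B * exp (\<theta> * m (Suc n) B))"
      by (simp add: sum_distrib_left exp_diff exp_minus field_simps)
    also have "\<dots> \<le> exp (- b') * (measure M A * exp (\<theta> * m n A + \<theta>\<^sup>2 * step_var n A))"
      by (intro mult_left_mono exp_step Suc.prems lam) auto
    also have "\<dots> = measure M A * exp (\<theta> * m n A - b)"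
      by (simp add: b'_def exp_diff exp_minus exp_add field_simps)
    finally show ?thesis .
  qed
qed

lemma measurable_quad_var [measurable]: "quad_var n \<in> borel_measurable M"
  unfolding quad_var_def by measurable

lemma maximal_inequality:
  assumes lam: "0 \<le> \<theta>" "\<theta> * K \<le> 1"
  shows "measure M {x\<in>space M. \<exists>k. b \<le> \<theta> * m k (cell k x) - \<theta>\<^sup>2 * quad_var k x}
    \<le> measure M (space M) * exp (\<theta> * m 0 (space M) - b)"
proof -
  let ?E = "\<lambda>N. {x\<in>space M. \<exists>k\<in>{0..N}. b \<le> \<theta> * m k (cell k x) - \<theta>\<^sup>2 * quad_var k x}"
  have "(\<lambda>N. measure M (?E N)) \<longlonglongrightarrow> measure M (\<Union>N. ?E N)"
  proof (rule finite_Lim_measure_incseq)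
    show "range ?E \<subseteq> sets M" by auto
    show "incseq ?E" by (auto simp: incseq_def)
  qed
  moreover have "(\<Union>N. ?E N) = {x\<in>space M. \<exists>k. b \<le> \<theta> * m k (cell k x) - \<theta>\<^sup>2 * quad_var k x}"
  proof -
    have ex: "(\<exists>N. \<exists>k\<in>{0..N}. P k) = (\<exists>k::nat. P k)" for P
      by (metis atLeastAtMost_iff le0 order_refl)
    have "(\<Union>N. ?E N) = {x\<in>space M. \<exists>N. \<exists>k\<in>{0..N}. b \<le> \<theta> * m k (cell k x) - \<theta>\<^sup>2 * quad_var k x}"
      by blast
    then show ?thesis unfolding ex .
  qed
  moreover have "measure M (?E N) \<le> measure M (space M) * exp (\<theta> * m 0 (space M) - b)" for N
    using maximal_inequality_aux[OF lam, of "space M" 0 N b] At_0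
    by (simp add: quad_var_def atLeast0LessThan)
  ultimately show ?thesis by (intro LIMSEQ_le_const2) auto
qed

text \<open>The maximal inequality is used with \<open>\<theta> = sqrt (ln j / exp j)\<close> and level \<open>b = 2 * ln j\<close>; the
  exceptional sets then have measure \<open>O(1 / j\<^sup>2)\<close>.\<close>
lemma bounded_eventually:
  "AE x in M. eventually (\<lambda>j. \<forall>k. m k (cell k x) < sqrt (ln (real j) / exp (real j)) * quad_var k x
     + 2 * sqrt (exp (real j) * ln (real j))) sequentially"
proof -
  define lam where "lam j = sqrt (ln (real j) / exp (real j))" for j
  have "lam \<longlonglongrightarrow> 0" unfolding lam_def by real_asymp
  then have ev: "eventually (\<lambda>j. \<bar>lam j\<bar> < 1 / (\<bar>K\<bar> + 1)) sequentially"
    by (metis (no_types, lifting) abs_ge_zero add_nonneg_pos diff_zero divide_pos_pos LIMSEQ_D eventually_sequentially real_norm_def zero_less_one)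
  have l0: "lam j \<ge> 0" for j by (cases "j = 0") (auto simp: lam_def ln_ge_zero)
  \<comment> \<open>Beyond \<open>J\<close> the parameter is admissible in
    \<open>maximal_inequality\<close>, and \<open>lam j \<le> 1\<close> makes the contribution of
    the initial value \<open>m 0\<close> a fixed constant.\<close>
  obtain J where J: "\<And>j. j \<ge> J \<Longrightarrow> lam j * K \<le> 1" "\<And>j. j \<ge> J \<Longrightarrow> lam j \<le> 1" "J \<ge> 2"
  proof -
    obtain J0 where J0: "\<And>j. j \<ge> J0 \<Longrightarrow> \<bar>lam j\<bar> < 1 / (\<bar>K\<bar> + 1)" using ev unfolding eventually_sequentially by blast
    have a: "lam j * (\<bar>K\<bar> + 1) < 1" if "j \<ge> J0" for j
      using J0[OF that] l0[of j] by (simp add: pos_less_divide_eq)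
    have "lam j * K \<le> 1 \<and> lam j \<le> 1" if "j \<ge> J0" for j
    proof -
      have "lam j * K \<le> lam j * \<bar>K\<bar>" "0 \<le> lam j * \<bar>K\<bar>" using l0[of j] by (auto intro!: mult_left_mono)
      then show ?thesis using a[OF that] l0[of j] unfolding distrib_left by linarith
    qed
    then show ?thesis using that[of "max J0 2"] by auto
  qed
  define E where "E j = {x\<in>space M. \<exists>k. 2 * ln (real (j + J)) \<le> lam (j + J) * m k (cell k x) - (lam (j + J))\<^sup>2 * quad_var k x}" for j
  define C where "C = measure M (space M) * exp \<bar>m 0 (space M)\<bar>"
  have Ele: "measure M (E j) \<le> C * (1 / real (j + J) ^ 2)" for j
  proof -
    have jJ: "real (j + J) > 0" using J(3) by simp
    have "lam (j + J) * m 0 (space M) \<le> lam (j + J) * \<bar>m 0 (space M)\<bar>"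
      using l0[of "j + J"] by (intro mult_left_mono) auto
    also have "\<dots> \<le> 1 * \<bar>m 0 (space M)\<bar>"
      using J(2)[of "j + J"] by (intro mult_right_mono) auto
    finally have "lam (j + J) * m 0 (space M) \<le> \<bar>m 0 (space M)\<bar>" by simp
    then have "measure M (E j) \<le> measure M (space M) * exp (\<bar>m 0 (space M)\<bar> - 2 * ln (real (j + J)))"
      unfolding E_def using J(1)[of "j + J"] l0
      by (intro order_trans[OF maximal_inequality] mult_left_mono) auto
    also have "exp (- (2 * ln (real (j + J)))) = 1 / real (j + J) ^ 2"
    proof -
      have "2 * ln (real (j + J)) = ln (real (j + J) ^ 2)" using jJ by (simp add: ln_realpow)
      then show ?thesis using jJ by (simp add: exp_minus inverse_eq_divide)
    qed
    then have "exp (\<bar>m 0 (space M)\<bar> - 2 * ln (real (j + J))) = exp \<bar>m 0 (space M)\<bar> * (1 / real (j + J) ^ 2)"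
      by (simp add: exp_diff exp_minus inverse_eq_divide)
    finally show ?thesis by (simp add: C_def)
  qed
  have sm: "summable (\<lambda>j. C * (1 / real (j + J) ^ 2))"
    using summable_mult[OF summable_ignore_initial_segment[OF inverse_power_summable[of 2, where ?'a = real], of J], of C]
    by (simp add: inverse_eq_divide)
  have "AE x in M. eventually (\<lambda>j. x \<in> space M - E j) sequentially"
  proof (rule borel_cantelli_AE1)
    show "E j \<in> sets M" for j unfolding E_def by measurable
    show "emeasure M (E j) < \<infinity>" for j by (simp add: emeasure_eq_measure)
    show "summable (\<lambda>j. measure M (E j))"
      by (rule summable_comparison_test'[OF sm, of 0]) (use Ele in auto)
  qed
  then show ?thesis
  proof eventually_elim
    case (elim x)
    have "eventually (\<lambda>j. \<forall>k. m k (cell k x) < lam (j + J) * quad_var k x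
     + 2 * sqrt (exp (real (j + J)) * ln (real (j + J)))) sequentially"
      using elim
    proof eventually_elim
      case (elim j)
      show ?case
      proof
        fix k
        let ?l = "lam (j + J)" and ?j = "real (j + J)"
        have j2: "?j \<ge> 2" using J(3) by linarith
        then have lnp: "ln ?j > 0" by (intro ln_gt_zero) linarith
        have lp: "?l > 0" unfolding lam_def using lnp by simp
        \<comment> \<open>The choice of \<open>lam\<close> balances the two terms of the bound when
          the quadratic variation is of order \<open>exp j\<close>: dividing the level
          \<open>2 * ln j\<close> by \<open>lam j\<close> gives twice this square root.\<close>
        have "?l * sqrt (exp ?j * ln ?j) = sqrt (ln ?j * ln ?j)"
          unfolding lam_def real_sqrt_mult[symmetric] by (simp add: field_simps)
        also have "\<dots> = ln ?j" using lnp by simp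
        finally have eq: "?l * sqrt (exp ?j * ln ?j) = ln ?j" .
        have "?l * m k (cell k x) - ?l\<^sup>2 * quad_var k x < 2 * ln ?j"
          using elim by (auto simp: E_def not_le)
        then have "?l * m k (cell k x) < ?l * (?l * quad_var k x + 2 * sqrt (exp ?j * ln ?j))"
          using eq by (simp add: algebra_simps power2_eq_square)
        then show "m k (cell k x) < ?l * quad_var k x + 2 * sqrt (exp ?j * ln ?j)"
          using lp by simp
      qed
    qed
    then show ?case unfolding lam_def by (subst eventually_sequentially_seg[of _ J, symmetric]) simp
  qed
qed

text \<open>The quantifier over \<open>V\<close> stands inside the almost sure statement, so
  \<open>V\<close> may depend on the point. At index \<open>n\<close> take \<open>j\<close> to be
  the integer part of \<open>ln (V n)\<close>; then \<open>exp j \<le> V n \<le> 3 * exp j\<close>,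
  and 5 arises as 3 from the variance term plus 2 from the level.\<close>

theorem iterated_log_bound:
  "AE x in M. \<forall>V. (\<forall>n. quad_var n x \<le> V n) \<longrightarrow> filterlim V at_top sequentially \<longrightarrow>
     eventually (\<lambda>n. m n (cell n x) \<le> 5 * sqrt (V n * ln (ln (V n)))) sequentially"
  using bounded_eventually
proof eventually_elim
  case (elim x)
  then obtain J where J: "\<And>j k. j \<ge> J \<Longrightarrow> m k (cell k x) < sqrt (ln (real j) / exp (real j)) * quad_var k x
     + 2 * sqrt (exp (real j) * ln (real j))" unfolding eventually_sequentially by blast
  show ?case
  proof (intro allI impI)
    fix V :: "nat \<Rightarrow> real"
    assume V: "\<forall>n. quad_var n x \<le> V n" "filterlim V at_top sequentially"
    have "eventually (\<lambda>n. exp (real (max J 2)) \<le> V n) sequentially"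
      using V(2) unfolding filterlim_at_top by blast
    then show "eventually (\<lambda>n. m n (cell n x) \<le> 5 * sqrt (V n * ln (ln (V n)))) sequentially"
    proof eventually_elim
      case (elim n)
      let ?v = "V n"
      define j where "j = nat \<lfloor>ln ?v\<rfloor>"
      have vpos: "?v > 0" using elim by (meson exp_gt_zero less_le_trans)
      have lnv: "real (max J 2) \<le> ln ?v" using elim vpos by (simp add: ln_ge_iff)
      have jl: "real j \<le> ln ?v" "ln ?v < real j + 1" using lnv by (auto simp: j_def)
      have jJ: "j \<ge> J" "j \<ge> 2" using lnv unfolding j_def by (simp_all add: le_nat_floor)
      have e1: "exp (real j) \<le> ?v" using jl(1) vpos by (metis exp_le_cancel_iff exp_ln)
      have e2: "?v \<le> 3 * exp (real j)"
      proof -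
        have "?v \<le> exp (real j + 1)" using jl(2) vpos by (metis exp_le_cancel_iff exp_ln less_imp_le)
        also have "\<dots> \<le> 3 * exp (real j)" using exp_le by (simp add: exp_add mult.commute)
        finally show ?thesis .
      qed
      have lj: "0 < ln (real j)" using jJ by simp
      have lj2: "ln (real j) \<le> ln (ln ?v)" using jl jJ by simp
      let ?s = "sqrt (ln (real j) / exp (real j))" and ?t = "sqrt (exp (real j) * ln (real j))"
      have st: "?s * exp (real j) = ?t"
      proof -
        have "?s * exp (real j) = ?s * sqrt (exp (real j) * exp (real j))" by simp
        also have "\<dots> = sqrt (ln (real j) / exp (real j) * (exp (real j) * exp (real j)))"
          by (simp only: real_sqrt_mult)
        finally show ?thesis by (simp add: mult.commute)
      qed
      have "m n (cell n x) \<le> ?s * quad_var n x + 2 * ?t" using J[OF jJ(1), of n] by linarith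
      also have "\<dots> \<le> ?s * (3 * exp (real j)) + 2 * ?t"
        using V(1) e2 lj by (intro add_right_mono mult_left_mono) (auto intro: order_trans)
      also have "\<dots> = 5 * ?t" using st by (simp add: algebra_simps)
      also have "\<dots> \<le> 5 * sqrt (?v * ln (ln ?v))"
        using e1 lj lj2 by (intro mult_left_mono real_sqrt_le_mono mult_mono) (auto simp: vpos less_imp_le)
      finally show ?case .
    qed
  qed
qed

end

section \<open>Chains of atoms\<close>

text \<open>With \<open>B n\<close> the expression in brackets in the last assumption, \<open>\<theta> (Suc n) * \<delta> (Suc n)\<close> is at most
  \<open>K\<^sup>2 * (1 / B n - 1 / B (Suc n))\<close>; and \<open>\<theta> (Suc n) * (\<delta> n - \<delta> (Suc n))\<close> telescopes since \<open>\<theta> \<le> 1\<close>.\<close>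
lemma weighted_tail_sum_bound:
  fixes \<delta> \<theta> :: "nat \<Rightarrow> real"
  assumes pos: "\<And>n. 0 < \<delta> n" and dec: "\<And>n. \<delta> (Suc n) \<le> \<delta> n" and th: "\<And>n. 0 \<le> \<theta> n" "\<And>n. \<theta> n \<le> 1"
    and bound: "\<And>n. k \<le> n \<Longrightarrow> \<delta> n * (1 / \<delta> k + (\<Sum>l\<in>{k<..n}. \<theta> l / \<delta> l)) \<le> K"
  shows "(\<Sum>n=k..<N. \<theta> (Suc n) * \<delta> n) \<le> (K\<^sup>2 + 1) * \<delta> k"
proof -
  define B where "B n = 1 / \<delta> k + (\<Sum>l\<in>{k<..n}. \<theta> l / \<delta> l)" for n
  have Bpos: "0 < B n" for n
    unfolding B_def using pos th by (intro add_pos_nonneg sum_nonneg) (auto simp: less_imp_le)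
  have bound': "\<delta> n * B n \<le> K" if "k \<le> n" for n using bound that by (simp add: B_def)
  have B_Suc: "B (Suc n) = B n + \<theta> (Suc n) / \<delta> (Suc n)" if "k \<le> n" for n
  proof -
    have "{k<..Suc n} = insert (Suc n) {k<..n}" using that by auto
    then show ?thesis by (simp add: B_def)
  qed
  \<comment> \<open>Since \<open>B k = 1 / \<delta> k\<close>, the first bracket is the telescoped
    \<open>1 / B k - 1 / B N\<close>.\<close>
  have tele: "(\<Sum>n=k..<N. \<theta> (Suc n) * \<delta> n) \<le> K\<^sup>2 * (\<delta> k - 1 / B N) + (\<delta> k - \<delta> N)" if "k \<le> N" for N
    using that
  proof (induction N rule: dec_induct)
    case base
    then show ?case by (simp add: B_def)
  next
    case (step N)
    let ?t = "\<theta> (Suc N)" and ?d = "\<delta> (Suc N)"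
    have d: "0 < ?d" using pos .
    have "?t * (\<delta> N - ?d) \<le> 1 * (\<delta> N - ?d)" using th dec[of N] by (intro mult_right_mono) auto
    then have 1: "?t * \<delta> N \<le> ?t * ?d + (\<delta> N - ?d)" by (simp add: algebra_simps)
    have t: "?t = (B (Suc N) - B N) * ?d" using B_Suc[OF step(1)] d by simp
    have BB: "B N \<le> B (Suc N)" using B_Suc[OF step(1)] th d by (simp add: less_imp_le)
    have dB: "?d * B (Suc N) \<le> K" using bound'[of "Suc N"] step(1) by simp
    have dB0: "0 \<le> ?d * B (Suc N)" using d Bpos[of "Suc N"] by simp
    \<comment> \<open>The bound on \<open>\<delta> * B\<close> enters squared: writing
      \<open>?d\<close> as \<open>(?d * B (Suc N)) / B (Suc N)\<close> twice leaves a difference of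
      \<open>B\<close> over a square of \<open>B\<close>, which is dominated by the difference of
      reciprocals.\<close>
    have "?t * ?d = (B (Suc N) - B N) * (?d * B (Suc N))\<^sup>2 / (B (Suc N))\<^sup>2"
      using t Bpos[of "Suc N"] by (simp add: power_mult_distrib power2_eq_square)
    also have "\<dots> \<le> (B (Suc N) - B N) * K\<^sup>2 / (B (Suc N))\<^sup>2"
      using BB dB dB0 by (intro divide_right_mono mult_left_mono power_mono) auto
    also have "\<dots> \<le> (B (Suc N) - B N) * K\<^sup>2 / (B N * B (Suc N))"
      using BB Bpos[of N] Bpos[of "Suc N"] unfolding power2_eq_square[of "B (Suc N)"]
      by (intro divide_left_mono mult_right_mono mult_nonneg_nonneg mult_pos_pos) auto
    also have "\<dots> = K\<^sup>2 * (1 / B N - 1 / B (Suc N))"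
      using Bpos[of N] Bpos[of "Suc N"] by (simp add: field_simps)
    finally have "?t * ?d \<le> K\<^sup>2 * (1 / B N - 1 / B (Suc N))" .
    then show ?case using step 1 by (simp add: algebra_simps)
  qed
  have main: "(\<Sum>n=k..<N. \<theta> (Suc n) * \<delta> n) \<le> (K\<^sup>2 + 1) * \<delta> k" if "k \<le> N"
  proof -
    have "K\<^sup>2 * (\<delta> k - 1 / B N) \<le> K\<^sup>2 * \<delta> k" using Bpos[of N] by (intro mult_left_mono) auto
    moreover have "0 < \<delta> N" using pos .
    ultimately show ?thesis using tele[OF that] by (simp add: distrib_right)
  qed
  show ?thesis
  proof (cases "k \<le> N")
    case False
    then show ?thesis using pos[of k] by simp
  qed (rule main)
qed

section \<open>Fat blocks and the weighted sum of relative losses along a chain\<close>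

fun chain_weight :: "'a::metric_space measure \<Rightarrow> 'a set \<Rightarrow> 'a set list \<Rightarrow> real" where
  "chain_weight M A [] = 0"
| "chain_weight M A (B # Cs) = (1 - measure M B / measure M A) / diameter B + chain_weight M B Cs"

lemma chain_weight_append:
  "chain_weight M A (xs @ ys) = chain_weight M A xs + chain_weight M (last (A # xs)) ys"
  by (induction xs arbitrary: A) auto

definition shrinking :: "'a::metric_space measure \<Rightarrow> 'a set list \<Rightarrow> bool" where
  "shrinking M Cs \<longleftrightarrow> sorted_wrt (\<lambda>A B. B \<subseteq> A \<and> measure M B < measure M A) Cs \<and>
     (\<forall>A\<in>set Cs. bounded A \<and> 0 < diameter A \<and> 0 < measure M A)"

lemma shrinking_append:
  "shrinking M (xs @ ys) \<Longrightarrow> shrinking M xs \<and> shrinking M ys"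
  by (auto simp: shrinking_def sorted_wrt_append)

text \<open>A relative loss is a difference of consecutive measures over the larger one. With all
  denominators replaced by the common lower bound \<open>h * e\<close>, the differences
  telescope.\<close>

lemma chain_weight_block:
  assumes "shrinking M (A # xs)" "0 < h" "0 < e" "\<And>B. B \<in> set xs \<Longrightarrow> h \<le> measure M B"
    "\<And>B. B \<in> set xs \<Longrightarrow> e \<le> diameter B"
  shows "chain_weight M A xs \<le> (measure M A - measure M (last (A # xs))) / (h * e)"
  using assms
proof (induction xs arbitrary: A)
  case (Cons B xs)
  have B: "measure M B < measure M A" "h \<le> measure M B" "e \<le> diameter B" "0 < measure M B"
    using Cons.prems by (auto simp: shrinking_def)
  have "(1 - measure M B / measure M A) / diameter B = (measure M A - measure M B) / (measure M A * diameter B)"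
    using B by (simp add: field_simps)
  also have "\<dots> \<le> (measure M A - measure M B) / (h * e)"
    using B Cons.prems(2,3) by (intro divide_left_mono mult_mono mult_pos_pos) auto
  finally have "(1 - measure M B / measure M A) / diameter B \<le> (measure M A - measure M B) / (h * e)" .
  moreover have "chain_weight M B xs \<le> (measure M B - measure M (last (B # xs))) / (h * e)"
    using Cons.prems by (intro Cons.IH) (auto simp: shrinking_def)
  ultimately show ?case by (auto simp: diff_divide_distrib)
qed simp

lemma smallest_atom_in: "Xs \<noteq> [] \<Longrightarrow> smallest_atom M Xs \<in> set Xs"
  and smallest_atom_le: "B \<in> set Xs \<Longrightarrow> measure M (smallest_atom M Xs) \<le> measure M B"
  unfolding smallest_atom_def by (auto intro: arg_min_if_finite arg_min_least)

lemma largest_atom_in: 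
  assumes "Xs \<noteq> []" shows "largest_atom M Xs \<in> set Xs"
proof -
  have "Max (measure M ` set Xs) \<in> measure M ` set Xs" using assms by (intro Max_in) auto
  then obtain A where A: "A \<in> set Xs" "measure M A = Max (measure M ` set Xs)" by force
  show ?thesis unfolding largest_atom_def arg_max_on_def
    by (rule arg_maxI[where x = A]) (use A in \<open>auto simp: not_less\<close>)
qed

text \<open>Measures decrease strictly along the chain, so the atom of least measure comes last and
  is contained in all the others.\<close>

lemma diameter_smallest_atom_le:
  assumes "shrinking M Xs" "B \<in> set Xs"
  shows "diameter (smallest_atom M Xs) \<le> diameter B"
proof -
  have ne: "Xs \<noteq> []" using assms(2) by auto
  let ?S = "smallest_atom M Xs"
  obtain i j where ij: "i < length Xs" "Xs ! i = ?S" "j < length Xs" "Xs ! j = B"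
    using smallest_atom_in[OF ne] assms(2) by (metis in_set_conv_nth)
  have "\<not> i < j"
  proof
    assume "i < j"
    then have "measure M B < measure M ?S" using assms(1) ij
      unfolding shrinking_def sorted_wrt_iff_nth_less by metis
    then show False using smallest_atom_le[OF assms(2), of M] by simp
  qed
  then have "?S \<subseteq> B" using assms(1) ij
    unfolding shrinking_def sorted_wrt_iff_nth_less by (metis linorder_neqE_nat order_refl)
  then show ?thesis using assms by (intro diameter_subset) (auto simp: shrinking_def)
qed

text \<open>Within a fat block the total loss is at most half of the measure of the first atom while
  all measures stay above that half, so the block contributes at most the reciprocal
  \<open>1 / e\<close> of its least diameter. Entering a block costs one more such term, whence the
  factor 2.\<close>

lemma chain_weight_fat_blocks:
  assumes "shrinking M (A # Cs)"
  shows "1 / diameter A + chain_weight M A Cs \<le>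
    2 * (\<Sum>Xs\<leftarrow>fat_blocks M (A # Cs). inverse (diameter (smallest_atom M Xs)))"
  using assms
proof (induction "length Cs" arbitrary: A Cs rule: less_induct)
  case less
  define P where "P = (\<lambda>B. \<not> measure M B < measure M A / 2)"
  define xs ys where "xs = takeWhile P Cs" and "ys = dropWhile P Cs"
  define e where "e = diameter (smallest_atom M (A # xs))"
  have Cs: "Cs = xs @ ys" by (simp add: xs_def ys_def)
  have blocks: "fat_blocks M (A # Cs) = (A # xs) # fat_blocks M ys"
    by (simp add: xs_def ys_def P_def)
  have sh: "shrinking M (A # xs)" "shrinking M ys"
    using shrinking_append[of M "A # xs" ys] less.prems Cs by auto
  have dia: "e \<le> diameter B" if "B \<in> set (A # xs)" for B
    unfolding e_def using sh(1) that by (rule diameter_smallest_atom_le)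
  have e: "0 < e" unfolding e_def using smallest_atom_in[of "A # xs" M] sh(1) by (auto simp: shrinking_def)
  have mA: "0 < measure M A" using less.prems by (auto simp: shrinking_def)
  have half: "measure M A / 2 \<le> measure M B" if "B \<in> set (A # xs)" for B
    using that mA by (auto simp: xs_def P_def not_less dest: set_takeWhileD)
  have "chain_weight M A xs \<le> (measure M A - measure M (last (A # xs))) / (measure M A / 2 * e)"
    using sh(1) mA e half dia by (intro chain_weight_block) auto
  also have "\<dots> \<le> (measure M A - measure M A / 2) / (measure M A / 2 * e)"
    using half[of "last (A # xs)"] mA e by (intro divide_right_mono diff_left_mono) auto
  also have "\<dots> = 1 / e" using mA e by (simp add: field_simps)
  finally have cw: "chain_weight M A xs \<le> 1 / e" .
  have A: "1 / diameter A \<le> 1 / e" using dia[of A] e by (simp add: frac_le)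
  have rest: "chain_weight M (last (A # xs)) ys \<le> 2 * (\<Sum>Xs\<leftarrow>fat_blocks M ys. inverse (diameter (smallest_atom M Xs)))"
  proof (cases ys)
    case (Cons Y Ys)
    have "length Ys < length Cs" using Cs Cons by simp
    then have IH: "1 / diameter Y + chain_weight M Y Ys \<le>
        2 * (\<Sum>Xs\<leftarrow>fat_blocks M ys. inverse (diameter (smallest_atom M Xs)))"
      using less.hyps[of Ys Y] sh(2) Cons by simp
    have Y: "0 < diameter Y" using sh(2) Cons by (auto simp: shrinking_def)
    \<comment> \<open>The loss on entering a block may be close to 1. It is only bounded by 1, and
      this is the term \<open>1 / diameter Y\<close> that the induction hypothesis carries.\<close>
    have "(1 - measure M Y / measure M (last (A # xs))) / diameter Y \<le> 1 / diameter Y"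
      using Y by (intro divide_right_mono) auto
    then show ?thesis using IH Cons by simp
  qed simp
  have "chain_weight M A Cs = chain_weight M A xs + chain_weight M (last (A # xs)) ys"
    unfolding Cs by (rule chain_weight_append)
  then show ?case unfolding blocks using cw A rest e by (simp add: e_def[symmetric] inverse_eq_divide)
qed

lemma fat_blocks_in: "Xs \<in> set (fat_blocks M Cs) \<Longrightarrow> Xs \<noteq> [] \<and> set Xs \<subseteq> set Cs"
proof (induction M Cs rule: fat_blocks.induct)
  case (2 M A Cs)
  then show ?case
    by (auto dest: set_takeWhileD set_dropWhileD)
qed simp

text \<open>The condition on chains is used for the last block: its largest atom contains the last
  atom of the chain, and the sum then runs over all blocks.\<close>

lemma chain_weight_bound:
  assumes C: "chain_diam_bound M F C" and full: "full_chain F (A # Cs)" and sh: "shrinking M (A # Cs)"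
  shows "diameter (last (A # Cs)) * (1 / diameter A + chain_weight M A Cs) \<le> 2 * C"
proof -
  let ?L = "last (A # Cs)" and ?Xs = "fat_blocks M (A # Cs)"
  define i where "i = length ?Xs - 1"
  have len: "length ?Xs = Suc i" by (simp add: i_def)
  then have i: "i < length ?Xs" by simp
  let ?B = "largest_atom M (?Xs ! i)"
  have B: "?B \<in> set (A # Cs)"
    using fat_blocks_in[OF nth_mem[OF i]] largest_atom_in by blast
  have "?L \<subseteq> ?B"
  proof -
    obtain j where j: "j < length (A # Cs)" "(A # Cs) ! j = ?B" using B by (metis in_set_conv_nth)
    have L: "?L = (A # Cs) ! (length (A # Cs) - 1)" by (simp add: last_conv_nth)
    show ?thesis
    proof (cases "j = length (A # Cs) - 1")
      case True then show ?thesis using L j by simp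
    next
      case False
      then have "j < length (A # Cs) - 1" using j by simp
      then show ?thesis using sh j L unfolding shrinking_def sorted_wrt_iff_nth_less
        by (metis (no_types, lifting) diff_less length_greater_0_conv list.discI zero_less_one)
    qed
  qed
  then have dL: "diameter ?L \<le> diameter ?B"
    using B sh by (intro diameter_subset) (auto simp: shrinking_def)
  have "(\<Sum>Xs\<leftarrow>?Xs. inverse (diameter (smallest_atom M Xs))) =
      (\<Sum>j\<le>i. inverse (diameter (smallest_atom M (?Xs ! j))))"
    by (simp add: sum_list_sum_nth len atLeast0LessThan lessThan_Suc_atMost del: fat_blocks.simps)
  moreover have nonneg: "0 \<le> (\<Sum>j\<le>i. inverse (diameter (smallest_atom M (?Xs ! j))))"
  proof (intro sum_nonneg)
    fix j assume "j \<in> {..i}"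
    then have "j < length ?Xs" using len by simp
    then have "smallest_atom M (?Xs ! j) \<in> set (A # Cs)"
      using fat_blocks_in[OF nth_mem] smallest_atom_in by blast
    then have "0 < diameter (smallest_atom M (?Xs ! j))" using sh unfolding shrinking_def by blast
    then show "0 \<le> inverse (diameter (smallest_atom M (?Xs ! j)))" by simp
  qed
  ultimately have le: "1 / diameter A + chain_weight M A Cs \<le> 2 * (\<Sum>j\<le>i. inverse (diameter (smallest_atom M (?Xs ! j))))"
    using chain_weight_fat_blocks[OF sh] by simp
  have "0 < diameter ?L" using sh unfolding shrinking_def by (metis last_in_set list.discI)
  then have "diameter ?L * (1 / diameter A + chain_weight M A Cs) \<le>
      diameter ?L * (2 * (\<Sum>j\<le>i. inverse (diameter (smallest_atom M (?Xs ! j)))))"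
    using le by (intro mult_left_mono) auto
  also have "\<dots> \<le> diameter ?B * (2 * (\<Sum>j\<le>i. inverse (diameter (smallest_atom M (?Xs ! j)))))"
    using dL nonneg by (intro mult_right_mono) auto
  also have "\<dots> = 2 * (diameter ?B * (\<Sum>j\<le>i. inverse (diameter (smallest_atom M (?Xs ! j)))))" by simp
  also have "\<dots> \<le> 2 * C" using C full i unfolding chain_diam_bound_def Let_def by auto
  finally show ?thesis .
qed

text \<open>The chain of \<open>A\<close> and \<open>B\<close> is a single fat block, with
  \<open>A\<close> its largest and \<open>B\<close> its smallest atom. This instance of the
  condition on chains is what makes a Remez inequality between parent and child available.\<close>

lemma diameter_le_of_half:
  assumes C: "chain_diam_bound M F C" and ch: "child_atom F A B" and A: "0 < measure M A" "measure M A / 2 \<le> measure M B"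
    and lt: "measure M B < measure M A" and B: "0 < diameter B"
  shows "diameter A \<le> C * diameter B"
proof -
  have full: "full_chain F [A, B]" using ch by (auto simp: full_chain_def child_atom_def all_atoms_def)
  have blocks: "fat_blocks M [A, B] = [[A, B]]" using A(2) by simp
  have sm: "smallest_atom M [A, B] = B"
  proof -
    have "smallest_atom M [A, B] \<noteq> A"
    proof
      assume "smallest_atom M [A, B] = A"
      moreover have "measure M (smallest_atom M [A, B]) \<le> measure M B" by (rule smallest_atom_le) simp
      ultimately show False using lt by simp
    qed
    moreover have "smallest_atom M [A, B] \<in> {A, B}" using smallest_atom_in[of "[A, B]" M] by simp
    ultimately show ?thesis by blast
  qed
  have la: "largest_atom M [A, B] = A"
  proof -
    have "measure M (largest_atom M [A, B]) = measure M A"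
      unfolding largest_atom_def arg_max_on_def using lt by (intro arg_max_equality) auto
    then have "largest_atom M [A, B] \<noteq> B" using lt by (metis less_irrefl)
    moreover have "largest_atom M [A, B] \<in> {A, B}" using largest_atom_in[of "[A, B]" M] by simp
    ultimately show ?thesis by blast
  qed
  have "diameter A * inverse (diameter B) \<le> C"
    using C[unfolded chain_diam_bound_def, rule_format, OF full, unfolded Let_def, rule_format, of 0]
    unfolding blocks by (simp add: sm la)
  then show ?thesis using B by (simp add: field_simps)
qed

section \<open>Binary filtrations and projections\<close>

lemma sigma_sets_partition:
  assumes "X \<in> sigma_sets \<Omega> P" "\<Union>P = \<Omega>" "\<And>A B. A \<in> P \<Longrightarrow> B \<in> P \<Longrightarrow> A \<noteq> B \<Longrightarrow> A \<inter> B = {}"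
  shows "\<exists>Q\<subseteq>P. X = \<Union>Q"
  using assms(1)
proof induction
  case (Basic a) then show ?case by (intro exI[of _ "{a}"]) auto
next
  case Empty then show ?case by (intro exI[of _ "{}"]) auto
next
  case (Compl a)
  then obtain Q where Q: "Q \<subseteq> P" "a = \<Union>Q" by blast
  have "\<Omega> - a = \<Union>(P - Q)"
  proof
    show "\<Omega> - a \<subseteq> \<Union>(P - Q)" using Q(2) assms(2) by auto
    show "\<Union>(P - Q) \<subseteq> \<Omega> - a"
    proof
      fix x assume "x \<in> \<Union>(P - Q)"
      then obtain A where A: "A \<in> P" "A \<notin> Q" "x \<in> A" by blast
      have "x \<notin> B" if B: "B \<in> Q" for B
        using assms(3)[of A B] A B Q(1) by auto
      then show "x \<in> \<Omega> - a" using A Q(2) assms(2) by auto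
    qed
  qed
  then show ?case by (intro exI[of _ "P - Q"]) simp
next
  case (Union a)
  then have "\<forall>i. \<exists>Q. Q \<subseteq> P \<and> a i = \<Union>Q" by blast
  from choice[OF this] obtain Q where Q: "\<And>i::nat. Q i \<subseteq> P \<and> a i = \<Union>(Q i)" by blast
  then show ?case by (intro exI[of _ "\<Union>i. Q i"]) blast
qed

lemma atoms_of_partition:
  assumes N: "sets N = sigma_sets \<Omega> P" and P: "\<Union>P = \<Omega>" "{} \<notin> P"
    and disj: "\<And>A B. A \<in> P \<Longrightarrow> B \<in> P \<Longrightarrow> A \<noteq> B \<Longrightarrow> A \<inter> B = {}"
  shows "atoms N = P"
proof
  show "P \<subseteq> atoms N"
  proof
    fix A assume A: "A \<in> P"
    have "B = {} \<or> B = A" if BN: "B \<in> sets N" "B \<subseteq> A" for B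
    proof -
      obtain Q where Q: "Q \<subseteq> P" "B = \<Union>Q"
        using sigma_sets_partition[OF BN(1)[unfolded N] P(1) disj] by blast
      have "C = A" if "C \<in> Q" for C
      proof (rule ccontr)
        assume "C \<noteq> A"
        have C: "C \<in> P" "C \<subseteq> A" "C \<noteq> {}" using that Q BN(2) P(2) by auto
        then show False using disj[OF C(1) A \<open>C \<noteq> A\<close>] by auto
      qed
      then have "Q \<subseteq> {A}" by blast
      then show ?thesis using Q(2) by auto
    qed
    then show "A \<in> atoms N" using A P(2) by (auto simp: atoms_def N)
  qed
  show "atoms N \<subseteq> P"
  proof
    fix A assume A: "A \<in> atoms N"
    then have "A \<in> sigma_sets \<Omega> P" by (simp add: atoms_def N)
    from sigma_sets_partition[OF this P(1) disj] obtain Q where Q: "Q \<subseteq> P" "A = \<Union>Q" by blast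
    have "A \<noteq> {}" using A by (simp add: atoms_def)
    then obtain B where B: "B \<in> Q" using Q by auto
    then have "B \<in> sets N" "B \<subseteq> A" "B \<noteq> {}" using Q P(2) by (auto simp: N)
    then have "B = A" using A by (auto simp: atoms_def)
    then show "A \<in> P" using B Q by blast
  qed
qed

lemma halves_partition:
  assumes P: "\<Union>P = \<Omega>" "\<And>A B. A \<in> P \<Longrightarrow> B \<in> P \<Longrightarrow> A \<noteq> B \<Longrightarrow> A \<inter> B = {}"
    and halves: "\<And>A. A \<in> P \<Longrightarrow> lo A \<union> hi A = A \<and> lo A \<inter> hi A = {}"
  shows "\<Union>(\<Union>A\<in>P. {lo A, hi A}) = \<Omega>"
    and "B \<in> (\<Union>A\<in>P. {lo A, hi A}) \<Longrightarrow> C \<in> (\<Union>A\<in>P. {lo A, hi A}) \<Longrightarrow> B \<noteq> C \<Longrightarrow> B \<inter> C = {}"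
proof -
  have "\<Union>(\<Union>A\<in>P. {lo A, hi A}) = (\<Union>A\<in>P. lo A \<union> hi A)" by auto
  also have "\<dots> = (\<Union>A\<in>P. A)" by (intro SUP_cong refl) (use halves in blast)
  finally show "\<Union>(\<Union>A\<in>P. {lo A, hi A}) = \<Omega>" using P(1) by simp
  assume B: "B \<in> (\<Union>A\<in>P. {lo A, hi A})" and C: "C \<in> (\<Union>A\<in>P. {lo A, hi A})" and "B \<noteq> C"
  obtain A where A: "A \<in> P" "B = lo A \<or> B = hi A" using B by blast
  obtain D where D: "D \<in> P" "C = lo D \<or> C = hi D" using C by blast
  show "B \<inter> C = {}"
  proof (cases "A = D")
    case True
    then show ?thesis using A D \<open>B \<noteq> C\<close> halves[OF A(1)] by blast
  next
    case False
    then have "A \<inter> D = {}" using P(2)[OF A(1) D(1)] by blast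
    moreover have "B \<subseteq> A" "C \<subseteq> D" using A D halves[OF A(1)] halves[OF D(1)] by blast+
    ultimately show ?thesis by blast
  qed
qed

section \<open>The atoms of a binary filtration form a tree of cells\<close>

locale binary_tree = prob_space M for M :: "'a measure" +
  fixes F :: "nat \<Rightarrow> 'a measure"
  assumes binary: "binary_filtration M F"
begin

text \<open>An induction invariant: the atoms of the next level can be identified with the chosen
  halves only once the present atoms are known to partition the space.\<close>

definition good_level :: "nat \<Rightarrow> bool" where
  "good_level n \<longleftrightarrow> finite (atoms (F n)) \<and> \<Union>(atoms (F n)) = space M \<and>
     (\<forall>A\<in>atoms (F n). \<forall>B\<in>atoms (F n). A \<noteq> B \<longrightarrow> A \<inter> B = {}) \<and>
     (\<forall>A\<in>atoms (F n). A \<in> sets M \<and> 0 < measure M A)"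

lemma F0: "sets (F 0) = {{}, space M}" and subalg: "subalgebra M (F n)"
  using binary by (auto simp: binary_filtration_def)

lemma halves:
  "\<exists>lo hi. (\<forall>A\<in>atoms (F n). lo A \<in> sets M \<and> hi A \<in> sets M \<and> lo A \<union> hi A = A \<and>
      lo A \<inter> hi A = {} \<and> 0 < measure M (lo A) \<and> measure M (lo A) \<le> measure M (hi A)) \<and>
    sets (F (Suc n)) = sigma_sets (space M) (\<Union>A\<in>atoms (F n). {lo A, hi A})"
  using binary unfolding binary_filtration_def by (elim conjE) (erule allE)

lemma atoms_0: "atoms (F 0) = {space M}"
  using not_empty by (auto simp: atoms_def F0)

lemma split_level:
  assumes "good_level n"
  obtains lo hi where "\<And>A. A \<in> atoms (F n) \<Longrightarrow> lo A \<in> sets M \<and> hi A \<in> sets M \<and> lo A \<union> hi A = A \<and>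
      lo A \<inter> hi A = {} \<and> 0 < measure M (lo A) \<and> 0 < measure M (hi A)"
    "atoms (F (Suc n)) = (\<Union>A\<in>atoms (F n). {lo A, hi A})"
proof -
  obtain lo hi where lh: "\<And>A. A \<in> atoms (F n) \<Longrightarrow> lo A \<in> sets M \<and> hi A \<in> sets M \<and> lo A \<union> hi A = A \<and>
      lo A \<inter> hi A = {} \<and> 0 < measure M (lo A) \<and> measure M (lo A) \<le> measure M (hi A)"
    and s: "sets (F (Suc n)) = sigma_sets (space M) (\<Union>A\<in>atoms (F n). {lo A, hi A})"
    using halves[of n] by (elim exE conjE) (rule that, erule (1) bspec, assumption)
  have lh': "lo A \<in> sets M \<and> hi A \<in> sets M \<and> lo A \<union> hi A = A \<and>
      lo A \<inter> hi A = {} \<and> 0 < measure M (lo A) \<and> 0 < measure M (hi A)" if "A \<in> atoms (F n)" for A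
    using lh[OF that] by linarith
  have ne: "lo A \<noteq> {}" "hi A \<noteq> {}" if "A \<in> atoms (F n)" for A
    using lh'[OF that] by (metis measure_empty less_irrefl)+
  have "atoms (F (Suc n)) = (\<Union>A\<in>atoms (F n). {lo A, hi A})"
  proof (rule atoms_of_partition[OF s])
    show "\<Union>(\<Union>A\<in>atoms (F n). {lo A, hi A}) = space M"
      by (rule halves_partition) (use assms lh in \<open>auto simp: good_level_def\<close>)
    show "{} \<notin> (\<Union>A\<in>atoms (F n). {lo A, hi A})" using ne by fastforce
    show "B \<inter> C = {}" if "B \<in> (\<Union>A\<in>atoms (F n). {lo A, hi A})" "C \<in> (\<Union>A\<in>atoms (F n). {lo A, hi A})" "B \<noteq> C" for B C
      using that by (rule halves_partition(2)[rotated 3]) (use assms lh in \<open>auto simp: good_level_def\<close>)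
  qed
  then show ?thesis by (intro that[of lo hi] lh')
qed

lemma good_level: "good_level n"
proof (induction n)
  case 0
  show ?case using prob_space by (simp add: good_level_def atoms_0)
next
  case (Suc n)
  obtain lo hi where lh: "\<And>A. A \<in> atoms (F n) \<Longrightarrow> lo A \<in> sets M \<and> hi A \<in> sets M \<and> lo A \<union> hi A = A \<and>
      lo A \<inter> hi A = {} \<and> 0 < measure M (lo A) \<and> 0 < measure M (hi A)"
    and at: "atoms (F (Suc n)) = (\<Union>A\<in>atoms (F n). {lo A, hi A})"
    using split_level[OF Suc] by blast
  show ?case unfolding good_level_def
  proof (intro conjI ballI impI)
    show "finite (atoms (F (Suc n)))" unfolding at using Suc by (auto simp: good_level_def)
    show "\<Union>(atoms (F (Suc n))) = space M" unfolding at
      by (rule halves_partition) (use Suc lh in \<open>auto simp: good_level_def\<close>)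
    show "A \<in> sets M" "0 < measure M A" if "A \<in> atoms (F (Suc n))" for A
      using that lh unfolding at by blast+
    show "B \<inter> C = {}" if "B \<in> atoms (F (Suc n))" "C \<in> atoms (F (Suc n))" "B \<noteq> C" for B C
      using that unfolding at
      by (rule halves_partition(2)[rotated 3]) (use Suc lh in \<open>auto simp: good_level_def\<close>)
  qed
qed

sublocale cell_tree M "\<lambda>n. atoms (F n)"
proof
  fix n
  show "finite (atoms (F n))" "\<Union>(atoms (F n)) = space M"
    using good_level[of n] by (auto simp: good_level_def)
  show "atoms (F 0) = {space M}" by (rule atoms_0)
  show "A \<in> sets M" "0 < measure M A" if "A \<in> atoms (F n)" for A
    using good_level[of n] that by (auto simp: good_level_def)
  show "A \<inter> B = {}" if "A \<in> atoms (F n)" "B \<in> atoms (F n)" "A \<noteq> B" for A B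
    using good_level[of n] that by (auto simp: good_level_def)
  show "\<exists>A\<in>atoms (F n). B \<subseteq> A" if B: "B \<in> atoms (F (Suc n))" for B
  proof -
    obtain lo hi where lh: "\<And>A. A \<in> atoms (F n) \<Longrightarrow> lo A \<in> sets M \<and> hi A \<in> sets M \<and> lo A \<union> hi A = A \<and>
        lo A \<inter> hi A = {} \<and> 0 < measure M (lo A) \<and> 0 < measure M (hi A)"
      and at: "atoms (F (Suc n)) = (\<Union>A\<in>atoms (F n). {lo A, hi A})"
      using split_level[OF good_level[of n]] by blast
    obtain A where A: "A \<in> atoms (F n)" "B = lo A \<or> B = hi A" using B unfolding at by blast
    then have "B \<subseteq> A" using lh[OF A(1)] by blast
    then show ?thesis using A(1) by blast
  qed
qed

lemma sibling:
  fixes n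
  assumes x: "x \<in> space M"
  defines "A \<equiv> cell n x" and "B \<equiv> cell (Suc n) x"
  shows "A - B \<in> atoms (F (Suc n))" "children n A = {B, A - B}" "B \<subseteq> A" "B \<noteq> A - B"
    "measure M (A - B) = measure M A - measure M B" "measure M B < measure M A"
proof -
  have A: "A \<in> atoms (F n)" "x \<in> A" unfolding A_def using cell_At[OF x] by auto
  have B: "B \<in> atoms (F (Suc n))" "x \<in> B" unfolding B_def using cell_At[OF x] by auto
  show BA: "B \<subseteq> A" unfolding A_def B_def using cell_Suc_subset[OF x] .
  show "B \<noteq> A - B" using B by blast
  obtain lo hi where lh: "\<And>A. A \<in> atoms (F n) \<Longrightarrow> lo A \<in> sets M \<and> hi A \<in> sets M \<and> lo A \<union> hi A = A \<and>
      lo A \<inter> hi A = {} \<and> 0 < measure M (lo A) \<and> 0 < measure M (hi A)"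
    and at: "atoms (F (Suc n)) = (\<Union>A\<in>atoms (F n). {lo A, hi A})"
    using split_level[OF good_level[of n]] by blast
  obtain D where D: "D \<in> atoms (F n)" "B = lo D \<or> B = hi D" using B(1) unfolding at by blast
  have "x \<in> D" using D lh[OF D(1)] B(2) by blast
  then have DA: "D = A" using At_disjoint[OF D(1) A(1)] A(2) by blast
  have AB: "A - B = lo A \<or> A - B = hi A" using D(2) lh[OF A(1)] unfolding DA by blast
  then show AB': "A - B \<in> atoms (F (Suc n))" unfolding at using A(1) by blast
  show "children n A = {B, A - B}"
  proof
    show "{B, A - B} \<subseteq> children n A" using B AB' BA by (auto simp: children_def)
    show "children n A \<subseteq> {B, A - B}"
    proof
      fix C assume C: "C \<in> children n A"
      then have C': "C \<in> atoms (F (Suc n))" "C \<subseteq> A" by (auto simp: children_def)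
      have "C \<noteq> {}" using C' by (auto simp: atoms_def)
      then have "C \<inter> B \<noteq> {} \<or> C \<inter> (A - B) \<noteq> {}" using C'(2) by blast
      then show "C \<in> {B, A - B}" using At_disjoint[OF C'(1) B(1)] At_disjoint[OF C'(1) AB'] by blast
    qed
  qed
  show m: "measure M (A - B) = measure M A - measure M B"
    using A B At_sets BA by (intro finite_measure_Diff) auto
  show "measure M B < measure M A" using m At_pos[OF AB'] by simp
qed

text \<open>This holds at every point and not just almost everywhere: the chosen version is
  measurable with respect to \<open>F n\<close>, hence constant on atoms, and atoms have positive
  measure.\<close>

lemma real_cond_exp_cell:
  assumes x: "x \<in> space M" and int: "integrable M \<phi>"
  shows "real_cond_exp M (F n) \<phi> x = (LINT y:cell n x|M. \<phi> y) / measure M (cell n x)"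
proof -
  interpret S: finite_measure_subalgebra M "F n" by unfold_locales (rule subalg)
  let ?A = "cell n x" and ?g = "real_cond_exp M (F n) \<phi>"
  have A: "?A \<in> atoms (F n)" "x \<in> ?A" using cell_At[OF x] by auto
  have AF: "?A \<in> sets (F n)" using A by (simp add: atoms_def)
  have spF: "space (F n) = space M" using subalg[of n] by (simp add: subalgebra_def)
  have sub: "X = ?A" if "X \<in> sets (F n)" "X \<subseteq> ?A" "x \<in> X" for X
    using A(1) that by (auto simp: atoms_def)
  have const: "?g y = ?g x" if y: "y \<in> ?A" for y
  proof -
    have "{z \<in> space (F n). ?g z = ?g x} \<in> sets (F n)" by measurable
    then have "?A \<inter> {z \<in> space (F n). ?g z = ?g x} \<in> sets (F n)" using AF by blast
    moreover have "x \<in> ?A \<inter> {z \<in> space (F n). ?g z = ?g x}" using A x spF by simp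
    ultimately have "?A \<inter> {z \<in> space (F n). ?g z = ?g x} = ?A" by (intro sub Int_lower1)
    then show ?thesis using y by blast
  qed
  have "(LINT y:?A|M. \<phi> y) = (LINT y:?A|M. ?g y)" by (rule S.real_cond_exp_intA[OF int AF])
  also have "\<dots> = (LINT y:?A|M. ?g x)"
    using const by (intro set_lebesgue_integral_cong) (auto simp: At_sets[OF A(1)])
  also have "\<dots> = measure M ?A * ?g x"
    using At_sets[OF A(1)] by (subst set_integral_const) (auto simp: emeasure_eq_measure)
  finally show ?thesis using At_pos[OF A(1)] by simp
qed

end

section \<open>Projecting integrable functions onto finite spans of bounded functions\<close>

lemma (in finite_measure) integrable_mult_bounded:
  fixes u v :: "'a \<Rightarrow> real"
  assumes u: "integrable M u" and v: "v \<in> borel_measurable M" "\<exists>K. \<forall>x\<in>space M. \<bar>v x\<bar> \<le> K"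
  shows "integrable M (\<lambda>x. u x * v x)"
proof -
  obtain K where K: "\<forall>x\<in>space M. \<bar>v x\<bar> \<le> K" using v by blast
  show ?thesis
  proof (rule Bochner_Integration.integrable_bound[OF integrable_mult_left[OF integrable_abs[OF u], of K]])
    show "(\<lambda>x. u x * v x) \<in> borel_measurable M" using u v by measurable
    show "AE x in M. norm (u x * v x) \<le> norm (\<bar>u x\<bar> * K)"
    proof (rule AE_I2)
      fix x assume "x \<in> space M"
      then have "\<bar>v x\<bar> \<le> \<bar>K\<bar>" using K by fastforce
      then show "norm (u x * v x) \<le> norm (\<bar>u x\<bar> * K)" by (simp add: abs_mult mult_left_mono)
    qed
  qed
qed

text \<open>Gram--Schmidt: the induction adds to the span the component \<open>e\<close> of the new function
  orthogonal to the old span; if \<open>e\<close> vanishes almost everywhere, nothing has to be corrected.\<close>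
lemma (in finite_measure) orthogonal_projection_exists:
  fixes f :: "'a \<Rightarrow> real"
  assumes "finite B" "integrable M f" "\<And>b. b \<in> B \<Longrightarrow> b \<in> borel_measurable M"
    "\<And>b. b \<in> B \<Longrightarrow> \<exists>K. \<forall>x\<in>space M. \<bar>b x\<bar> \<le> K"
  shows "\<exists>c. \<forall>b\<in>B. (\<integral>x. (f x - (\<Sum>b'\<in>B. c b' * b' x)) * b x \<partial>M) = 0"
  using assms
proof (induction B arbitrary: f rule: finite_induct)
  case empty
  then show ?case by simp
next
  case (insert b B)
  note bd = integrable_mult_bounded
  have bounded_span: "\<exists>K. \<forall>x\<in>space M. \<bar>\<Sum>b'\<in>A. c b' * b' x\<bar> \<le> K" if "finite A" "A \<subseteq> insert b B" for c and A :: "('a \<Rightarrow> real) set"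
  proof -
    have "\<forall>b'\<in>A. \<exists>K. \<forall>x\<in>space M. \<bar>b' x\<bar> \<le> K" using insert.prems(3) that by blast
    from bchoice[OF this] obtain K where K: "\<And>b' x. b' \<in> A \<Longrightarrow> x \<in> space M \<Longrightarrow> \<bar>b' x\<bar> \<le> K b'" by blast
    have "\<bar>\<Sum>b'\<in>A. c b' * b' x\<bar> \<le> (\<Sum>b'\<in>A. \<bar>c b'\<bar> * K b')" if "x \<in> space M" for x
      by (rule order_trans[OF sum_abs]) (auto simp: abs_mult intro!: sum_mono mult_left_mono K that)
    then show ?thesis by blast
  qed
  have meas_span: "(\<lambda>x. \<Sum>b'\<in>A. c b' * b' x) \<in> borel_measurable M" if "A \<subseteq> insert b B" for c and A :: "('a \<Rightarrow> real) set"
    using insert.prems(2) that by (intro borel_measurable_sum borel_measurable_times) auto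
  have int_b: "integrable M b'" if "b' \<in> insert b B" for b'
    using bd[of "\<lambda>_. 1" b'] insert.prems(2,3)[OF that] by simp
  have int_span: "integrable M (\<lambda>x. \<Sum>b'\<in>A. c b' * b' x)" if "A \<subseteq> insert b B" for c and A :: "('a \<Rightarrow> real) set"
    using int_b that by (intro Bochner_Integration.integrable_sum integrable_mult_right) auto
  obtain c where c: "\<And>b'. b' \<in> B \<Longrightarrow> (\<integral>x. (f x - (\<Sum>b'\<in>B. c b' * b' x)) * b' x \<partial>M) = 0"
    using insert.IH[of f] insert.prems by blast
  \<comment> \<open>The induction hypothesis is used a second time, for the new function
    \<open>b\<close> itself; this is why it is stated for arbitrary \<open>f\<close>.\<close>
  obtain d where d: "\<And>b'. b' \<in> B \<Longrightarrow> (\<integral>x. (b x - (\<Sum>b'\<in>B. d b' * b' x)) * b' x \<partial>M) = 0"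
    using insert.IH[of b] insert.prems int_b[of b] by blast
  define h0 where "h0 x = (\<Sum>b'\<in>B. c b' * b' x)" for x
  define e where "e x = b x - (\<Sum>b'\<in>B. d b' * b' x)" for x
  define g where "g x = f x - h0 x" for x
  have int_g: "integrable M g" unfolding g_def h0_def
    by (intro Bochner_Integration.integrable_diff insert.prems(1) int_span) auto
  have int_e: "integrable M e" unfolding e_def
    by (intro Bochner_Integration.integrable_diff int_b int_span) auto
  have e_meas: "e \<in> borel_measurable M" using int_e by auto
  obtain K1 K2 where K: "\<forall>x\<in>space M. \<bar>b x\<bar> \<le> K1" "\<forall>x\<in>space M. \<bar>\<Sum>b'\<in>B. d b' * b' x\<bar> \<le> K2"
    using insert.prems(3)[of b] bounded_span[OF insert.hyps(1), of d] by auto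
  have "\<bar>e x\<bar> \<le> K1 + K2" if "x \<in> space M" for x
    unfolding e_def using K that abs_triangle_ineq4[of "b x" "\<Sum>b'\<in>B. d b' * b' x"] by fastforce
  then have e_bd: "\<exists>K. \<forall>x\<in>space M. \<bar>e x\<bar> \<le> K" by blast
  have int_ge: "integrable M (\<lambda>x. g x * e x)" and int_ee: "integrable M (\<lambda>x. e x * e x)"
    using bd[OF int_g e_meas e_bd] bd[OF int_e e_meas e_bd] by auto
  define \<alpha> where "\<alpha> = (if (\<integral>x. e x * e x \<partial>M) = 0 then 0 else (\<integral>x. g x * e x \<partial>M) / (\<integral>x. e x * e x \<partial>M))"
  define h where "h x = h0 x + \<alpha> * e x" for x
  define c' where "c' b' = (if b' = b then \<alpha> else c b' - \<alpha> * d b')" for b'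
  have h_span: "h x = (\<Sum>b'\<in>insert b B. c' b' * b' x)" for x
  proof -
    have "(\<Sum>b'\<in>B. c' b' * b' x) = (\<Sum>b'\<in>B. (c b' - \<alpha> * d b') * b' x)"
      using insert.hyps by (intro sum.cong) (auto simp: c'_def)
    also have "\<dots> = h0 x - \<alpha> * (\<Sum>b'\<in>B. d b' * b' x)"
      by (simp add: h0_def left_diff_distrib sum_subtractf sum_distrib_left mult.assoc)
    finally show ?thesis using insert.hyps
      by (simp add: h_def e_def c'_def algebra_simps)
  qed
  have orthB: "(\<integral>x. (f x - h x) * b' x \<partial>M) = 0" if b': "b' \<in> B" for b'
  proof -
    have b'm: "b' \<in> borel_measurable M" "\<exists>K. \<forall>x\<in>space M. \<bar>b' x\<bar> \<le> K" using insert.prems b' by auto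
    have "(\<integral>x. (f x - h x) * b' x \<partial>M) = (\<integral>x. g x * b' x - \<alpha> * (e x * b' x) \<partial>M)"
      by (simp add: h_def g_def algebra_simps)
    also have "\<dots> = (\<integral>x. g x * b' x \<partial>M) - \<alpha> * (\<integral>x. e x * b' x \<partial>M)"
      using bd[OF int_g b'm] bd[OF int_e b'm] by simp
    also have "\<dots> = 0" using c[OF b'] d[OF b'] by (simp add: g_def h0_def e_def)
    finally show ?thesis .
  qed
  have orth_e: "(\<integral>x. (f x - h x) * e x \<partial>M) = 0"
  proof -
    have "(\<integral>x. (f x - h x) * e x \<partial>M) = (\<integral>x. g x * e x - \<alpha> * (e x * e x) \<partial>M)"
      by (simp add: h_def g_def algebra_simps)
    also have "\<dots> = (\<integral>x. g x * e x \<partial>M) - \<alpha> * (\<integral>x. e x * e x \<partial>M)"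
      using int_ge int_ee by simp
    also have "\<dots> = 0"
    proof (cases "(\<integral>x. e x * e x \<partial>M) = 0")
      case True
      then have "AE x in M. e x * e x = 0"
        using integral_nonneg_eq_0_iff_AE[OF int_ee] by simp
      then have "AE x in M. g x * e x = 0" by eventually_elim simp
      then have "(\<integral>x. g x * e x \<partial>M) = 0" by (rule integral_eq_zero_AE)
      then show ?thesis using True by simp
    qed (simp add: \<alpha>_def)
    finally show ?thesis .
  qed
  have int_fh: "integrable M (\<lambda>x. f x - h x)"
    unfolding h_span by (intro Bochner_Integration.integrable_diff insert.prems(1) int_span) auto
  \<comment> \<open>The function \<open>b\<close> is \<open>e\<close> plus a combination of the old
    functions, and orthogonality to each of these is already known.\<close>
  have "(\<integral>x. (f x - h x) * b x \<partial>M) = (\<integral>x. (f x - h x) * e x + (\<Sum>b'\<in>B. d b' * ((f x - h x) * b' x)) \<partial>M)"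
    by (intro Bochner_Integration.integral_cong refl) (simp add: e_def algebra_simps sum_distrib_left)
  also have "\<dots> = (\<integral>x. (f x - h x) * e x \<partial>M) + (\<Sum>b'\<in>B. d b' * (\<integral>x. (f x - h x) * b' x \<partial>M))"
    using bd[OF int_fh] e_meas e_bd insert.prems(2,3)
    by (subst Bochner_Integration.integral_add)
      (auto simp: Bochner_Integration.integral_sum intro!: Bochner_Integration.integrable_sum)
  also have "\<dots> = 0" using orthB orth_e by simp
  finally have "(\<integral>x. (f x - h x) * b x \<partial>M) = 0" .
  then have "\<forall>b'\<in>insert b B. (\<integral>x. (f x - h x) * b' x \<partial>M) = 0" using orthB by blast
  then show ?case unfolding h_span by blast
qed

section \<open>Smartingales\<close>

locale smartingale_tree = binary_tree M F
  for M :: "'a::euclidean_space measure" and F +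
  fixes S :: "('a \<Rightarrow> real) set" and f :: "nat \<Rightarrow> 'a \<Rightarrow> real" and g :: "'a \<Rightarrow> real" and c1 c2 c3 c4 C L :: real
  assumes compact_space: "compact (space M)"
    and sets_M: "sets M = sets (restrict_space borel (space M))"
    and convex_atoms: "A \<in> all_atoms F \<Longrightarrow> convex A"
    and c4_pos: "0 < c4" and width: "A \<in> all_atoms F \<Longrightarrow> c4 * diameter A \<le> min_width A"
    and fin_dim: "finite_dim_space S" and polynomial: "p \<in> S \<Longrightarrow> real_polynomial_function p"
    and c3_pos: "0 < c3" and g_in: "g \<in> S" and g_bounds: "x \<in> space M \<Longrightarrow> c3 \<le> g x \<and> g x \<le> 1"
    and c1_pos: "0 < c1" and c2_pos: "0 < c2"
    and norming: "A \<in> all_atoms F \<Longrightarrow> p \<in> S \<Longrightarrow>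
      c2 * measure M A \<le> measure M {x\<in>A. c1 * sup_norm_on A p \<le> \<bar>p x\<bar>}"
    and smart: "smartingale M F S f"
    and increment_bound: "AE x in M. \<bar>increment f n x\<bar> \<le> L"
    and chain_bound: "chain_diam_bound M F C"
begin

lemma spanning_set:
  obtains B where "finite B" "B \<subseteq> S" "S = {p. \<exists>c. p = (\<lambda>x. \<Sum>b\<in>B. c b * b x)}"
proof -
  obtain B where fB: "finite B" and B: "S = {p. \<exists>c. p = (\<lambda>x. \<Sum>b\<in>B. c b * b x)}"
    using fin_dim unfolding finite_dim_space_def by blast
  have "b \<in> S" if "b \<in> B" for b
  proof -
    have "b = (\<lambda>x. \<Sum>b'\<in>B. (if b' = b then 1 else 0) * b' x)"
      using fB that by (simp add: if_distrib[of "\<lambda>c. c * _"] cong: if_cong)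
    then show ?thesis unfolding B by (intro CollectI exI[of _ "\<lambda>b'. if b' = b then 1 else 0"])
  qed
  then have "B \<subseteq> S" by blast
  then show ?thesis by (rule that[OF fB _ B])
qed

lemma diff_in: assumes "p \<in> S" "q \<in> S" shows "(\<lambda>x. p x - q x) \<in> S"
proof -
  obtain B where B: "S = {p. \<exists>c. p = (\<lambda>x. \<Sum>b\<in>B. c b * b x)}"
    using fin_dim unfolding finite_dim_space_def by blast
  obtain c d where "p = (\<lambda>x. \<Sum>b\<in>B. c b * b x)" "q = (\<lambda>x. \<Sum>b\<in>B. d b * b x)"
    using assms unfolding B by blast
  then have "(\<lambda>x. p x - q x) = (\<lambda>x. \<Sum>b\<in>B. (c b - d b) * b x)"
    by (simp add: left_diff_distrib sum_subtractf)
  then show ?thesis unfolding B by (intro CollectI exI[of _ "\<lambda>b. c b - d b"])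
qed

lemma zero_in: "(\<lambda>x. 0) \<in> S"
  using diff_in[OF g_in g_in] by simp

lemma uniform_line_degree: "\<exists>D. \<forall>p\<in>S. line_degree_le D p"
proof -
  obtain B where fB: "finite B" and BS: "B \<subseteq> S" and B: "S = {p. \<exists>c. p = (\<lambda>x. \<Sum>b\<in>B. c b * b x)}"
    by (rule spanning_set)
  have "\<forall>b\<in>B. \<exists>D. line_degree_le D b"
    using BS polynomial real_polynomial_function_line_degree by blast
  from bchoice[OF this] obtain D where D: "\<And>b. b \<in> B \<Longrightarrow> line_degree_le (D b) b" by blast
  have "line_degree_le (Max (D ` B)) b" if "b \<in> B" for b
    using D[OF that] fB that by (elim line_degree_le_mono) auto
  then have "line_degree_le (Max (D ` B)) p" if "p \<in> S" for p
    using that line_degree_le_lincomb[of B "Max (D ` B)"] unfolding B by auto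
  then show ?thesis by blast
qed

lemma continuous_S: "p \<in> S \<Longrightarrow> continuous_on A p"
  by (intro continuous_at_imp_continuous_on ballI continuous_real_polymonial_function polynomial)

lemma measurable_S [measurable]: "p \<in> S \<Longrightarrow> p \<in> borel_measurable M"
  by (subst measurable_cong_sets[OF sets_M refl]) (intro borel_measurable_continuous_on_restrict continuous_S)

lemma bounded_S: 
  assumes "p \<in> S" shows "\<exists>K. \<forall>x\<in>space M. \<bar>p x\<bar> \<le> K"
proof -
  have "bounded (p ` space M)"
    by (intro compact_imp_bounded compact_continuous_image continuous_S assms compact_space)
  then show ?thesis unfolding bounded_iff by auto
qed

lemma integrable_mult_S: "integrable M u \<Longrightarrow> p \<in> S \<Longrightarrow> integrable M (\<lambda>x. u x * p x)"
  by (intro integrable_mult_bounded measurable_S bounded_S)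

lemma integrable_S: "p \<in> S \<Longrightarrow> integrable M p"
  using integrable_mult_S[of "\<lambda>_. 1" p] by simp

lemma sum_atoms_indicator:
  assumes x: "x \<in> space M"
  shows "(\<Sum>A\<in>atoms (F n). indicator A x * h A) = (h (cell n x) :: real)"
proof -
  have "indicator A x * h A = (if A = cell n x then h (cell n x) else 0)" if "A \<in> atoms (F n)" for A
    using cell_eq[OF that, of x] cell_At(2)[OF x, of n] by (cases "x \<in> A") auto
  then have "(\<Sum>A\<in>atoms (F n). indicator A x * h A) = (\<Sum>A\<in>atoms (F n). if A = cell n x then h (cell n x) else 0)"
    by (intro sum.cong refl)
  then show ?thesis using finite_At[of n] cell_At(1)[OF x, of n] by simp
qed

lemma atom_all: "A \<in> atoms (F n) \<Longrightarrow> A \<in> all_atoms F"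
  by (auto simp: all_atoms_def)

lemma atom_bounded: "A \<in> atoms (F n) \<Longrightarrow> bounded A"
  by (rule bounded_subset[OF compact_imp_bounded[OF compact_space] At_subset_space])

lemma atom_nonempty: "A \<in> atoms (F n) \<Longrightarrow> A \<noteq> {}"
  by (simp add: atoms_def)

text \<open>An atom splits into two nonempty disjoint atoms of the next level, so it contains two
  distinct points.\<close>

lemma atom_diameter_pos:
  assumes A: "A \<in> atoms (F n)" shows "0 < diameter A"
proof -
  obtain x where x: "x \<in> A" using atom_nonempty[OF A] by blast
  have xM: "x \<in> space M" using At_subset_space[OF A] x by blast
  have cA: "cell n x = A" using cell_eq[OF A x] .
  obtain y where y: "y \<in> A - cell (Suc n) x"
    using atom_nonempty[OF sibling(1)[OF xM, of n]] cA by blast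
  have "x \<noteq> y" using y cell_At[OF xM, of "Suc n"] by blast
  then have "0 < dist x y" by simp
  also have "\<dots> \<le> diameter A" using diameter_bounded_bound[OF atom_bounded[OF A] x] y by blast
  finally show ?thesis .
qed

lemma bdd_above_S: assumes "A \<in> atoms (F n)" "p \<in> S" shows "bdd_above ((\<lambda>x. \<bar>p x\<bar>) ` A)"
proof -
  obtain K where "\<forall>x\<in>space M. \<bar>p x\<bar> \<le> K" using bounded_S[OF assms(2)] by blast
  then show ?thesis using At_subset_space[OF assms(1)] by (intro bdd_aboveI2[of _ _ K]) blast
qed

lemma sup_norm_ge: "A \<in> atoms (F n) \<Longrightarrow> p \<in> S \<Longrightarrow> x \<in> A \<Longrightarrow> \<bar>p x\<bar> \<le> sup_norm_on A p"
  unfolding sup_norm_on_def by (intro cSUP_upper bdd_above_S)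

lemma sup_norm_le: "A \<in> atoms (F n) \<Longrightarrow> (\<And>x. x \<in> A \<Longrightarrow> \<bar>p x\<bar> \<le> K) \<Longrightarrow> sup_norm_on A p \<le> K"
  unfolding sup_norm_on_def by (intro cSUP_least atom_nonempty)

lemma sup_norm_nonneg:
  assumes "A \<in> atoms (F n)" "p \<in> S" shows "0 \<le> sup_norm_on A p"
proof -
  obtain x where "x \<in> A" using atom_nonempty[OF assms(1)] by blast
  from sup_norm_ge[OF assms this] show ?thesis by linarith
qed

section \<open>Remez, Markov and norming inequalities on atoms\<close>

lemma chord:
  assumes A: "A \<in> atoms (F n)" shows "\<forall>v. norm v < c4 * diameter A \<longrightarrow> (\<exists>a\<in>A. a + v \<in> A)"
proof (intro allI impI)
  fix v :: 'a assume "norm v < c4 * diameter A"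
  also have "\<dots> \<le> min_width A" by (rule width[OF atom_all[OF A]])
  finally show "\<exists>a\<in>A. a + v \<in> A"
    by (rule chord_of_min_width[OF convex_atoms[OF atom_all[OF A]] atom_bounded[OF A] atom_nonempty[OF A]])
qed

lemma norm_le_diameter: "A \<in> atoms (F n) \<Longrightarrow> x \<in> A \<Longrightarrow> y \<in> A \<Longrightarrow> norm (y - x) \<le> diameter A"
  using diameter_bounded_bound[OF atom_bounded, of A n y x] by (simp add: dist_norm)

text \<open>Comparable diameters put every point of \<open>A\<close> within a fixed multiple of
  \<open>c4 * diameter B\<close> of a point of \<open>B\<close>, and chords up to that length exist
  in \<open>B\<close>.\<close>

lemma remez_parent:
  "\<exists>K\<ge>1. \<forall>p\<in>S. \<forall>A B m n. A \<in> atoms (F m) \<longrightarrow> B \<in> atoms (F n) \<longrightarrow> B \<subseteq> A \<longrightarrow>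
     diameter A \<le> C * diameter B \<longrightarrow> sup_norm_on A p \<le> K * sup_norm_on B p"
proof -
  obtain D where D: "\<And>p. p \<in> S \<Longrightarrow> line_degree_le D p" using uniform_line_degree by blast
  \<comment> \<open>The maximum is taken because the sign of \<open>C\<close> is not known
    here.\<close>
  define T where "T = max 0 (C / c4)"
  have T0: "0 \<le> T" by (simp add: T_def)
  obtain K where K1: "K \<ge> 1" and K: "\<And>(p::'a \<Rightarrow> real) A w m x y. line_degree_le D p \<Longrightarrow> convex A \<Longrightarrow> w > 0 \<Longrightarrow>
     (\<forall>v. norm v < w \<longrightarrow> (\<exists>a\<in>A. a + v \<in> A)) \<Longrightarrow> (\<forall>z\<in>A. \<bar>p z\<bar> \<le> m) \<Longrightarrow> x \<in> A \<Longrightarrow>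
     norm (y - x) \<le> T * w \<Longrightarrow> \<bar>p y\<bar> \<le> K * m"
    using line_degree_growth[of T D, OF T0] by blast
  have "sup_norm_on A p \<le> K * sup_norm_on B p"
    if p: "p \<in> S" and A: "A \<in> atoms (F m)" and B: "B \<in> atoms (F n)" and BA: "B \<subseteq> A"
      and dia: "diameter A \<le> C * diameter B" for p A B m n
  proof (rule sup_norm_le[OF A])
    fix y assume y: "y \<in> A"
    obtain x where x: "x \<in> B" using atom_nonempty[OF B] by blast
    have w: "0 < c4 * diameter B" using c4_pos atom_diameter_pos[OF B] by simp
    have "norm (y - x) \<le> diameter A" using norm_le_diameter[OF A _ y] x BA by blast
    also have "\<dots> \<le> C / c4 * (c4 * diameter B)" using dia c4_pos by simp
    also have "\<dots> \<le> T * (c4 * diameter B)" using w by (intro mult_right_mono) (auto simp: T_def)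
    finally show "\<bar>p y\<bar> \<le> K * sup_norm_on B p"
      using K[OF D[OF p] convex_atoms[OF atom_all[OF B]] w chord[OF B] _ x, of "sup_norm_on B p" y]
        sup_norm_ge[OF B p] by blast
  qed
  then show ?thesis using K1 by (intro exI[of _ K]) auto
qed

text \<open>On \<open>A\<close> the Lipschitz constant is of the order of the sup norm over the
  width, and the width is at least \<open>c4 * diameter A\<close>; two points of \<open>B\<close>
  are at most \<open>diameter B\<close> apart.\<close>

lemma markov_sub:
  "\<exists>K\<ge>1. \<forall>p\<in>S. \<forall>A B m n. A \<in> atoms (F m) \<longrightarrow> B \<in> atoms (F n) \<longrightarrow> B \<subseteq> A \<longrightarrow>
     (\<forall>y\<in>B. \<forall>z\<in>B. \<bar>p y - p z\<bar> \<le> K * sup_norm_on A p * (diameter B / diameter A))"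
proof -
  obtain D where D: "\<And>p. p \<in> S \<Longrightarrow> line_degree_le D p" using uniform_line_degree by blast
  have T0: "0 \<le> 1 / c4" using c4_pos by simp
  obtain K where K1: "K \<ge> 1" and K: "\<And>(p::'a \<Rightarrow> real) A w m x y z. line_degree_le D p \<Longrightarrow> convex A \<Longrightarrow> w > 0 \<Longrightarrow>
     (\<forall>v. norm v < w \<longrightarrow> (\<exists>a\<in>A. a + v \<in> A)) \<Longrightarrow> (\<forall>z\<in>A. \<bar>p z\<bar> \<le> m) \<Longrightarrow> x \<in> A \<Longrightarrow>
     norm (y - x) \<le> 1 / c4 * w \<Longrightarrow> norm (z - x) \<le> 1 / c4 * w \<Longrightarrow> \<bar>p y - p z\<bar> \<le> K * m * norm (y - z) / w"
    using line_degree_lipschitz[of "1 / c4" D, OF T0] by blast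
  have "\<bar>p y - p z\<bar> \<le> (K / c4 + 1) * sup_norm_on A p * (diameter B / diameter A)"
    if p: "p \<in> S" and A: "A \<in> atoms (F m)" and B: "B \<in> atoms (F n)" and BA: "B \<subseteq> A"
      and yz: "y \<in> B" "z \<in> B" for p A B m n y z
  proof -
    have dA: "0 < diameter A" and dB: "0 < diameter B" using atom_diameter_pos A B by auto
    have w: "0 < c4 * diameter A" using c4_pos dA by simp
    have near: "norm (u - y) \<le> 1 / c4 * (c4 * diameter A)" if "u \<in> B" for u
      using norm_le_diameter[OF A, of y u] that yz BA c4_pos by auto
    have N: "0 \<le> sup_norm_on A p" using sup_norm_nonneg[OF A p] .
    have "\<bar>p y - p z\<bar> \<le> K * sup_norm_on A p * norm (y - z) / (c4 * diameter A)"
      using K[OF D[OF p] convex_atoms[OF atom_all[OF A]] w chord[OF A] _ _ near near, of "sup_norm_on A p" y z]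
        sup_norm_ge[OF A p] yz BA by blast
    also have "\<dots> \<le> K * sup_norm_on A p * diameter B / (c4 * diameter A)"
      using norm_le_diameter[OF B yz(2) yz(1)] N K1 w by (intro divide_right_mono mult_left_mono) auto
    also have "\<dots> = K / c4 * (sup_norm_on A p * (diameter B / diameter A))" by simp
    also have "\<dots> \<le> (K / c4 + 1) * (sup_norm_on A p * (diameter B / diameter A))"
      using N dA dB by (intro mult_right_mono) auto
    finally show ?thesis by (simp only: mult.assoc)
  qed
  moreover have "K / c4 + 1 \<ge> 1" using K1 c4_pos by simp
  ultimately show ?thesis by (intro exI[of _ "K / c4 + 1"]) auto
qed

lemma norming_set: "p \<in> S \<Longrightarrow> A \<in> atoms (F n) \<Longrightarrow> {x\<in>A. K \<le> \<bar>p x\<bar>} \<in> sets M"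
proof -
  assume [measurable]: "p \<in> S" and A: "A \<in> atoms (F n)"
  have [measurable]: "A \<in> sets M" using At_sets[OF A] .
  have "{x\<in>A. K \<le> \<bar>p x\<bar>} = {x\<in>space M. x \<in> A \<and> K \<le> \<bar>p x\<bar>}" using At_subset_space[OF A] by auto
  also have "\<dots> \<in> sets M" by measurable
  finally show ?thesis .
qed

text \<open>A Chebyshev estimate on the norming set: the mean square on an atom controls the sup
  norm.\<close>

lemma square_lower:
  assumes p: "p \<in> S" and A: "A \<in> atoms (F n)"
  shows "c1\<^sup>2 * c2 * (sup_norm_on A p)\<^sup>2 * measure M A \<le> (LINT x:A|M. (p x)\<^sup>2)"
proof -
  let ?N = "sup_norm_on A p"
  define E where "E = {x\<in>A. c1 * ?N \<le> \<bar>p x\<bar>}"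
  have N: "0 \<le> ?N" using sup_norm_nonneg[OF A p] .
  have E: "E \<in> sets M" unfolding E_def using norming_set[OF p A] .
  have int: "integrable M (\<lambda>x. indicator A x * (p x)\<^sup>2)"
    using integrable_mult_indicator[OF At_sets[OF A] integrable_mult_S[OF integrable_S[OF p] p]]
    by (simp add: power2_eq_square)
  have "(c1 * ?N)\<^sup>2 * (c2 * measure M A) \<le> (c1 * ?N)\<^sup>2 * measure M E"
    unfolding E_def by (intro mult_left_mono norming[OF atom_all[OF A] p]) auto
  also have "\<dots> = (\<integral>x. (c1 * ?N)\<^sup>2 * indicator E x \<partial>M)" using E by simp
  also have "\<dots> \<le> (\<integral>x. indicator A x * (p x)\<^sup>2 \<partial>M)"
  proof (intro integral_mono int)
    show "integrable M (\<lambda>x. (c1 * ?N)\<^sup>2 * indicator E x)" using E by (simp add: emeasure_eq_measure)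
    fix x
    show "(c1 * ?N)\<^sup>2 * indicator E x \<le> indicator A x * (p x)\<^sup>2"
    proof (cases "x \<in> E")
      case True
      then have "(c1 * ?N)\<^sup>2 \<le> \<bar>p x\<bar>\<^sup>2" using N c1_pos by (intro power_mono) (auto simp: E_def)
      then show ?thesis using True by (simp add: E_def)
    qed auto
  qed
  finally show ?thesis by (simp add: set_lebesgue_integral_def power_mult_distrib mult_ac)
qed

text \<open>A bound valid almost everywhere must hold somewhere on the norming set, because that set
  has positive measure; this costs the factor \<open>c1\<close>.\<close>

lemma sup_norm_AE_le:
  assumes p: "p \<in> S" and A: "A \<in> atoms (F n)" and ae: "AE x in M. x \<in> A \<longrightarrow> \<bar>p x\<bar> \<le> K"
  shows "c1 * sup_norm_on A p \<le> K"
proof (rule ccontr)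
  let ?E = "{x\<in>A. c1 * sup_norm_on A p \<le> \<bar>p x\<bar>}"
  assume nt: "\<not> ?thesis"
  have "AE x in M. x \<notin> ?E" using ae by eventually_elim (use nt in auto)
  then have "measure M ?E = 0" using prob_eq_0[OF norming_set[OF p A]] by simp
  moreover have "0 < c2 * measure M A" using c2_pos At_pos[OF A] by simp
  ultimately show False using norming[OF atom_all[OF A] p] by simp
qed

section \<open>Projections, polynomial pieces and orthogonality of increments\<close>

definition proj :: "nat \<Rightarrow> ('a \<Rightarrow> real) \<Rightarrow> 'a \<Rightarrow> real" where
  "proj n \<phi> = orth_proj M (piecewise_space S (F n)) \<phi>"

lemma atom_projection:
  assumes A: "A \<in> atoms (F n)" and phi: "integrable M \<phi>"
  shows "\<exists>p\<in>S. \<forall>r\<in>S. (LINT x:A|M. (\<phi> x - p x) * r x) = 0"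
proof -
  obtain B where fB: "finite B" and "B \<subseteq> S" and B: "S = {p. \<exists>c. p = (\<lambda>x. \<Sum>b\<in>B. c b * b x)}"
    by (rule spanning_set)
  then have BS: "b \<in> S" if "b \<in> B" for b using that by blast
  have AM: "A \<in> sets M" "A \<subseteq> space M" using At_sets[OF A] At_subset_space[OF A] by auto
  interpret R: finite_measure "restrict_space M A"
    by (rule finite_measure_restrict_space[OF finite_measure_axioms AM(1)])
  have spR: "space (restrict_space M A) = A" using AM by (simp add: space_restrict_space2)
  have "\<exists>c. \<forall>b\<in>B. (\<integral>x. (\<phi> x - (\<Sum>b'\<in>B. c b' * b' x)) * b x \<partial>restrict_space M A) = 0"
  proof (rule R.orthogonal_projection_exists[OF fB])
    show "integrable (restrict_space M A) \<phi>"
      using AM integrable_mult_indicator[OF AM(1) phi] by (subst integrable_restrict_space) (auto simp: Int_absorb2)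
    show "b \<in> borel_measurable (restrict_space M A)" if "b \<in> B" for b
      using measurable_S[OF BS[OF that]] by (rule measurable_restrict_space1)
    show "\<exists>K. \<forall>x\<in>space (restrict_space M A). \<bar>b x\<bar> \<le> K" if "b \<in> B" for b
      using bounded_S[OF BS[OF that]] AM(2) unfolding spR by blast
  qed
  then obtain c where c: "\<And>b. b \<in> B \<Longrightarrow> (\<integral>x. (\<phi> x - (\<Sum>b'\<in>B. c b' * b' x)) * b x \<partial>restrict_space M A) = 0" by blast
  define p where "p x = (\<Sum>b'\<in>B. c b' * b' x)" for x
  have p: "p \<in> S" unfolding B p_def by blast
  have c': "(LINT x:A|M. (\<phi> x - p x) * b x) = 0" if "b \<in> B" for b
    using c[OF that] AM by (subst (asm) integral_restrict_space) (auto simp: p_def set_lebesgue_integral_def Int_absorb2)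
  have int: "integrable M (\<lambda>x. (\<phi> x - p x) * r x)" if "r \<in> S" for r
    using phi integrable_S[OF p] that by (intro integrable_mult_S) auto
  have "(LINT x:A|M. (\<phi> x - p x) * r x) = 0" if r: "r \<in> S" for r
  proof -
    obtain d where d: "r = (\<lambda>x. \<Sum>b\<in>B. d b * b x)" using r unfolding B by blast
    have "(LINT x:A|M. (\<phi> x - p x) * r x) = (\<integral>x. (\<Sum>b\<in>B. d b * (indicator A x *\<^sub>R ((\<phi> x - p x) * b x))) \<partial>M)"
      unfolding set_lebesgue_integral_def d
      by (intro Bochner_Integration.integral_cong refl) (simp add: sum_distrib_left mult_ac)
    also have "\<dots> = (\<Sum>b\<in>B. d b * (LINT x:A|M. (\<phi> x - p x) * b x))"
      unfolding set_lebesgue_integral_def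
      using integrable_mult_indicator[OF AM(1) int[OF BS]]
      by (subst Bochner_Integration.integral_sum) auto
    also have "\<dots> = 0" using c' by simp
    finally show ?thesis .
  qed
  then show ?thesis using p by blast
qed

text \<open>Projections on the single atoms glue together to one on the whole space. Hence the
  choice in \<open>orth_proj\<close> is made from a nonempty set and inherits its defining
  properties.\<close>

lemma proj_props:
  assumes phi: "integrable M \<phi>"
  shows "proj n \<phi> \<in> piecewise_space S (F n)"
    and "v \<in> piecewise_space S (F n) \<Longrightarrow> (\<integral>x. (\<phi> x - proj n \<phi> x) * v x \<partial>M) = 0"
proof -
  have "\<forall>A\<in>atoms (F n). \<exists>p. p \<in> S \<and> (\<forall>r\<in>S. (LINT x:A|M. (\<phi> x - p x) * r x) = 0)"
    using atom_projection[OF _ phi] by blast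
  from bchoice[OF this] obtain P where P: "\<And>A. A \<in> atoms (F n) \<Longrightarrow> P A \<in> S"
    "\<And>A r. A \<in> atoms (F n) \<Longrightarrow> r \<in> S \<Longrightarrow> (LINT x:A|M. (\<phi> x - P A x) * r x) = 0" by blast
  define h where "h x = P (cell n x) x" for x
  have h_in: "h \<in> piecewise_space S (F n)"
    unfolding piecewise_space_def h_def using P(1) cell_eq by auto
  have "(\<integral>x. (\<phi> x - h x) * v x \<partial>M) = 0" if v: "v \<in> piecewise_space S (F n)" for v
  proof -
    let ?w = "\<lambda>x. (\<phi> x - h x) * v x"
    have on_A: "integrable M (\<lambda>x. indicator A x *\<^sub>R ?w x) \<and> (\<integral>x. indicator A x *\<^sub>R ?w x \<partial>M) = 0"
      if A: "A \<in> atoms (F n)" for A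
    proof -
      obtain r where r: "r \<in> S" "\<And>x. x \<in> A \<Longrightarrow> v x = r x"
        using v A unfolding piecewise_space_def by blast
      have eq: "(\<lambda>x. indicator A x *\<^sub>R ?w x) = (\<lambda>x. indicator A x *\<^sub>R ((\<phi> x - P A x) * r x))"
        by (rule ext) (auto simp: indicator_def h_def cell_eq[OF A] r(2))
      have "integrable M (\<lambda>x. (\<phi> x - P A x) * r x)"
        using phi integrable_S[OF P(1)[OF A]] r(1) by (intro integrable_mult_S) auto
      from integrable_mult_indicator[OF At_sets[OF A] this] show ?thesis
        unfolding eq using P(2)[OF A r(1)] unfolding set_lebesgue_integral_def by blast
    qed
    have "(\<integral>x. ?w x \<partial>M) = (\<integral>x. (\<Sum>A\<in>atoms (F n). indicator A x *\<^sub>R ?w x) \<partial>M)"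
    proof (intro Bochner_Integration.integral_cong refl)
      fix x assume x: "x \<in> space M"
      show "?w x = (\<Sum>A\<in>atoms (F n). indicator A x *\<^sub>R ?w x)"
        using sum_atoms_indicator[OF x, of "\<lambda>_. ?w x" n] unfolding real_scaleR_def by (rule sym)
    qed
    also have "\<dots> = (\<Sum>A\<in>atoms (F n). (\<integral>x. indicator A x *\<^sub>R ?w x \<partial>M))"
      using on_A by (intro Bochner_Integration.integral_sum) blast
    also have "\<dots> = 0" using on_A by (intro sum.neutral) blast
    finally show ?thesis .
  qed
  then have "\<exists>h. h \<in> piecewise_space S (F n) \<and> (\<forall>v\<in>piecewise_space S (F n). (\<integral>x. (\<phi> x - h x) * v x \<partial>M) = 0)"
    using h_in by blast
  from someI_ex[OF this]
  have sel: "proj n \<phi> \<in> piecewise_space S (F n) \<and> (\<forall>v\<in>piecewise_space S (F n). (\<integral>x. (\<phi> x - proj n \<phi> x) * v x \<partial>M) = 0)"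
    unfolding proj_def orth_proj_def .
  show "proj n \<phi> \<in> piecewise_space S (F n)"
    and "v \<in> piecewise_space S (F n) \<Longrightarrow> (\<integral>x. (\<phi> x - proj n \<phi> x) * v x \<partial>M) = 0"
    using sel by simp_all
qed

lemma integrable_f: "integrable M (f n)"
  using smart by (simp add: smartingale_def)

lemma f_eq_proj: "AE x in M. f n x = proj n (f (Suc n)) x"
proof -
  have "AE x in M. proj (Suc n - 1) (f (Suc n)) x = f (Suc n - 1) x"
    using smart unfolding smartingale_def proj_def by (elim conjE allE[of _ "Suc n"]) simp
  then show ?thesis by eventually_elim simp
qed

text \<open>Only almost everywhere is \<open>f n\<close> known to be piecewise in \<open>S\<close>.
  Its version \<open>proj n (f (Suc n))\<close> is so everywhere, and the pieces are read off from
  that version.\<close>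

definition piece :: "nat \<Rightarrow> 'a set \<Rightarrow> 'a \<Rightarrow> real" where
  "piece n A = (SOME p. p \<in> S \<and> (\<forall>x\<in>A. proj n (f (Suc n)) x = p x))"

lemma piece:
  assumes "A \<in> atoms (F n)" shows "piece n A \<in> S" "x \<in> A \<Longrightarrow> proj n (f (Suc n)) x = piece n A x"
proof -
  have "\<exists>p. p \<in> S \<and> (\<forall>x\<in>A. proj n (f (Suc n)) x = p x)"
    using proj_props(1)[OF integrable_f, of n "Suc n"] assms unfolding piecewise_space_def by blast
  from someI_ex[OF this] show "piece n A \<in> S" "x \<in> A \<Longrightarrow> proj n (f (Suc n)) x = piece n A x"
    unfolding piece_def by blast+
qed

lemma f_eq_piece: "AE x in M. f n x = piece n (cell n x) x"
  using f_eq_proj[of n] AE_space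
proof eventually_elim
  case (elim x)
  then show ?case using piece(2)[OF cell_At[OF elim(2), of n]] by simp
qed

lemma measurable_proj: "proj n (f (Suc n)) \<in> borel_measurable M"
proof -
  have "(\<lambda>x. \<Sum>A\<in>atoms (F n). indicator A x * piece n A x) \<in> borel_measurable M"
    using piece(1) At_sets by (intro borel_measurable_sum borel_measurable_times measurable_S borel_measurable_indicator) auto
  moreover have "proj n (f (Suc n)) x = (\<Sum>A\<in>atoms (F n). indicator A x * piece n A x)" if x: "x \<in> space M" for x
  proof -
    show ?thesis
      using sum_atoms_indicator[OF x, of "\<lambda>A. piece n A x" n] piece(2)[OF cell_At[OF x, of n]] by simp
  qed
  ultimately show ?thesis by (simp cong: measurable_cong)
qed

text \<open>The test function that equals \<open>p\<close> on \<open>A\<close> and 0 elsewhere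
  belongs to the space of level \<open>n\<close>, which localises orthogonality to single
  atoms.\<close>

lemma increment_orthogonal:
  assumes A: "A \<in> atoms (F n)" and p: "p \<in> S"
  shows "(LINT x:A|M. increment f (Suc n) x * p x) = 0"
proof -
  have [measurable]: "f m \<in> borel_measurable M" for m using integrable_f by auto
  have [measurable]: "A \<in> sets M" "p \<in> borel_measurable M" "proj n (f (Suc n)) \<in> borel_measurable M"
    using At_sets[OF A] measurable_S[OF p] measurable_proj by auto
  define v where "v x = indicator A x * p x" for x
  have v: "v \<in> piecewise_space S (F n)"
    unfolding piecewise_space_def
  proof (intro CollectI ballI)
    fix B assume B: "B \<in> atoms (F n)"
    show "\<exists>q\<in>S. \<forall>x\<in>B. v x = q x"
    proof (cases "B = A")
      case True
      then show ?thesis using p by (auto simp: v_def)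
    next
      case False
      then have "A \<inter> B = {}" using At_disjoint[OF A B] by blast
      then have "\<forall>x\<in>B. v x = 0" by (auto simp: v_def indicator_def)
      then show ?thesis using zero_in by (intro bexI[of _ "\<lambda>x. 0"])
    qed
  qed
  have "(LINT x:A|M. increment f (Suc n) x * p x) = (\<integral>x. (f (Suc n) x - f n x) * v x \<partial>M)"
    unfolding set_lebesgue_integral_def v_def
    by (intro Bochner_Integration.integral_cong refl) (simp add: increment_def)
  also have "\<dots> = (\<integral>x. (f (Suc n) x - proj n (f (Suc n)) x) * v x \<partial>M)"
  proof (rule integral_cong_AE)
    show "AE x in M. (f (Suc n) x - f n x) * v x = (f (Suc n) x - proj n (f (Suc n)) x) * v x"
      using f_eq_proj[of n] by eventually_elim simp
  qed (unfold v_def, measurable)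
  also have "\<dots> = 0" by (rule proj_props(2)[OF integrable_f v])
  finally show ?thesis .
qed

end

text \<open>A Schur test. Cauchy-Schwarz in \<open>k\<close> uses the row bound \<open>B\<close> for
  the sum of \<open>\<theta> k * \<delta> n / \<delta> k\<close>; after exchanging the sums,
  \<open>weighted_tail_sum_bound\<close> supplies the column bound
  \<open>B\<^sup>2 + 1\<close>.\<close>

lemma oscillation_sum_bound:
  fixes \<delta> \<theta> e N :: "nat \<Rightarrow> real"
  assumes pos: "\<And>n. 0 < \<delta> n" and dec: "\<And>n. \<delta> (Suc n) \<le> \<delta> n" and th: "\<And>n. 0 \<le> \<theta> n" "\<And>n. \<theta> n \<le> 1" "\<theta> 0 = 1"
    and bound: "\<And>k n. k \<le> n \<Longrightarrow> \<delta> n * (1 / \<delta> k + (\<Sum>l\<in>{k<..n}. \<theta> l / \<delta> l)) \<le> B"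
    and N: "\<And>k. 0 \<le> N k" "\<And>k. N k \<le> K * \<theta> k" "\<And>k. (N k)\<^sup>2 \<le> K * \<theta> k * e k" and e: "\<And>k. 0 \<le> e k" and K: "0 \<le> K"
  shows "(\<Sum>k\<le>n. N k * (\<delta> n / \<delta> k)) \<le> K * B"
    and "(\<Sum>n<m. \<theta> (Suc n) * (\<Sum>k\<le>n. N k * (\<delta> n / \<delta> k))\<^sup>2) \<le> K * B * (B\<^sup>2 + 1) * (\<Sum>k<m. e k)"
proof -
  have W: "(\<Sum>k\<le>n. \<theta> k * (\<delta> n / \<delta> k)) \<le> B" for n
  proof -
    have "{..n} = insert 0 {0<..n}" by auto
    then have "(\<Sum>k\<le>n. \<theta> k * (\<delta> n / \<delta> k)) = \<delta> n * (1 / \<delta> 0 + (\<Sum>l\<in>{0<..n}. \<theta> l / \<delta> l))"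
      using th(3) by (simp add: sum_distrib_left distrib_left mult_ac)
    also have "\<dots> \<le> B" by (rule bound) simp
    finally show ?thesis .
  qed
  have B0: "0 \<le> B"
    by (rule order_trans[OF _ W[of 0]]) (use pos th in \<open>auto intro!: less_imp_le\<close>)
  have "(\<Sum>k\<le>n. N k * (\<delta> n / \<delta> k)) \<le> (\<Sum>k\<le>n. (K * \<theta> k) * (\<delta> n / \<delta> k))"
    using N pos by (intro sum_mono mult_right_mono) (auto intro!: divide_nonneg_nonneg less_imp_le)
  also have "\<dots> = K * (\<Sum>k\<le>n. \<theta> k * (\<delta> n / \<delta> k))" by (simp add: sum_distrib_left mult.assoc)
  also have "\<dots> \<le> K * B" using W K by (intro mult_left_mono)
  finally show "(\<Sum>k\<le>n. N k * (\<delta> n / \<delta> k)) \<le> K * B" .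
  have sq: "(\<Sum>k\<le>n. N k * (\<delta> n / \<delta> k))\<^sup>2 \<le> K * B * (\<Sum>k\<le>n. e k * (\<delta> n / \<delta> k))" for n
  proof -
    have w0: "0 \<le> \<delta> n / \<delta> k" for k using pos by (auto intro!: divide_nonneg_nonneg less_imp_le)
    \<comment> \<open>The quadratic bound on \<open>N k\<close> is split so that one factor carries
      \<open>\<theta> k\<close> and the other \<open>e k\<close>, each with half of the weight
      \<open>\<delta> n / \<delta> k\<close>.\<close>
    have "N k * (\<delta> n / \<delta> k) \<le> sqrt (K * \<theta> k * (\<delta> n / \<delta> k)) * sqrt (e k * (\<delta> n / \<delta> k))" for k
    proof -
      have "N k \<le> sqrt (K * \<theta> k * e k)" using N by (intro real_le_rsqrt)
      then have "N k * (\<delta> n / \<delta> k) \<le> sqrt (K * \<theta> k * e k) * sqrt ((\<delta> n / \<delta> k) * (\<delta> n / \<delta> k))"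
        unfolding real_sqrt_abs2 abs_of_nonneg[OF w0] by (intro mult_right_mono w0)
      also have "\<dots> = sqrt (K * \<theta> k * (\<delta> n / \<delta> k)) * sqrt (e k * (\<delta> n / \<delta> k))"
        unfolding real_sqrt_mult[symmetric] by (simp add: mult_ac)
      finally show ?thesis .
    qed
    then have "(\<Sum>k\<le>n. N k * (\<delta> n / \<delta> k)) \<le> (\<Sum>k\<le>n. sqrt (K * \<theta> k * (\<delta> n / \<delta> k)) * sqrt (e k * (\<delta> n / \<delta> k)))"
      by (intro sum_mono)
    then have "(\<Sum>k\<le>n. N k * (\<delta> n / \<delta> k))\<^sup>2 \<le> (\<Sum>k\<le>n. sqrt (K * \<theta> k * (\<delta> n / \<delta> k)) * sqrt (e k * (\<delta> n / \<delta> k)))\<^sup>2"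
      using N w0 by (intro power_mono sum_nonneg mult_nonneg_nonneg)
    also have "\<dots> \<le> (\<Sum>k\<le>n. (sqrt (K * \<theta> k * (\<delta> n / \<delta> k)))\<^sup>2) * (\<Sum>k\<le>n. (sqrt (e k * (\<delta> n / \<delta> k)))\<^sup>2)"
      by (rule Cauchy_Schwarz_ineq_sum)
    also have "\<dots> = (\<Sum>k\<le>n. K * \<theta> k * (\<delta> n / \<delta> k)) * (\<Sum>k\<le>n. e k * (\<delta> n / \<delta> k))"
    proof -
      have "(sqrt (K * \<theta> k * (\<delta> n / \<delta> k)))\<^sup>2 = K * \<theta> k * (\<delta> n / \<delta> k)" for k
        using K th(1) w0 by (intro real_sqrt_pow2 mult_nonneg_nonneg)
      moreover have "(sqrt (e k * (\<delta> n / \<delta> k)))\<^sup>2 = e k * (\<delta> n / \<delta> k)" for k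
        using e w0 by (intro real_sqrt_pow2 mult_nonneg_nonneg)
      ultimately show ?thesis by simp
    qed
    also have "\<dots> = (K * (\<Sum>k\<le>n. \<theta> k * (\<delta> n / \<delta> k))) * (\<Sum>k\<le>n. e k * (\<delta> n / \<delta> k))"
      by (simp add: sum_distrib_left mult.assoc)
    also have "\<dots> \<le> (K * B) * (\<Sum>k\<le>n. e k * (\<delta> n / \<delta> k))"
      using W K e w0 by (intro mult_right_mono mult_left_mono sum_nonneg mult_nonneg_nonneg)
    finally show ?thesis .
  qed
  have "(\<Sum>n<m. \<theta> (Suc n) * (\<Sum>k\<le>n. N k * (\<delta> n / \<delta> k))\<^sup>2) \<le>
      (\<Sum>n<m. \<theta> (Suc n) * (K * B * (\<Sum>k\<le>n. e k * (\<delta> n / \<delta> k))))"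
    using sq th by (intro sum_mono mult_left_mono)
  also have "\<dots> = K * B * (\<Sum>n<m. \<Sum>k\<le>n. (e k / \<delta> k) * (\<theta> (Suc n) * \<delta> n))"
    by (simp add: sum_distrib_left mult_ac)
  also have "(\<Sum>n<m. \<Sum>k\<le>n. (e k / \<delta> k) * (\<theta> (Suc n) * \<delta> n)) =
      (\<Sum>k<m. \<Sum>n=k..<m. (e k / \<delta> k) * (\<theta> (Suc n) * \<delta> n))"
    unfolding sum.Sigma[OF finite_lessThan ballI[OF finite_atMost]] sum.Sigma[OF finite_lessThan ballI[OF finite_atLeastLessThan]]
    by (rule sum.reindex_bij_witness[of _ "\<lambda>(k, n). (n, k)" "\<lambda>(n, k). (k, n)"]) auto
  also have "\<dots> = (\<Sum>k<m. (e k / \<delta> k) * (\<Sum>n=k..<m. \<theta> (Suc n) * \<delta> n))"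
    by (simp add: sum_distrib_left)
  also have "K * B * \<dots> \<le> K * B * (\<Sum>k<m. (e k / \<delta> k) * ((B\<^sup>2 + 1) * \<delta> k))"
    using K B0 pos e[THEN divide_nonneg_pos, OF pos]
    by (intro mult_left_mono sum_mono weighted_tail_sum_bound dec th bound) auto
  also have "\<dots> = K * B * (B\<^sup>2 + 1) * (\<Sum>k<m. e k)"
  proof -
    have "(e k / \<delta> k) * ((B\<^sup>2 + 1) * \<delta> k) = (B\<^sup>2 + 1) * e k" for k
      using pos[of k] by simp
    then show ?thesis by (simp add: sum_distrib_left[symmetric] mult.assoc)
  qed
  finally show "(\<Sum>n<m. \<theta> (Suc n) * (\<Sum>k\<le>n. N k * (\<delta> n / \<delta> k))\<^sup>2) \<le> K * B * (B\<^sup>2 + 1) * (\<Sum>k<m. e k)" .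
qed

section \<open>Jumps, their norms and the chain of cells at a point\<close>

context smartingale_tree
begin

text \<open>The increment on the cell of \<open>x\<close>, continued as one polynomial. It is also
  evaluated on the parent cell, where it agrees with the increment only on the part containing
  \<open>x\<close>.\<close>

definition jump :: "nat \<Rightarrow> 'a \<Rightarrow> 'a \<Rightarrow> real" where
  "jump n x = (if n = 0 then piece 0 (cell 0 x)
     else (\<lambda>y. piece n (cell n x) y - piece (n - 1) (cell (n - 1) x) y))"

definition jump_norm :: "nat \<Rightarrow> 'a \<Rightarrow> real" where
  "jump_norm n x = sup_norm_on (cell n x) (jump n x)"

text \<open>This is the weight \<open>\<theta>\<close> of the summation lemmas. The value 1 at level
  0 turns \<open>1 / \<delta> 0\<close> into the first term of the sum of
  \<open>\<theta> / \<delta>\<close>.\<close>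

definition loss :: "nat \<Rightarrow> 'a \<Rightarrow> real" where
  "loss n x = (if n = 0 then 1 else 1 - measure M (cell n x) / measure M (cell (n - 1) x))"

definition mean_square :: "nat \<Rightarrow> nat \<Rightarrow> 'a \<Rightarrow> real" where
  "mean_square n k x = (LINT y:cell n x|M. (increment f k y)\<^sup>2) / measure M (cell n x)"

definition energy :: "nat \<Rightarrow> 'a \<Rightarrow> real" where
  "energy k x = mean_square k k x + (if k = 0 then 0 else mean_square (k - 1) k x)"

lemma jump_in: "x \<in> space M \<Longrightarrow> jump n x \<in> S"
  by (auto simp: jump_def intro!: diff_in piece(1) cell_At(1))

lemma jump_cong:
  assumes x: "x \<in> space M" and y: "y \<in> cell n x"
  shows "jump n y = jump n x"
proof -
  have "y \<in> cell (n - 1) x" using y cell_antimono[OF x, of "n - 1" n] by auto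
  then show ?thesis using cell_cong[OF x y] cell_cong[OF x, of y "n - 1"] cell_cong[OF x, of y 0] y
    by (auto simp: jump_def)
qed

lemma jump_sum:
  "(\<Sum>k\<le>n. jump k x y) = piece n (cell n x) y"
  by (induction n) (auto simp: jump_def)

lemma increment_eq_jump: "AE y in M. increment f n y = jump n y y"
proof (cases n)
  case 0
  then show ?thesis using f_eq_piece[of 0] by (simp add: increment_def jump_def)
next
  case (Suc m)
  show ?thesis using f_eq_piece[of n] f_eq_piece[of m]
    by eventually_elim (simp add: increment_def jump_def Suc)
qed

lemma increment_eq_jump_cell:
  assumes x: "x \<in> space M"
  shows "AE y in M. y \<in> cell n x \<longrightarrow> increment f n y = jump n x y"
  using increment_eq_jump[of n]
proof eventually_elim
  case (elim y)
  then show ?case using jump_cong[OF x, of y n] by simp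
qed

lemma jump_norm_le:
  assumes x: "x \<in> space M" shows "c1 * jump_norm n x \<le> L"
  unfolding jump_norm_def
proof (rule sup_norm_AE_le[OF jump_in[OF x] cell_At(1)[OF x]])
  show "AE y in M. y \<in> cell n x \<longrightarrow> \<bar>jump n x y\<bar> \<le> L"
    using increment_eq_jump_cell[OF x, of n] increment_bound[of n] by eventually_elim auto
qed

lemma jump_norm_nonneg: "x \<in> space M \<Longrightarrow> 0 \<le> jump_norm n x"
  unfolding jump_norm_def by (rule sup_norm_nonneg[OF cell_At(1) jump_in])

lemma L_nonneg: "0 \<le> L"
proof -
  obtain x where x: "x \<in> space M" using not_empty by blast
  have "0 \<le> c1 * jump_norm 0 x" using jump_norm_nonneg[OF x] c1_pos by simp
  then show ?thesis using jump_norm_le[OF x, of 0] by linarith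
qed

lemma integrable_increment: "integrable M (increment f n)"
proof (cases n)
  case 0
  then have "increment f n = f 0" by (auto simp: increment_def)
  then show ?thesis using integrable_f by simp
next
  case (Suc m)
  then have "increment f n = (\<lambda>x. f (Suc m) x - f m x)" by (auto simp: increment_def)
  then show ?thesis using integrable_f by simp
qed

lemma measurable_increment [measurable]: "increment f n \<in> borel_measurable M"
  using integrable_increment by auto

lemma integrable_increment_sq: "integrable M (\<lambda>y. (increment f n y)\<^sup>2)"
proof (rule integrable_const_bound[of _ "L\<^sup>2"])
  show "AE x in M. norm ((increment f n x)\<^sup>2) \<le> L\<^sup>2"
    using increment_bound[of n]
  proof eventually_elim
    case (elim x)
    then have "\<bar>increment f n x\<bar>\<^sup>2 \<le> L\<^sup>2" by (intro power_mono) auto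
    then show ?case by simp
  qed
qed measurable

lemma set_integrable_of_integrable: "integrable M \<phi> \<Longrightarrow> A \<in> sets M \<Longrightarrow> set_integrable M A (\<phi> :: 'a \<Rightarrow> real)"
  unfolding set_integrable_def by (rule integrable_mult_indicator)

lemma set_integral_nonneg_real:
  assumes "\<And>y. 0 \<le> \<phi> y" shows "0 \<le> (LINT y:A|M. (\<phi> y :: real))"
  unfolding set_lebesgue_integral_def using assms by (intro Bochner_Integration.integral_nonneg) simp

lemma mean_square_nonneg: "0 \<le> mean_square n k x"
  unfolding mean_square_def by (intro divide_nonneg_nonneg set_integral_nonneg_real) auto

lemma energy_nonneg: "0 \<le> energy k x"
  unfolding energy_def using mean_square_nonneg by auto

lemma mean_square_le_energy: "mean_square k k x \<le> energy k x" "mean_square n (Suc n) x \<le> energy (Suc n) x"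
  unfolding energy_def using mean_square_nonneg by auto

lemma square_var_eq: "x \<in> space M \<Longrightarrow> square_var M F f n x = (\<Sum>k\<le>n. energy k x)"
  unfolding square_var_def energy_def mean_square_def
  using real_cond_exp_cell[OF _ integrable_increment_sq] by (intro sum.cong) auto

lemma jump_norm_sq_integral:
  assumes x: "x \<in> space M"
  shows "c1\<^sup>2 * c2 * (jump_norm n x)\<^sup>2 * measure M (cell n x) \<le> (LINT y:cell n x|M. (increment f n y)\<^sup>2)"
proof -
  have [measurable]: "jump n x \<in> borel_measurable M" using jump_in[OF x] by (rule measurable_S)
  have "(LINT y:cell n x|M. (increment f n y)\<^sup>2) = (LINT y:cell n x|M. (jump n x y)\<^sup>2)"
  proof (rule set_lebesgue_integral_cong_AE)
    show "AE y\<in>cell n x in M. (increment f n y)\<^sup>2 = (jump n x y)\<^sup>2"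
      using increment_eq_jump_cell[OF x, of n] by eventually_elim simp
  qed (use cell_sets[OF x] in measurable)
  then show ?thesis using square_lower[OF jump_in[OF x] cell_At(1)[OF x]] unfolding jump_norm_def by simp
qed

lemma cell_measure_pos: "x \<in> space M \<Longrightarrow> 0 < measure M (cell n x)"
  using At_pos cell_At by blast

lemma jump_norm_sq_le:
  assumes x: "x \<in> space M"
  shows "c1\<^sup>2 * c2 * (jump_norm n x)\<^sup>2 \<le> mean_square n n x"
  using jump_norm_sq_integral[OF x, of n] cell_measure_pos[OF x, of n]
  unfolding mean_square_def by (simp add: pos_le_divide_eq)

lemma loss_bounds:
  assumes x: "x \<in> space M" shows "0 \<le> loss n x" "loss n x \<le> 1"
proof -
  show "0 \<le> loss n x"
  proof (cases n)
    case (Suc m)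
    show ?thesis using sibling(6)[OF x, of m] cell_measure_pos[OF x, of m] by (simp add: loss_def Suc)
  qed (simp add: loss_def)
qed (auto simp: loss_def)

lemma child_cell: "x \<in> space M \<Longrightarrow> child_atom F (cell n x) (cell (Suc n) x)"
  unfolding child_atom_def using cell_At(1) cell_Suc_subset by blast

text \<open>If the cell has at least half of the measure of its parent, orthogonality on the parent moves the
  integral of the squared jump to the sibling, whose measure is \<open>loss\<close> times that of the parent.\<close>
lemma jump_norm_loss_large:
  assumes x: "x \<in> space M" and half: "measure M (cell n x) / 2 \<le> measure M (cell (Suc n) x)"
    and KR: "1 \<le> KR" "sup_norm_on (cell n x) (jump (Suc n) x) \<le> KR * jump_norm (Suc n) x"
  defines "a \<equiv> c1\<^sup>2 * c2"
  shows "jump_norm (Suc n) x \<le> 2 * KR * L / a * loss (Suc n) x"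
    and "(jump_norm (Suc n) x)\<^sup>2 \<le> 4 * KR\<^sup>2 / a\<^sup>2 * loss (Suc n) x * mean_square n (Suc n) x"
proof -
  let ?A = "cell n x" and ?B = "cell (Suc n) x"
  let ?R = "?A - ?B" and ?p = "jump (Suc n) x" and ?d = "increment f (Suc n)" and ?N = "jump_norm (Suc n) x"
  have a: "0 < a" using c1_pos c2_pos by (simp add: a_def)
  have sets: "?A \<in> sets M" "?B \<in> sets M" "?R \<in> sets M" using cell_sets[OF x] by auto
  have p: "?p \<in> S" by (rule jump_in[OF x])
  have pm [measurable]: "?p \<in> borel_measurable M" by (rule measurable_S[OF p])
  have A: "?A \<in> atoms (F n)" by (rule cell_At(1)[OF x])
  have mA: "0 < measure M ?A" by (rule cell_measure_pos[OF x])
  have mR: "measure M ?R = loss (Suc n) x * measure M ?A" "0 < measure M ?R"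
    using sibling(5,6)[OF x, of n] mA by (auto simp: loss_def left_diff_distrib)
  have N0: "0 \<le> ?N" by (rule jump_norm_nonneg[OF x])
  have int_dp: "integrable M (\<lambda>y. ?d y * ?p y)" by (rule integrable_mult_S[OF integrable_increment p])
  have AB: "?A = ?B \<union> ?R" using sibling(3)[OF x, of n] by blast
  define I where "I = (LINT y:?R|M. \<bar>?d y\<bar>)"
  define J where "J = (LINT y:?A|M. (?d y)\<^sup>2)"
  have int_abs: "integrable M (\<lambda>y. \<bar>?d y\<bar>)" using integrable_increment by auto
  have I0: "0 \<le> I" unfolding I_def by (rule set_integral_nonneg_real) simp
  have "0 = (LINT y:?A|M. ?d y * ?p y)" using increment_orthogonal[OF A p] by simp
  also have "\<dots> = (LINT y:?B|M. ?d y * ?p y) + (LINT y:?R|M. ?d y * ?p y)"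
    by (subst AB, rule set_integral_Un) (use int_dp sets in \<open>auto intro: set_integrable_of_integrable\<close>)
  finally have "(LINT y:?B|M. ?d y * ?p y) = - (LINT y:?R|M. ?d y * ?p y)" by simp
  also have "(LINT y:?B|M. ?d y * ?p y) = (LINT y:?B|M. (?d y)\<^sup>2)"
  proof (rule set_lebesgue_integral_cong_AE)
    show "AE y\<in>?B in M. ?d y * ?p y = (?d y)\<^sup>2"
      using increment_eq_jump_cell[OF x, of "Suc n"] by eventually_elim (simp add: power2_eq_square)
  qed (use sets in measurable)
  \<comment> \<open>On the sibling the increment is a different polynomial, so only the continuation
    of \<open>jump\<close> is bounded there, by its sup norm on the parent and the Remez constant
    \<open>KR\<close>. The increment itself stays in the integral \<open>I\<close>.\<close>
  also have "- (LINT y:?R|M. ?d y * ?p y) \<le> KR * ?N * I"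
  proof -
    have "(LINT y:?R|M. - (KR * ?N) * \<bar>?d y\<bar>) \<le> (LINT y:?R|M. ?d y * ?p y)"
    proof (rule set_integral_mono)
      fix y assume "y \<in> ?R"
      then have "\<bar>?p y\<bar> \<le> KR * ?N" using sup_norm_ge[OF A p, of y] KR(2) by fastforce
      then have "\<bar>?d y * ?p y\<bar> \<le> KR * ?N * \<bar>?d y\<bar>" by (simp add: abs_mult mult.commute mult_left_mono)
      then have "- (KR * ?N * \<bar>?d y\<bar>) \<le> ?d y * ?p y" by linarith
      then show "- (KR * ?N) * \<bar>?d y\<bar> \<le> ?d y * ?p y" by simp
    qed (use int_dp int_abs sets in \<open>auto intro!: set_integrable_of_integrable\<close>)
    moreover have "(LINT y:?R|M. - (KR * ?N) * \<bar>?d y\<bar>) = - (KR * ?N) * I"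
      unfolding I_def by (rule set_integral_mult_right)
    ultimately show ?thesis by simp
  qed
  finally have "a * ?N\<^sup>2 * measure M ?B \<le> KR * ?N * I"
    using jump_norm_sq_integral[OF x, of "Suc n"] unfolding a_def by linarith
  then have "?N * (a * measure M ?B * ?N) \<le> ?N * (KR * I)" by (simp add: power2_eq_square mult_ac)
  then have "a * measure M ?B * ?N \<le> KR * I" using N0 KR(1) I0 
    by (cases "?N = 0") (auto simp: mult_le_cancel_left)
  moreover have "a * (measure M ?A / 2) * ?N \<le> a * measure M ?B * ?N"
    using half a N0 by (intro mult_right_mono mult_left_mono) auto
  ultimately have "a * measure M ?A * ?N \<le> 2 * KR * I" by simp
  then have NI: "?N \<le> 2 * KR * I / (a * measure M ?A)"
    using a mA by (simp add: pos_le_divide_eq mult.commute)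
  \<comment> \<open>Two estimates of \<open>I\<close> yield the two claims: the bound
    \<open>L\<close> on increments here, Cauchy-Schwarz below.\<close>
  have "I \<le> (LINT y:?R|M. L)"
    unfolding I_def
  proof (rule set_integral_mono_AE)
    show "AE y\<in>?R in M. \<bar>?d y\<bar> \<le> L" using increment_bound[of "Suc n"] by eventually_elim simp
  qed (use int_abs sets in \<open>auto intro!: set_integrable_of_integrable\<close>)
  also have "\<dots> = measure M ?R * L" using sets by (subst set_integral_const) (auto simp: emeasure_eq_measure)
  finally have IL: "I \<le> L * loss (Suc n) x * measure M ?A" using mR by (simp add: mult_ac)
  have "?N \<le> 2 * KR * (L * loss (Suc n) x * measure M ?A) / (a * measure M ?A)"
    using KR(1) a mA by (intro order_trans[OF NI] divide_right_mono mult_left_mono IL) auto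
  then show "?N \<le> 2 * KR * L / a * loss (Suc n) x" using mA by simp
  \<comment> \<open>Cauchy-Schwarz on the sibling, obtained from the nonnegative integral of the
    squared deviation of the absolute increment from its mean.\<close>
  have "0 \<le> (LINT y:?R|M. (\<bar>?d y\<bar> - I / measure M ?R)\<^sup>2)" by (rule set_integral_nonneg_real) simp
  also have "\<dots> = (LINT y:?R|M. (?d y)\<^sup>2) - 2 * (I / measure M ?R) * I + (I / measure M ?R)\<^sup>2 * measure M ?R"
  proof -
    have "(LINT y:?R|M. (\<bar>?d y\<bar> - I / measure M ?R)\<^sup>2) =
        (LINT y:?R|M. (?d y)\<^sup>2 - 2 * (I / measure M ?R) * \<bar>?d y\<bar> + (I / measure M ?R)\<^sup>2)"
      using sets by (intro set_lebesgue_integral_cong) (auto simp: power2_eq_square algebra_simps)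
    also have "\<dots> = (LINT y:?R|M. (?d y)\<^sup>2) - (LINT y:?R|M. 2 * (I / measure M ?R) * \<bar>?d y\<bar>) + (LINT y:?R|M. (I / measure M ?R)\<^sup>2)"
      using sets integrable_increment_sq int_abs
      by (subst set_integral_add set_integral_diff; (intro set_integral_diff set_integral_add set_integrable_of_integrable)?; simp)+
    also have "(LINT y:?R|M. (I / measure M ?R)\<^sup>2) = (I / measure M ?R)\<^sup>2 * measure M ?R"
      using sets by (subst set_integral_const) (auto simp: emeasure_eq_measure)
    finally show ?thesis unfolding I_def by simp
  qed
  also have "\<dots> = (LINT y:?R|M. (?d y)\<^sup>2) - I\<^sup>2 / measure M ?R"
    using mR(2) by (simp add: field_simps power2_eq_square)
  finally have "I\<^sup>2 \<le> measure M ?R * (LINT y:?R|M. (?d y)\<^sup>2)" using mR(2) by (simp add: field_simps)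
  also have "\<dots> \<le> measure M ?R * J"
  proof (intro mult_left_mono)
    have "J = (LINT y:?B|M. (?d y)\<^sup>2) + (LINT y:?R|M. (?d y)\<^sup>2)"
      unfolding J_def by (subst AB, rule set_integral_Un) (use integrable_increment_sq sets in \<open>auto intro: set_integrable_of_integrable\<close>)
    moreover have "0 \<le> (LINT y:?B|M. (?d y)\<^sup>2)" by (rule set_integral_nonneg_real) simp
    ultimately show "(LINT y:?R|M. (?d y)\<^sup>2) \<le> J" by simp
  qed simp
  finally have IJ: "I\<^sup>2 \<le> measure M ?R * J" .
  have "?N\<^sup>2 \<le> (2 * KR * I / (a * measure M ?A))\<^sup>2" using NI N0 by (intro power_mono)
  also have "\<dots> = 4 * KR\<^sup>2 / (a * measure M ?A)\<^sup>2 * I\<^sup>2" by (simp add: power_mult_distrib power_divide)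
  also have "\<dots> \<le> 4 * KR\<^sup>2 / (a * measure M ?A)\<^sup>2 * (measure M ?R * J)" by (intro mult_left_mono IJ) simp
  also have "\<dots> = 4 * KR\<^sup>2 / a\<^sup>2 * loss (Suc n) x * mean_square n (Suc n) x"
    unfolding mR(1) mean_square_def J_def[symmetric] using mA by (simp add: power2_eq_square)
  finally show "?N\<^sup>2 \<le> 4 * KR\<^sup>2 / a\<^sup>2 * loss (Suc n) x * mean_square n (Suc n) x" .
qed

text \<open>If the loss is at least 1/2 it may be inserted at the cost of a factor 2, and the mean
  square on the cell itself suffices. Otherwise the diameters of cell and parent are comparable, and
  the mean square on the parent is used.\<close>

lemma jump_norm_loss:
  "\<exists>K\<ge>0. \<forall>x\<in>space M. \<forall>k. jump_norm k x \<le> K * loss k x \<and> (jump_norm k x)\<^sup>2 \<le> K * loss k x * energy k x"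
proof -
  obtain KR where KR1: "KR \<ge> 1" and KR2: "\<forall>p\<in>S. \<forall>A B m n. A \<in> atoms (F m) \<longrightarrow> B \<in> atoms (F n) \<longrightarrow> B \<subseteq> A \<longrightarrow>
     diameter A \<le> C * diameter B \<longrightarrow> sup_norm_on A p \<le> KR * sup_norm_on B p"
    using remez_parent by (elim exE conjE)
  note KR = KR1 KR2[rule_format]
  define a where "a = c1\<^sup>2 * c2"
  have a: "0 < a" using c1_pos c2_pos by (simp add: a_def)
  define K where "K = 2 * L / c1 + 2 / a + 2 * KR * L / a + 4 * KR\<^sup>2 / a\<^sup>2"
  have parts: "0 \<le> 2 * L / c1" "0 \<le> 2 / a" "0 \<le> 2 * KR * L / a" "0 \<le> 4 * KR\<^sup>2 / a\<^sup>2"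
    using L_nonneg c1_pos a KR(1) by auto
  then have Kge: "2 * L / c1 \<le> K" "2 / a \<le> K" "2 * KR * L / a \<le> K" "4 * KR\<^sup>2 / a\<^sup>2 \<le> K" "0 \<le> K"
    unfolding K_def by linarith+
  have "jump_norm k x \<le> K * loss k x \<and> (jump_norm k x)\<^sup>2 \<le> K * loss k x * energy k x" if x: "x \<in> space M" for x k
  proof -
    have l0: "0 \<le> loss k x" and e0: "0 \<le> energy k x" using loss_bounds[OF x] energy_nonneg by auto
    have big: ?thesis if half: "1 \<le> 2 * loss k x"
    proof
      have "jump_norm k x \<le> (L / c1) * 1" using jump_norm_le[OF x, of k] c1_pos by (simp add: pos_le_divide_eq mult.commute)
      also have "\<dots> \<le> (L / c1) * (2 * loss k x)" using half L_nonneg c1_pos by (intro mult_left_mono) auto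
      also have "\<dots> \<le> K * loss k x" using mult_right_mono[OF Kge(1) l0] by (simp add: mult_ac)
      finally show "jump_norm k x \<le> K * loss k x" .
      have "a * (jump_norm k x)\<^sup>2 \<le> energy k x"
        using jump_norm_sq_le[OF x, of k] mean_square_le_energy(1)[of k x] unfolding a_def by linarith
      then have "(jump_norm k x)\<^sup>2 \<le> energy k x / a * 1" using a by (simp add: pos_le_divide_eq mult.commute)
      also have "\<dots> \<le> energy k x / a * (2 * loss k x)" using half e0 a by (intro mult_left_mono) auto
      also have "\<dots> = 2 / a * (loss k x * energy k x)" by simp
      also have "\<dots> \<le> K * (loss k x * energy k x)" using Kge(2) l0 e0 by (intro mult_right_mono) auto
      finally show "(jump_norm k x)\<^sup>2 \<le> K * loss k x * energy k x" by (simp add: mult.assoc)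
    qed
    show ?thesis
    proof (cases k)
      case 0
      then show ?thesis using big by (simp add: loss_def)
    next
      case (Suc n)
      let ?A = "cell n x" and ?B = "cell (Suc n) x"
      have mA: "0 < measure M ?A" by (rule cell_measure_pos[OF x])
      show ?thesis
      proof (cases "measure M ?A / 2 \<le> measure M ?B")
        case False
        then have "measure M ?B / measure M ?A \<le> 1 / 2" using mA by (simp add: pos_divide_le_eq)
        moreover have "t \<le> 1 / 2 \<Longrightarrow> 1 \<le> 2 * (1 - t)" for t :: real by simp
        ultimately have "1 \<le> 2 * (1 - measure M ?B / measure M ?A)" by blast
        then have "1 \<le> 2 * loss k x" by (simp add: loss_def Suc)
        then show ?thesis by (rule big)
      next
        case True
        have "diameter ?A \<le> C * diameter ?B"
          by (rule diameter_le_of_half[OF chain_bound child_cell[OF x] mA True sibling(6)[OF x]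
                atom_diameter_pos[OF cell_At(1)[OF x]]])
        then have sup: "sup_norm_on ?A (jump (Suc n) x) \<le> KR * jump_norm (Suc n) x"
          unfolding jump_norm_def
          by (rule KR(2)[OF jump_in[OF x] cell_At(1)[OF x] cell_At(1)[OF x] cell_Suc_subset[OF x]])
        note large = jump_norm_loss_large[OF x True KR(1) sup, folded a_def]
        have "jump_norm k x \<le> K * loss k x"
          unfolding Suc using large(1) mult_right_mono[OF Kge(3) l0] unfolding Suc by linarith
        moreover have "(jump_norm k x)\<^sup>2 \<le> K * loss k x * energy k x"
        proof -
          have "(jump_norm k x)\<^sup>2 \<le> 4 * KR\<^sup>2 / a\<^sup>2 * (loss k x * mean_square n k x)"
            using large(2) unfolding Suc by (simp only: mult.assoc)
          also have "\<dots> \<le> K * (loss k x * energy k x)"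
            using Kge(4,5) l0 mean_square_le_energy(2)[of n x] mean_square_nonneg unfolding Suc
            by (intro mult_mono mult_left_mono mult_nonneg_nonneg) auto
          finally show ?thesis by (simp only: mult.assoc)
        qed
        ultimately show ?thesis by blast
      qed
    qed
  qed
  then show ?thesis using Kge(5) by blast
qed

lemma cell_diameter_pos: "x \<in> space M \<Longrightarrow> 0 < diameter (cell n x)"
  using atom_diameter_pos[OF cell_At(1)] .

lemma cell_diameter_Suc: "x \<in> space M \<Longrightarrow> diameter (cell (Suc n) x) \<le> diameter (cell n x)"
  by (intro diameter_subset cell_Suc_subset atom_bounded[OF cell_At(1)])

lemma chain_weight_cells:
  assumes "k \<le> n"
  shows "chain_weight M (cell k x) (map (\<lambda>i. cell i x) [Suc k..<Suc n]) = (\<Sum>l\<in>{k<..n}. loss l x / diameter (cell l x))"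
  using assms
proof (induction n rule: dec_induct)
  case base
  then show ?case by simp
next
  case (step n)
  have last: "last (cell k x # map (\<lambda>i. cell i x) [Suc k..<Suc n]) = cell n x"
    using step(1) by (cases "k = n") auto
  have "[Suc k..<Suc (Suc n)] = [Suc k..<Suc n] @ [Suc n]" using step(1) by simp
  then have "chain_weight M (cell k x) (map (\<lambda>i. cell i x) [Suc k..<Suc (Suc n)]) =
    chain_weight M (cell k x) (map (\<lambda>i. cell i x) [Suc k..<Suc n]) + loss (Suc n) x / diameter (cell (Suc n) x)"
    by (simp only: map_append chain_weight_append last) (simp add: loss_def)
  moreover have "{k<..Suc n} = insert (Suc n) {k<..n}" using step(1) by auto
  ultimately show ?case using step(3) by simp
qed

lemma measure_cell_strict: "x \<in> space M \<Longrightarrow> i < j \<Longrightarrow> measure M (cell j x) < measure M (cell i x)"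
  using lift_Suc_mono_less[of "\<lambda>i. - measure M (cell i x)" i j] sibling(6)[of x] by simp

text \<open>The cells of \<open>x\<close> between two levels form a full chain, and its
  \<open>chain_weight\<close> is the sum of losses over diameters.\<close>

lemma loss_weight_bound:
  assumes x: "x \<in> space M" and kn: "k \<le> n"
  shows "diameter (cell n x) * (1 / diameter (cell k x) + (\<Sum>l\<in>{k<..n}. loss l x / diameter (cell l x))) \<le> 2 * C"
proof -
  let ?Cs = "map (\<lambda>i. cell i x) [k..<Suc n]"
  have Cs: "?Cs = cell k x # map (\<lambda>i. cell i x) [Suc k..<Suc n]"
    using kn by (simp add: upt_conv_Cons del: upt_Suc)
  have "full_chain F ?Cs"
    unfolding full_chain_def
  proof (intro conjI)
    show "?Cs \<noteq> []" using kn by simp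
    show "set ?Cs \<subseteq> all_atoms F" using atom_all[OF cell_At(1)[OF x]] by auto
    show "successively (child_atom F) ?Cs"
      unfolding successively_conv_nth using child_cell[OF x] by (auto simp del: upt_Suc)
  qed
  moreover have "shrinking M ?Cs"
    unfolding shrinking_def
  proof (intro conjI ballI)
    show "sorted_wrt (\<lambda>A B. B \<subseteq> A \<and> measure M B < measure M A) ?Cs"
      unfolding sorted_wrt_iff_nth_less
      using cell_antimono[OF x] measure_cell_strict[OF x] by (auto simp del: upt_Suc)
    fix A assume "A \<in> set ?Cs"
    then obtain i where "A = cell i x" by auto
    then show "bounded A" "0 < diameter A" "0 < measure M A"
      using atom_bounded[OF cell_At(1)[OF x]] cell_diameter_pos[OF x] cell_measure_pos[OF x] by auto
  qed
  ultimately have "diameter (last ?Cs) * (1 / diameter (cell k x) + chain_weight M (cell k x) (map (\<lambda>i. cell i x) [Suc k..<Suc n])) \<le> 2 * C"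
    unfolding Cs by (rule chain_weight_bound[OF chain_bound])
  moreover have "last ?Cs = cell n x" using kn by simp
  ultimately show ?thesis unfolding chain_weight_cells[OF kn] by simp
qed

end

context smartingale_tree
begin

lemma piece_oscillation:
  "\<exists>K\<ge>0. \<forall>x\<in>space M. \<forall>n. \<forall>y\<in>cell n x. \<bar>piece n (cell n x) y - piece n (cell n x) x\<bar> \<le>
     K * (\<Sum>k\<le>n. jump_norm k x * (diameter (cell n x) / diameter (cell k x)))"
proof -
  obtain K where K1: "K \<ge> 1" and K2: "\<forall>p\<in>S. \<forall>A B m n. A \<in> atoms (F m) \<longrightarrow> B \<in> atoms (F n) \<longrightarrow> B \<subseteq> A \<longrightarrow>
     (\<forall>y\<in>B. \<forall>z\<in>B. \<bar>p y - p z\<bar> \<le> K * sup_norm_on A p * (diameter B / diameter A))"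
    using markov_sub by (elim exE conjE)
  have "\<bar>piece n (cell n x) y - piece n (cell n x) x\<bar> \<le>
     K * (\<Sum>k\<le>n. jump_norm k x * (diameter (cell n x) / diameter (cell k x)))"
    if x: "x \<in> space M" and y: "y \<in> cell n x" for x n y
  proof -
    have "\<bar>jump k x y - jump k x x\<bar> \<le> K * jump_norm k x * (diameter (cell n x) / diameter (cell k x))" if "k \<le> n" for k
      unfolding jump_norm_def
      by (rule K2[rule_format, OF jump_in[OF x] cell_At(1)[OF x] cell_At(1)[OF x] cell_antimono[OF x that] y cell_At(2)[OF x]])
    then have "(\<Sum>k\<le>n. \<bar>jump k x y - jump k x x\<bar>) \<le>
        (\<Sum>k\<le>n. K * jump_norm k x * (diameter (cell n x) / diameter (cell k x)))"
      by (intro sum_mono) auto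
    also have "\<dots> = K * (\<Sum>k\<le>n. jump_norm k x * (diameter (cell n x) / diameter (cell k x)))"
      by (simp add: sum_distrib_left mult.assoc)
    finally have "(\<Sum>k\<le>n. \<bar>jump k x y - jump k x x\<bar>) \<le> \<dots>" .
    moreover have "piece n (cell n x) y - piece n (cell n x) x = (\<Sum>k\<le>n. jump k x y - jump k x x)"
      by (simp only: jump_sum[symmetric] sum_subtractf)
    ultimately show ?thesis by (simp only:) (rule order_trans[OF sum_abs])
  qed
  then show ?thesis using K1 by (intro exI[of _ K]) auto
qed

section \<open>The martingale of averages with respect to the weight g\<close>

definition nu :: "'a measure" where
  "nu = density M (\<lambda>x. ennreal (g x))"

definition wt :: "'a set \<Rightarrow> real" where
  "wt A = (LINT x:A|M. g x)"

definition avg :: "('a \<Rightarrow> real) \<Rightarrow> 'a set \<Rightarrow> real" where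
  "avg \<phi> A = (LINT x:A|M. \<phi> x * g x) / wt A"

lemma space_nu [simp]: "space nu = space M" and sets_nu [simp]: "sets nu = sets M"
  by (simp_all add: nu_def)

lemma integrable_g: "integrable M g"
  by (rule integrable_S[OF g_in])

lemma set_integrable_g: "integrable M \<phi> \<Longrightarrow> A \<in> sets M \<Longrightarrow> set_integrable M A (\<lambda>x. \<phi> x * g x)"
  by (intro set_integrable_of_integrable integrable_mult_S g_in)

lemma emeasure_nu: "A \<in> sets M \<Longrightarrow> emeasure nu A = ennreal (wt A)"
proof -
  assume A: "A \<in> sets M"
  have [measurable]: "g \<in> borel_measurable M" by (rule measurable_S[OF g_in])
  have "emeasure nu A = (\<integral>\<^sup>+x. ennreal (indicator A x *\<^sub>R g x) \<partial>M)"
    unfolding nu_def using A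
    by (subst emeasure_density) (auto intro!: nn_integral_cong simp: indicator_def)
  also have "\<dots> = ennreal (\<integral>x. indicator A x *\<^sub>R g x \<partial>M)"
  proof (rule nn_integral_eq_integral)
    show "integrable M (\<lambda>x. indicator A x *\<^sub>R g x)" by (rule integrable_mult_indicator[OF A integrable_g])
    show "AE x in M. 0 \<le> indicator A x *\<^sub>R g x"
    proof (rule AE_I2)
      fix x assume "x \<in> space M"
      then have "0 \<le> g x" using g_bounds c3_pos by force
      then show "0 \<le> indicator A x *\<^sub>R g x" by simp
    qed
  qed
  finally show ?thesis by (simp add: wt_def set_lebesgue_integral_def)
qed

lemma wt_bounds:
  assumes A: "A \<in> sets M" shows "c3 * measure M A \<le> wt A" "wt A \<le> measure M A" "0 \<le> wt A"
proof -
  have sub: "A \<subseteq> space M" using sets.sets_into_space[OF A] .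
  have gi: "set_integrable M A g" by (rule set_integrable_of_integrable[OF integrable_g A])
  have ci: "set_integrable M A (\<lambda>x. c)" for c :: real by (rule set_integrable_of_integrable[OF _ A]) simp
  have cm: "(LINT x:A|M. c) = c * measure M A" for c :: real
    using A by (subst set_integral_const) (auto simp: emeasure_eq_measure)
  have "(LINT x:A|M. c3) \<le> wt A" unfolding wt_def
    by (rule set_integral_mono[OF ci gi]) (use g_bounds sub in blast)
  then show 1: "c3 * measure M A \<le> wt A" by (simp add: cm)
  have "wt A \<le> (LINT x:A|M. 1)" unfolding wt_def
    by (rule set_integral_mono[OF gi ci]) (use g_bounds sub in blast)
  then show "wt A \<le> measure M A" by (simp add: cm)
  show "0 \<le> wt A" by (rule order_trans[OF mult_nonneg_nonneg[OF less_imp_le[OF c3_pos] measure_nonneg] 1])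
qed

lemma measure_nu: "A \<in> sets M \<Longrightarrow> measure nu A = wt A"
  using emeasure_nu[of A] wt_bounds(3)[of A] by (simp add: measure_def)

lemma wt_pos:
  assumes "A \<in> atoms (F n)" shows "0 < wt A"
  by (rule less_le_trans[OF mult_pos_pos[OF c3_pos At_pos[OF assms]] wt_bounds(1)[OF At_sets[OF assms]]])

text \<open>The functions \<open>cell\<close> and \<open>children\<close> depend on the atoms alone,
  so they are the same for both measures.\<close>

sublocale nu: cell_tree nu "\<lambda>n. atoms (F n)"
proof (intro cell_tree.intro finite_measureI cell_tree_axioms.intro)
  show "emeasure nu (space nu) \<noteq> \<infinity>" by (simp add: emeasure_nu)
  show "0 < measure nu A" if "A \<in> atoms (F n)" for A n
    using wt_pos[OF that] measure_nu[OF At_sets[OF that]] by simp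
  show "A \<inter> B = {}" if "A \<in> atoms (F n)" "B \<in> atoms (F n)" "A \<noteq> B" for A B n
    using that by (rule At_disjoint)
  show "\<exists>A\<in>atoms (F n). B \<subseteq> A" if "B \<in> atoms (F (Suc n))" for B n using that by (rule At_refine)
qed (simp_all add: finite_At At_sets At_0 At_cover)

lemma avg_near:
  assumes A: "A \<in> atoms (F n)" and int: "integrable M \<phi>"
    and ae: "AE x in M. x \<in> A \<longrightarrow> \<bar>\<phi> x - c\<bar> \<le> O'"
  shows "\<bar>avg \<phi> A - c\<bar> \<le> O'"
proof -
  have AM: "A \<in> sets M" by (rule At_sets[OF A])
  have w: "0 < wt A" by (rule wt_pos[OF A])
  have gi: "set_integrable M A (\<lambda>x. d * g x)" for d
    using set_integrable_of_integrable[OF integrable_g AM] by (rule set_integrable_mult_right)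
  have fi: "set_integrable M A (\<lambda>x. \<phi> x * g x)" by (rule set_integrable_g[OF int AM])
  have cm: "(LINT x:A|M. d * g x) = d * wt A" for d
    unfolding wt_def by (rule set_integral_mult_right)
  have g0: "0 \<le> g x" if "x \<in> A" for x
    using g_bounds[of x] c3_pos At_subset_space[OF A] that by force
  have "(LINT x:A|M. \<phi> x * g x) \<le> (LINT x:A|M. (c + O') * g x)"
  proof (rule set_integral_mono_AE[OF fi gi])
    show "AE x\<in>A in M. \<phi> x * g x \<le> (c + O') * g x"
      using ae by eventually_elim (auto intro!: mult_right_mono g0)
  qed
  moreover have "(LINT x:A|M. (c - O') * g x) \<le> (LINT x:A|M. \<phi> x * g x)"
  proof (rule set_integral_mono_AE[OF gi fi])
    show "AE x\<in>A in M. (c - O') * g x \<le> \<phi> x * g x"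
      using ae by eventually_elim (auto intro!: mult_right_mono g0)
  qed
  ultimately have "avg \<phi> A \<le> c + O'" "c - O' \<le> avg \<phi> A"
    unfolding cm avg_def using w by (simp_all add: pos_divide_le_eq pos_le_divide_eq)
  then show ?thesis by linarith
qed

lemma avg_Suc:
  assumes A: "A \<in> sets M"
  shows "avg (f (Suc n)) A = avg (f n) A + avg (increment f (Suc n)) A"
proof -
  have "(LINT x:A|M. f (Suc n) x * g x) = (LINT x:A|M. f n x * g x + increment f (Suc n) x * g x)"
    using A by (intro set_lebesgue_integral_cong) (auto simp: increment_def algebra_simps)
  also have "\<dots> = (LINT x:A|M. f n x * g x) + (LINT x:A|M. increment f (Suc n) x * g x)"
    by (intro set_integral_add set_integrable_g integrable_f integrable_increment A)
  finally show ?thesis unfolding avg_def by (simp add: add_divide_distrib)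
qed

lemma avg_increment_parent: "A \<in> atoms (F n) \<Longrightarrow> avg (increment f (Suc n)) A = 0"
  unfolding avg_def using increment_orthogonal[OF _ g_in] by simp

lemma avg_increment_le:
  assumes x: "x \<in> space M"
  shows "\<bar>avg (increment f n) (cell n x)\<bar> \<le> jump_norm n x"
proof -
  have "AE y in M. y \<in> cell n x \<longrightarrow> \<bar>increment f n y - 0\<bar> \<le> jump_norm n x"
    using increment_eq_jump_cell[OF x, of n]
  proof eventually_elim
    case (elim y)
    then show ?case unfolding jump_norm_def using sup_norm_ge[OF cell_At(1)[OF x] jump_in[OF x]] by simp
  qed
  from avg_near[OF cell_At(1)[OF x] integrable_increment this] show ?thesis by simp
qed

lemma wt_avg: "A \<in> atoms (F n) \<Longrightarrow> wt A * avg \<phi> A = (LINT x:A|M. \<phi> x * g x)"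
  using wt_pos[of A n] by (simp add: avg_def)

lemma wt_avg_split:
  assumes x: "x \<in> space M" and int: "integrable M \<phi>"
  shows "wt (cell n x) * avg \<phi> (cell n x) =
    wt (cell (Suc n) x) * avg \<phi> (cell (Suc n) x) + wt (cell n x - cell (Suc n) x) * avg \<phi> (cell n x - cell (Suc n) x)"
proof -
  let ?A = "cell n x" and ?B = "cell (Suc n) x"
  have AB: "?A = ?B \<union> (?A - ?B)" using sibling(3)[OF x, of n] by blast
  have "(LINT x:?A|M. \<phi> x * g x) = (LINT x:?B|M. \<phi> x * g x) + (LINT x:?A - ?B|M. \<phi> x * g x)"
    by (subst AB, rule set_integral_Un)
      (use cell_sets[OF x] int in \<open>auto intro!: set_integrable_g\<close>)
  then show ?thesis using wt_avg[OF cell_At(1)[OF x]] wt_avg[OF sibling(1)[OF x]] by simp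
qed

lemma wt_split:
  assumes x: "x \<in> space M"
  shows "wt (cell n x) = wt (cell (Suc n) x) + wt (cell n x - cell (Suc n) x)"
proof -
  let ?A = "cell n x" and ?B = "cell (Suc n) x"
  have AB: "?A = ?B \<union> (?A - ?B)" using sibling(3)[OF x, of n] by blast
  show ?thesis unfolding wt_def
    by (subst AB, rule set_integral_Un)
      (use cell_sets[OF x] integrable_g in \<open>auto intro!: set_integrable_of_integrable\<close>)
qed

lemma avg_f_near:
  assumes x: "x \<in> space M" and osc: "\<And>y. y \<in> cell n x \<Longrightarrow> \<bar>piece n (cell n x) y - piece n (cell n x) x\<bar> \<le> O'"
    and B: "B \<in> atoms (F m)" "B \<subseteq> cell n x"
  shows "\<bar>avg (f n) B - piece n (cell n x) x\<bar> \<le> O'"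
proof (rule avg_near[OF B(1) integrable_f])
  show "AE y in M. y \<in> B \<longrightarrow> \<bar>f n y - piece n (cell n x) x\<bar> \<le> O'"
    using f_eq_piece[of n]
  proof eventually_elim
    case (elim y)
    show ?case
    proof
      assume "y \<in> B"
      then have y: "y \<in> cell n x" using B by blast
      then show "\<bar>f n y - piece n (cell n x) x\<bar> \<le> O'" using osc[OF y] elim cell_cong[OF x y] by simp
    qed
  qed
qed

text \<open>The average of \<open>f (Suc n)\<close> over the child is that of \<open>f n\<close>
  plus that of the increment. The first is compared with the parent average through the value of the
  piece at \<open>x\<close>, the second is at most the sup norm of the jump.\<close>

lemma avg_diff_bound:
  assumes x: "x \<in> space M" and osc: "\<And>y. y \<in> cell n x \<Longrightarrow> \<bar>piece n (cell n x) y - piece n (cell n x) x\<bar> \<le> O'"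
  defines "A \<equiv> cell n x" and "B \<equiv> cell (Suc n) x"
  shows "\<bar>avg (f (Suc n)) B - avg (f n) A\<bar> \<le> L / c1 + 2 * O'"
proof -
  have 1: "\<bar>avg (f n) B - piece n A x\<bar> \<le> O'"
    unfolding A_def B_def by (rule avg_f_near[OF x osc cell_At(1)[OF x] cell_Suc_subset[OF x]])
  have 2: "\<bar>avg (f n) A - piece n A x\<bar> \<le> O'"
    unfolding A_def by (rule avg_f_near[OF x osc cell_At(1)[OF x] order_refl])
  have "\<bar>avg (increment f (Suc n)) B\<bar> \<le> jump_norm (Suc n) x"
    unfolding B_def by (rule avg_increment_le[OF x])
  also have "\<dots> \<le> L / c1" using jump_norm_le[OF x, of "Suc n"] c1_pos by (simp add: pos_le_divide_eq mult.commute)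
  finally show ?thesis using 1 2 avg_Suc[OF cell_sets[OF x], of n "Suc n"] unfolding B_def by linarith
qed

text \<open>With two children of weights \<open>pB\<close> and \<open>pR\<close>, a step is the
  average of the new increment over the child plus the deviation of the child average of
  \<open>f n\<close> from that of the parent. The first parts have mean square bounded by
  \<open>energy\<close>. The second have variance \<open>pB * pR * (bB - bR)\<^sup>2\<close>, where
  \<open>pR\<close> is at most \<open>loss / c3\<close> and the difference at most
  \<open>2 * O'\<close>.\<close>

lemma step_variance_bound:
  assumes x: "x \<in> space M" and osc: "\<And>y. y \<in> cell n x \<Longrightarrow> \<bar>piece n (cell n x) y - piece n (cell n x) x\<bar> \<le> O'"
  defines "A \<equiv> cell n x"
  shows "(\<Sum>B\<in>children n A. measure nu B * (avg (f (Suc n)) B - avg (f n) A)\<^sup>2) / measure nu A \<le>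
    2 / (c1\<^sup>2 * c2 * c3) * energy (Suc n) x + 8 / c3 * (loss (Suc n) x * O'\<^sup>2)"
proof -
  define B where "B = cell (Suc n) x"
  define R where "R = A - B"
  define a where "a = c1\<^sup>2 * c2"
  have a: "0 < a" using c1_pos c2_pos by (simp add: a_def)
  have At: "A \<in> atoms (F n)" "B \<in> atoms (F (Suc n))" "R \<in> atoms (F (Suc n))"
    unfolding A_def B_def R_def using cell_At(1)[OF x] sibling(1)[OF x] by auto
  note sets = At(1)[THEN At_sets] At(2)[THEN At_sets] At(3)[THEN At_sets]
  have sub: "B \<subseteq> A" "R \<subseteq> A" using sibling(3)[OF x, of n] by (auto simp: A_def B_def R_def)
  have ch: "children n A = {B, R}" "B \<noteq> R"
    using sibling(2,4)[OF x, of n] by (auto simp: A_def B_def R_def)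
  have mpos: "0 < measure M A" "0 < measure M B" "0 < measure M R" using At_pos At by auto
  have wpos: "0 < wt A" "0 < wt B" "0 < wt R" using wt_pos At by auto
  define bB bR eB eR where "bB = avg (f n) B" and "bR = avg (f n) R"
    and "eB = avg (increment f (Suc n)) B" and "eR = avg (increment f (Suc n)) R"
  define pB pR where "pB = wt B / wt A" and "pR = wt R / wt A"
  have p: "pB + pR = 1" "0 \<le> pB" "0 \<le> pR"
    using wt_split[OF x, of n] wpos unfolding pB_def pR_def A_def[symmetric] B_def[symmetric] R_def[symmetric]
    by (auto simp: add_divide_distrib[symmetric])
  then have p1: "pB \<le> 1" by simp
  have mA: "avg (f n) A = pB * bB + pR * bR"
    using wt_avg_split[OF x integrable_f, of n n] wpos
    unfolding pB_def pR_def bB_def bR_def A_def[symmetric] B_def[symmetric] R_def[symmetric]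
    by (simp add: field_simps)
  have mB: "avg (f (Suc n)) B = bB + eB" "avg (f (Suc n)) R = bR + eR"
    unfolding bB_def bR_def eB_def eR_def by (intro avg_Suc sets)+
  have pBe: "pB = 1 - pR" using p by simp
  have dB: "avg (f (Suc n)) B - avg (f n) A = eB + pR * (bB - bR)"
    unfolding mB mA pBe by (simp add: algebra_simps)
  have dR: "avg (f (Suc n)) R - avg (f n) A = eR + (- pB) * (bB - bR)"
    unfolding mB mA pBe by (simp add: algebra_simps)
  have sq: "(u + v)\<^sup>2 \<le> 2 * u\<^sup>2 + 2 * v\<^sup>2" for u v :: real
    using zero_le_power2[of "u - v"] by (simp add: power2_eq_square algebra_simps)
  \<comment> \<open>The average is bounded by the sup norm, hence by the mean square on the child
    through the norming condition. Passing from weights of \<open>nu\<close> to measures costs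
    \<open>c3\<close>.\<close>
  have weight: "wt T / wt A * (avg (increment f (Suc n)) T)\<^sup>2 \<le> (LINT y:T|M. (increment f (Suc n) y)\<^sup>2) / (a * c3 * measure M A)"
    if T: "T \<in> atoms (F (Suc n))" for T
  proof -
    obtain y where y: "y \<in> T" using atom_nonempty[OF T] by blast
    have yM: "y \<in> space M" using y At_subset_space[OF T] by blast
    have cy: "cell (Suc n) y = T" by (rule cell_eq[OF T y])
    have mT: "0 < measure M T" by (rule At_pos[OF T])
    define J where "J = (LINT y:T|M. (increment f (Suc n) y)\<^sup>2)"
    have "(avg (increment f (Suc n)) T)\<^sup>2 = \<bar>avg (increment f (Suc n)) T\<bar>\<^sup>2" by simp
    also have "\<dots> \<le> (jump_norm (Suc n) y)\<^sup>2"
      using avg_increment_le[OF yM, of "Suc n"] unfolding cy by (intro power_mono) auto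
    also have "\<dots> \<le> J / (a * measure M T)"
      using jump_norm_sq_integral[OF yM, of "Suc n"] a mT unfolding cy a_def[symmetric] J_def
      by (simp add: pos_le_divide_eq mult_ac)
    finally have 1: "(avg (increment f (Suc n)) T)\<^sup>2 \<le> J / (a * measure M T)" .
    have J0: "0 \<le> J" unfolding J_def by (rule set_integral_nonneg_real) simp
    have 2: "wt T / wt A \<le> measure M T / (c3 * measure M A)"
      using wt_bounds[OF At_sets[OF T]] wt_bounds(1)[OF sets(1)] c3_pos mpos
      by (intro frac_le) auto
    have "wt T / wt A * (avg (increment f (Suc n)) T)\<^sup>2 \<le> measure M T / (c3 * measure M A) * (J / (a * measure M T))"
      using 1 2 c3_pos mpos mT by (intro mult_mono) auto
    also have "\<dots> = J / (a * c3 * measure M A)" using mT by simp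
    finally show ?thesis unfolding J_def .
  qed
  have energy: "pB * eB\<^sup>2 + pR * eR\<^sup>2 \<le> energy (Suc n) x / (a * c3)"
  proof -
    have AB: "A = B \<union> R" using sub by (auto simp: R_def)
    have "(LINT y:A|M. (increment f (Suc n) y)\<^sup>2) =
      (LINT y:B|M. (increment f (Suc n) y)\<^sup>2) + (LINT y:R|M. (increment f (Suc n) y)\<^sup>2)"
      by (subst AB, rule set_integral_Un)
        (use sets integrable_increment_sq in \<open>auto intro!: set_integrable_of_integrable simp: R_def\<close>)
    then have "pB * eB\<^sup>2 + pR * eR\<^sup>2 \<le> (LINT y:A|M. (increment f (Suc n) y)\<^sup>2) / (a * c3 * measure M A)"
      using weight[OF At(2)] weight[OF At(3)] unfolding pB_def pR_def eB_def eR_def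
      by (simp add: add_divide_distrib)
    also have "\<dots> = mean_square n (Suc n) x / (a * c3)"
      unfolding mean_square_def A_def by (simp add: mult.commute)
    also have "\<dots> \<le> energy (Suc n) x / (a * c3)"
      using mean_square_le_energy(2) a c3_pos by (intro divide_right_mono) auto
    finally show ?thesis .
  qed
  have diff: "pB * pR * (bB - bR)\<^sup>2 \<le> 4 / c3 * (loss (Suc n) x * O'\<^sup>2)"
  proof -
    have "\<bar>bB - piece n A x\<bar> \<le> O'" "\<bar>bR - piece n A x\<bar> \<le> O'"
      unfolding bB_def bR_def A_def
      using avg_f_near[OF x osc At(2)] avg_f_near[OF x osc At(3)] sub unfolding A_def by auto
    then have "\<bar>bB - bR\<bar> \<le> 2 * O'" by linarith
    then have "\<bar>bB - bR\<bar>\<^sup>2 \<le> (2 * O')\<^sup>2" by (intro power_mono) auto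
    then have 1: "(bB - bR)\<^sup>2 \<le> 4 * O'\<^sup>2" by (simp add: power_mult_distrib)
    have "pR \<le> measure M R / (c3 * measure M A)"
      unfolding pR_def using wt_bounds[OF sets(3)] wt_bounds(1)[OF sets(1)] c3_pos mpos
      by (intro frac_le) auto
    also have "measure M R = loss (Suc n) x * measure M A"
      using sibling(5)[OF x, of n] mpos unfolding R_def A_def[symmetric] B_def[symmetric]
      by (simp add: loss_def left_diff_distrib A_def[symmetric] B_def[symmetric])
    finally have 2: "pR \<le> loss (Suc n) x / c3" using mpos by simp
    have "pB * pR * (bB - bR)\<^sup>2 \<le> 1 * (loss (Suc n) x / c3) * (4 * O'\<^sup>2)"
      using p p1 1 2 loss_bounds[OF x, of "Suc n"] c3_pos by (intro mult_mono mult_nonneg_nonneg) auto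
    then show ?thesis by (simp add: mult_ac)
  qed
  have "(\<Sum>B\<in>children n A. measure nu B * (avg (f (Suc n)) B - avg (f n) A)\<^sup>2) / measure nu A =
      pB * (eB + pR * (bB - bR))\<^sup>2 + pR * (eR + (- pB) * (bB - bR))\<^sup>2"
    unfolding ch(1) dB[symmetric] dR[symmetric] using ch(2)
    by (simp add: measure_nu[OF sets(1)] measure_nu[OF sets(2)] measure_nu[OF sets(3)] pB_def pR_def add_divide_distrib)
  also have "\<dots> \<le> pB * (2 * eB\<^sup>2 + 2 * (pR * (bB - bR))\<^sup>2) + pR * (2 * eR\<^sup>2 + 2 * ((- pB) * (bB - bR))\<^sup>2)"
    using p by (intro add_mono mult_left_mono sq) auto
  also have "\<dots> = 2 * (pB * eB\<^sup>2 + pR * eR\<^sup>2) + 2 * (pB + pR) * (pB * pR * (bB - bR)\<^sup>2)"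
    by (simp add: power_mult_distrib algebra_simps power2_eq_square)
  also have "\<dots> = 2 * (pB * eB\<^sup>2 + pR * eR\<^sup>2) + 2 * (pB * pR * (bB - bR)\<^sup>2)" using p(1) by simp
  also have "\<dots> \<le> 2 * (energy (Suc n) x / (a * c3)) + 2 * (4 / c3 * (loss (Suc n) x * O'\<^sup>2))"
    using energy diff by (intro add_mono mult_left_mono) auto
  also have "\<dots> = 2 / (c1\<^sup>2 * c2 * c3) * energy (Suc n) x + 8 / c3 * (loss (Suc n) x * O'\<^sup>2)"
    by (simp add: a_def)
  finally show ?thesis .
qed

lemma martingale_f:
  assumes A: "A \<in> atoms (F n)"
  shows "(\<Sum>B\<in>children n A. measure nu B * avg (f (Suc n)) B) = measure nu A * avg (f n) A"
proof -
  obtain x where x: "x \<in> A" using atom_nonempty[OF A] by blast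
  then have xM: "x \<in> space M" using At_subset_space[OF A] by blast
  have cA: "cell n x = A" by (rule cell_eq[OF A x])
  note sib = sibling[OF xM, of n, unfolded cA]
  have "(\<Sum>B\<in>children n A. measure nu B * avg (f (Suc n)) B) = wt A * avg (f (Suc n)) A"
    unfolding sib(2) using sib(4) wt_avg_split[OF xM integrable_f, of n "Suc n"] unfolding cA
    by (simp add: measure_nu[OF cell_sets[OF xM]] measure_nu[OF At_sets[OF sib(1)]])
  also have "avg (f (Suc n)) A = avg (f n) A"
    using avg_Suc[OF At_sets[OF A]] avg_increment_parent[OF A] by simp
  finally show ?thesis using measure_nu[OF At_sets[OF A]] by simp
qed

text \<open>The law for trees is applied with \<open>V\<close> a multiple of
  \<open>square_var\<close>; replacing the averages by \<open>f n\<close> costs the bounded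
  oscillation \<open>O'\<close>.\<close>

theorem smartingale_iterated_log_bound:
  "\<exists>K\<ge>1. \<exists>O'. AE x in M. filterlim (\<lambda>n. square_var M F f n x) at_top sequentially \<longrightarrow>
     eventually (\<lambda>n. f n x \<le> 5 * sqrt (K * square_var M F f n x * ln (ln (K * square_var M F f n x))) + O') sequentially"
proof -
  obtain K0 where K0: "K0 \<ge> 0" and osc0: "\<forall>x\<in>space M. \<forall>n. \<forall>y\<in>cell n x. \<bar>piece n (cell n x) y - piece n (cell n x) x\<bar> \<le>
     K0 * (\<Sum>k\<le>n. jump_norm k x * (diameter (cell n x) / diameter (cell k x)))"
    using piece_oscillation by (elim exE conjE)
  obtain K1 where K1: "K1 \<ge> 0" and N1: "\<forall>x\<in>space M. \<forall>k. jump_norm k x \<le> K1 * loss k x \<and> (jump_norm k x)\<^sup>2 \<le> K1 * loss k x * energy k x"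
    using jump_norm_loss by (elim exE conjE)
  define B where "B = 2 * C"
  define osc where "osc n x = K0 * (\<Sum>k\<le>n. jump_norm k x * (diameter (cell n x) / diameter (cell k x)))" for n x
  define O' where "O' = K0 * (K1 * B)"
  have osc: "\<bar>piece n (cell n x) y - piece n (cell n x) x\<bar> \<le> osc n x" if "x \<in> space M" "y \<in> cell n x" for n x y
    using osc0 that unfolding osc_def by blast
  have l0: "loss 0 x = 1" for x by (simp add: loss_def)
  have sums: "(\<Sum>k\<le>n. jump_norm k x * (diameter (cell n x) / diameter (cell k x))) \<le> K1 * B"
    "(\<Sum>n<m. loss (Suc n) x * (\<Sum>k\<le>n. jump_norm k x * (diameter (cell n x) / diameter (cell k x)))\<^sup>2)
      \<le> K1 * B * (B\<^sup>2 + 1) * (\<Sum>k<m. energy k x)" if x: "x \<in> space M" for x n m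
    using oscillation_sum_bound[of "\<lambda>n. diameter (cell n x)" "\<lambda>n. loss n x" B "\<lambda>n. jump_norm n x" K1 "\<lambda>n. energy n x",
        OF cell_diameter_pos[OF x] cell_diameter_Suc[OF x] loss_bounds[OF x] l0 loss_weight_bound[OF x, folded B_def]
          jump_norm_nonneg[OF x] N1[rule_format, OF x, THEN conjunct1] N1[rule_format, OF x, THEN conjunct2] energy_nonneg K1]
    by auto
  have oscO: "osc n x \<le> O'" if "x \<in> space M" for x n
    unfolding osc_def O'_def by (intro mult_left_mono sums that K0)
  define m where "m n A = avg (f n) A" for n A
  interpret tree_martingale nu "\<lambda>n. atoms (F n)" m "L / c1 + 2 * O'"
  proof
    show "(\<Sum>B\<in>children n A. measure nu B * m (Suc n) B) = measure nu A * m n A" if "A \<in> atoms (F n)" for A n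
      unfolding m_def by (rule martingale_f[OF that])
    fix A B n assume A: "A \<in> atoms (F n)" and B: "B \<in> children n A"
    then have B': "B \<in> atoms (F (Suc n))" "B \<subseteq> A" by (auto simp: children_def)
    obtain x where x: "x \<in> B" using atom_nonempty[OF B'(1)] by blast
    then have xM: "x \<in> space M" using At_subset_space[OF B'(1)] by blast
    have c: "cell n x = A" "cell (Suc n) x = B" using cell_eq[OF A] cell_eq[OF B'(1)] x B'(2) by auto
    have "\<bar>avg (f (Suc n)) (cell (Suc n) x) - avg (f n) (cell n x)\<bar> \<le> L / c1 + 2 * O'"
      by (rule avg_diff_bound[OF xM order_trans[OF osc[OF xM] oscO[OF xM]]])
    then show "\<bar>m (Suc n) B - m n A\<bar> \<le> L / c1 + 2 * O'" unfolding m_def c .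
  qed
  \<comment> \<open>The constants of \<open>step_variance_bound\<close>, the second multiplied by
    the double-sum constant of \<open>oscillation_sum_bound\<close>. The summand 1 ensures
    \<open>K \<ge> 1\<close>; the absolute value makes the constant visibly nonnegative.\<close>
  define K where "K = 1 + 2 / (c1\<^sup>2 * c2 * c3) + 8 / c3 * (K0\<^sup>2 * (K1 * \<bar>B\<bar> * (B\<^sup>2 + 1)))"
  have parts: "0 \<le> 2 / (c1\<^sup>2 * c2 * c3)" "0 \<le> 8 / c3 * (K0\<^sup>2 * (K1 * \<bar>B\<bar> * (B\<^sup>2 + 1)))"
    using c1_pos c2_pos c3_pos K1 by auto
  have K_ge: "K \<ge> 1" using parts by (simp add: K_def)
  have quad: "quad_var N x \<le> K * square_var M F f N x" if x: "x \<in> space M" for N x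
  proof -
    let ?E = "\<Sum>k\<le>N. energy k x"
    define s where "s n = (\<Sum>k\<le>n. jump_norm k x * (diameter (cell n x) / diameter (cell k x)))" for n
    have osc_s: "osc n x = K0 * s n" for n by (simp only: osc_def s_def)
    have E0: "0 \<le> ?E" by (intro sum_nonneg energy_nonneg)
    have "quad_var N x \<le> (\<Sum>n<N. 2 / (c1\<^sup>2 * c2 * c3) * energy (Suc n) x + 8 / c3 * (loss (Suc n) x * (osc n x)\<^sup>2))"
      unfolding quad_var_def step_var_def m_def
      by (intro sum_mono step_variance_bound[OF x osc[OF x]])
    also have "\<dots> = 2 / (c1\<^sup>2 * c2 * c3) * (\<Sum>n<N. energy (Suc n) x) + 8 / c3 * (K0\<^sup>2 *
        (\<Sum>n<N. loss (Suc n) x * (s n)\<^sup>2))"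
      unfolding osc_s by (simp add: sum.distrib sum_distrib_left sum_divide_distrib power_mult_distrib mult_ac)
    also have "\<dots> \<le> 2 / (c1\<^sup>2 * c2 * c3) * ?E + 8 / c3 * (K0\<^sup>2 * (K1 * \<bar>B\<bar> * (B\<^sup>2 + 1) * ?E))"
    proof (intro add_mono mult_left_mono)
      have "(\<Sum>n<N. energy (Suc n) x) + energy 0 x = ?E"
        using sum.lessThan_Suc_shift[of "\<lambda>k. energy k x" N] by (simp add: lessThan_Suc_atMost add.commute)
      then show "(\<Sum>n<N. energy (Suc n) x) \<le> ?E" using energy_nonneg[of 0 x] by linarith
      have "(\<Sum>k<N. energy k x) \<le> ?E" by (intro sum_mono2) (auto simp: energy_nonneg)
      then have "K1 * B * (B\<^sup>2 + 1) * (\<Sum>k<N. energy k x) \<le> K1 * \<bar>B\<bar> * (B\<^sup>2 + 1) * ?E"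
        using K1 by (intro mult_mono mult_nonneg_nonneg mult_left_mono sum_nonneg energy_nonneg mult_right_mono) auto
      then show "(\<Sum>n<N. loss (Suc n) x * (s n)\<^sup>2) \<le> K1 * \<bar>B\<bar> * (B\<^sup>2 + 1) * ?E"
        unfolding s_def using sums(2)[OF x, of N] by linarith
    qed (use c1_pos c2_pos c3_pos in auto)
    also have "\<dots> = (K - 1) * ?E" unfolding K_def by (simp add: algebra_simps)
    also have "\<dots> \<le> K * ?E" using E0 by (simp add: left_diff_distrib)
    finally show ?thesis unfolding square_var_eq[OF x] .
  qed
  \<comment> \<open>Since \<open>g\<close> is positive on the space, a null set of \<open>nu\<close>
    is also null for \<open>M\<close>.\<close>
  have "AE x in M. 0 < ennreal (g x) \<longrightarrow> (\<forall>V. (\<forall>n. quad_var n x \<le> V n) \<longrightarrow> filterlim V at_top sequentially \<longrightarrow>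
     eventually (\<lambda>n. m n (cell n x) \<le> 5 * sqrt (V n * ln (ln (V n)))) sequentially)"
    using iterated_log_bound unfolding nu_def
    by (subst (asm) AE_density) (use measurable_S[OF g_in] in measurable)
  moreover have "AE x in M. \<forall>n. f n x = piece n (cell n x) x"
    using f_eq_piece by (simp add: AE_all_countable)
  ultimately have "AE x in M. filterlim (\<lambda>n. square_var M F f n x) at_top sequentially \<longrightarrow>
     eventually (\<lambda>n. f n x \<le> 5 * sqrt (K * square_var M F f n x * ln (ln (K * square_var M F f n x))) + O') sequentially"
    using AE_space
  proof eventually_elim
    case (elim x)
    have x: "x \<in> space M" by (rule elim(3))
    show ?case
    proof
      assume lim: "filterlim (\<lambda>n. square_var M F f n x) at_top sequentially"
      have "filterlim (\<lambda>n. K * square_var M F f n x) at_top sequentially"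
        using K_ge by (intro filterlim_tendsto_pos_mult_at_top[OF tendsto_const _ lim]) simp
      moreover have "0 < ennreal (g x)" using g_bounds[OF x] c3_pos by simp
      ultimately have "eventually (\<lambda>n. m n (cell n x) \<le> 5 * sqrt (K * square_var M F f n x * ln (ln (K * square_var M F f n x)))) sequentially"
        using quad[OF x] by (intro elim(1)[rule_format, of "\<lambda>n. K * square_var M F f n x"])
      then show "eventually (\<lambda>n. f n x \<le> 5 * sqrt (K * square_var M F f n x * ln (ln (K * square_var M F f n x))) + O') sequentially"
      proof eventually_elim
        case (elim n)
        have "\<bar>m n (cell n x) - piece n (cell n x) x\<bar> \<le> O'"
          unfolding m_def by (rule avg_f_near[OF x order_trans[OF osc[OF x] oscO[OF x]] cell_At(1)[OF x] order_refl])
        then show ?case using elim \<open>\<forall>n. f n x = piece n (cell n x) x\<close> by (simp add: abs_le_iff)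
      qed
    qed
  qed
  then show ?thesis using K_ge by blast
qed

end

text \<open>In the normalising constant the factor 2 absorbs the passage from
  \<open>ln (ln (K * t))\<close> to \<open>ln (ln t)\<close>, and the summand 1 absorbs the additive
  constant \<open>c\<close>, which is eventually below \<open>sqrt (t * ln (ln t))\<close>.\<close>

lemma limsup_normalized_le_1:
  fixes s h :: "nat \<Rightarrow> real"
  assumes K: "K \<ge> 1" and lim: "filterlim s at_top sequentially"
    and bound: "eventually (\<lambda>n. h n \<le> 5 * sqrt (K * s n * ln (ln (K * s n))) + c) sequentially"
  shows "limsup (\<lambda>n. ereal (h n / sqrt ((5 * sqrt (2 * K) + 1)\<^sup>2 * s n * ln (ln (s n))))) \<le> 1"
proof (rule Limsup_bounded)
  have K0: "K > 0" using K by simp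
  have "eventually (\<lambda>t. ln (ln (K * t)) \<le> 2 * ln (ln t)) at_top"
    using K0 by real_asymp
  moreover have "filterlim (\<lambda>t::real. sqrt (t * ln (ln t))) at_top at_top" by real_asymp
  then have "eventually (\<lambda>t. c \<le> sqrt (t * ln (ln t))) at_top"
    unfolding filterlim_at_top by blast
  moreover have "eventually (\<lambda>t::real. 0 < ln (ln t)) at_top" by real_asymp
  moreover have "eventually (\<lambda>t::real. 0 < t) at_top" by (rule eventually_gt_at_top)
  ultimately have "eventually (\<lambda>t. ln (ln (K * t)) \<le> 2 * ln (ln t) \<and> c \<le> sqrt (t * ln (ln t)) \<and> 0 < ln (ln t) \<and> 0 < t) at_top"
    by eventually_elim auto
  from eventually_compose_filterlim[OF this lim] bound
  show "eventually (\<lambda>n. ereal (h n / sqrt ((5 * sqrt (2 * K) + 1)\<^sup>2 * s n * ln (ln (s n)))) \<le> 1) sequentially"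
  proof eventually_elim
    case (elim n)
    let ?t = "s n" and ?l = "ln (ln (s n))"
    have "K * ?t * ln (ln (K * ?t)) \<le> K * ?t * (2 * ?l)"
      using elim K0 by (intro mult_left_mono) auto
    then have "sqrt (K * ?t * ln (ln (K * ?t))) \<le> sqrt ((2 * K) * (?t * ?l))"
      by (intro real_sqrt_le_mono) (simp add: mult_ac)
    then have "h n \<le> 5 * (sqrt (2 * K) * sqrt (?t * ?l)) + sqrt (?t * ?l)"
      using elim unfolding real_sqrt_mult[of "2 * K"] by linarith
    also have "\<dots> = (5 * sqrt (2 * K) + 1) * sqrt (?t * ?l)" by (simp add: algebra_simps)
    also have "\<dots> = sqrt ((5 * sqrt (2 * K) + 1)\<^sup>2 * (?t * ?l))"
    proof -
      have "0 \<le> 5 * sqrt (2 * K) + 1" using K0 by (intro add_nonneg_nonneg mult_nonneg_nonneg) auto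
      then show ?thesis unfolding real_sqrt_mult[of "(5 * sqrt (2 * K) + 1)\<^sup>2"] by simp
    qed
    finally have le: "h n \<le> sqrt ((5 * sqrt (2 * K) + 1)\<^sup>2 * ?t * ?l)" by (simp add: mult.assoc)
    have "0 < 5 * sqrt (2 * K) + 1" using K0 by (intro add_nonneg_pos mult_nonneg_nonneg) auto
    then have "0 < sqrt ((5 * sqrt (2 * K) + 1)\<^sup>2 * ?t * ?l)" using elim by simp
    then show ?case using le by (simp add: divide_le_eq_1_pos one_ereal_def)
  qed
qed

theorem theorem3p12:
  fixes \<Omega> :: "(real ^ 'd) set"
    and \<mu> :: "(real ^ 'd) measure"
    and F :: "nat \<Rightarrow> (real ^ 'd) measure"
    and S :: "(real ^ 'd \<Rightarrow> real) set"
    and f :: "nat \<Rightarrow> real ^ 'd \<Rightarrow> real"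
    and c1 c2 c3 c4 C\<^sub>D L :: real
  assumes "convex \<Omega>" and "compact \<Omega>"
    and "prob_space \<mu>" and "space \<mu> = \<Omega>" and "sets \<mu> = sets (restrict_space borel \<Omega>)"
    and "binary_filtration \<mu> F"
    and "\<forall>A\<in>all_atoms F. convex A"
    and "(\<lambda>n. Max (diameter ` atoms (F n))) \<longlonglongrightarrow> 0"
    and "c4 > 0" and "\<forall>A\<in>all_atoms F. min_width A \<ge> c4 * diameter A"
    and "finite_dim_space S" and "\<forall>p\<in>S. real_polynomial_function p"
    and "c3 > 0" and "\<exists>g\<in>S. \<forall>x\<in>\<Omega>. c3 \<le> g x \<and> g x \<le> 1"
    and "0 < c1" and "c1 \<le> 1" and "0 < c2" and "c2 \<le> 1"
    and "\<forall>A\<in>all_atoms F. \<forall>p\<in>S.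
           measure \<mu> {x\<in>A. \<bar>p x\<bar> \<ge> c1 * sup_norm_on A p} \<ge> c2 * measure \<mu> A"
    and "smartingale \<mu> F S f"
    and "\<forall>n. AE x in \<mu>. \<bar>increment f n x\<bar> \<le> L"
    and "chain_diam_bound \<mu> F C\<^sub>D"
  shows "\<exists>r>0. AE x in \<mu>. (SUP n. ereal (square_var \<mu> F f n x)) = \<infinity> \<longrightarrow>
           limsup (\<lambda>n. ereal (f n x / sqrt (r * square_var \<mu> F f n x * ln (ln (square_var \<mu> F f n x))))) \<le> 1"
proof -
  obtain g where g: "g \<in> S" "\<forall>x\<in>\<Omega>. c3 \<le> g x \<and> g x \<le> 1" using assms(14) by blast
  interpret prob_space \<mu> by fact
  interpret smartingale_tree \<mu> F S f g c1 c2 c3 c4 C\<^sub>D L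
    by unfold_locales (use assms g in auto)
  obtain K O' where K: "K \<ge> 1" and
    ae: "AE x in \<mu>. filterlim (\<lambda>n. square_var \<mu> F f n x) at_top sequentially \<longrightarrow>
     eventually (\<lambda>n. f n x \<le> 5 * sqrt (K * square_var \<mu> F f n x * ln (ln (K * square_var \<mu> F f n x))) + O') sequentially"
    using smartingale_iterated_log_bound by (elim exE conjE)
  \<comment> \<open>At each point of the space \<open>square_var\<close> is nondecreasing in
    \<open>n\<close>, so an infinite supremum means divergence to infinity.\<close>
  have unbounded: "filterlim (\<lambda>n. square_var \<mu> F f n x) at_top sequentially"
    if x: "x \<in> space \<mu>" and inf: "(SUP n. ereal (square_var \<mu> F f n x)) = \<infinity>" for x
    unfolding filterlim_at_top eventually_sequentially
  proof
    fix Z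
    have "ereal Z < (SUP n. ereal (square_var \<mu> F f n x))" unfolding inf by simp
    then obtain n where n: "Z < square_var \<mu> F f n x" by (auto simp: less_SUP_iff)
    have "Z \<le> square_var \<mu> F f k x" if "n \<le> k" for k
    proof -
      have "square_var \<mu> F f n x \<le> square_var \<mu> F f k x"
        unfolding square_var_eq[OF x] using that by (intro sum_mono2) (auto simp: energy_nonneg)
      then show ?thesis using n by linarith
    qed
    then show "\<exists>N. \<forall>k\<ge>N. Z \<le> square_var \<mu> F f k x" by blast
  qed
  have "AE x in \<mu>. (SUP n. ereal (square_var \<mu> F f n x)) = \<infinity> \<longrightarrow>
     limsup (\<lambda>n. ereal (f n x / sqrt ((5 * sqrt (2 * K) + 1)\<^sup>2 * square_var \<mu> F f n x * ln (ln (square_var \<mu> F f n x))))) \<le> 1"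
    using ae AE_space
  proof eventually_elim
    case (elim x)
    show ?case
    proof
      assume "(SUP n. ereal (square_var \<mu> F f n x)) = \<infinity>"
      then have lim: "filterlim (\<lambda>n. square_var \<mu> F f n x) at_top sequentially" by (rule unbounded[OF elim(2)])
      show "limsup (\<lambda>n. ereal (f n x / sqrt ((5 * sqrt (2 * K) + 1)\<^sup>2 * square_var \<mu> F f n x * ln (ln (square_var \<mu> F f n x))))) \<le> 1"
        using elim(1) lim by (intro limsup_normalized_le_1[OF K lim]) blast
    qed
  qed
  moreover have "0 < (5 * sqrt (2 * K) + 1)\<^sup>2"
    using K by (intro zero_less_power add_nonneg_pos mult_nonneg_nonneg) auto
  ultimately show ?thesis by blast
qed

end
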